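(* Let $\mathcal{H}$ be a separable complex Hilbert space with norm $\|\cdot\|_{\mathcal{H}}$, and let $\{B_r \mid r\in\mathbb{N}\}$ be a countable family of bounded linear operators on $\mathcal{H}$. Suppose there exists an (infinite) orthonormal sequence $\{v_n\}_{n=1}^\infty$ in $\mathcal{H}$ such that $$\sup_{r\in\mathbb{N}}\|B_r^* v_n\|_{\mathcal{H}}\to 0\quad\text{as } n\to\infty .$$ Then there exists a unitary operator $U_\infty:\mathcal{H}\to L_2(\mathbb{R})$ (one and the same for all $r$) such that, for every $r\in\mathbb{N}$, the operator $U_\infty B_r U_\infty^{-1}:L_2(\mathbb{R})\to L_2(\mathbb{R})$ is a Carleman operator having an $SK^\infty$-kernel.
   Context: $\mathbb{N}$ is the set of positive integers; $B^*$ denotes the Hilbert space adjoint of $B$. $L_2=L_2(\mathbb{R})$ is the Hilbert space of (equivalence classes of) measurable complex-valued functions on $\mathbb{R}$ (Lebesgue measure) with inner product $\langle f,g\rangle=\int_{\mathbb{R}} f(s)\overline{g(s)}\,ds$. For a locally compact space $X$ and a Banach space $B$ with norm $\|\cdot\|_B$, $C(X,B)$ denotes the Banach space, with norm $\|f\|_{C(X,B)}=\sup_{x\in X}\|f(x)\|_B$, of continuous $B$-valued functions on $X$ vanishing at infinity, i.e. for each $f\in C(X,B)$ and $\varepsilon>0$ there is a compact subset $X(\varepsilon,f)\subset X$ such that $\|f(x)\|_B<\varepsilon$ whenever $x\notin X(\varepsilon,f)$. A linear operator $T:L_2\to L_2$ is integral if there is a measurable function $\boldsymbol{T}$ on $\mathbb{R}^2$,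 called a kernel of $T$, such that for every $f\in L_2$, $(Tf)(s)=\int_{\mathbb{R}}\boldsymbol{T}(s,t)f(t)\,dt$ for almost every $s\in\mathbb{R}$. A kernel $\boldsymbol{T}$ on $\mathbb{R}^2$ is Carleman if $\boldsymbol{T}(s,\cdot)\in L_2$ for almost every fixed $s\in\mathbb{R}$. An integral operator with a kernel $\boldsymbol{T}$ is called a Carleman operator if $\boldsymbol{T}$ is a Carleman kernel. A Carleman kernel $\boldsymbol{T}$ induces a Carleman function $\boldsymbol{t}$ from $\mathbb{R}$ to $L_2$ by $\boldsymbol{t}(s)=\overline{\boldsymbol{T}(s,\cdot)}$ for all $s\in\mathbb{R}$ for which $\boldsymbol{T}(s,\cdot)\in L_2$. For a non-negative integer $m$, a Carleman kernel $\boldsymbol{K}$ is called an $SK^m$-kernel if: (i) the function $\boldsymbol{K}$ and all its partial derivatives on $\mathbb{R}^2$ up to order $m$ are in $C(\mathbb{R}^2,\mathbb{C})$; (ii) the Carleman function $\boldsymbol{k}$, $\boldsymbol{k}(s)=\overline{\boldsymbol{K}(s,\cdot)}$, and all its (strong, i.e. norm) derivatives on $\mathbb{R}$ up to order $m$ are in $C(\mathbb{R},L_2)$. A function $\boldsymbol{K}$ is called an $SK^\infty$-kernel if it is an $SK^m$-kernel for each non-negative integer $m$. "$T$ is a Carleman operator having an $SK^\infty$-kernel" means that there is an $SK^\infty$-kernel $\boldsymbol{K}$ which is a kernel of the integral operator $T$. *)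

theory Defs
  imports "HOL-Analysis.Analysis"
begin

section \<open>Complex Hilbert spaces\<close>

class scaleC =
  fixes scaleC :: "complex \<Rightarrow> 'a \<Rightarrow> 'a"  (infixr \<open>*\<^sub>C\<close> 75)

text \<open>
  The complex inner product is linear in its first argument.  The real structure
  inherited from \<^class>\<open>real_inner\<close> is the underlying real one, so that the norm is
  induced by the complex inner product, and positive definiteness is inherited.
\<close>

class complex_inner = real_inner + scaleC +
  fixes cinner :: "'a \<Rightarrow> 'a \<Rightarrow> complex"
  assumes scaleC_add_right: "a *\<^sub>C (x + y) = a *\<^sub>C x + a *\<^sub>C y"
    and scaleC_add_left: "(a + b) *\<^sub>C x = a *\<^sub>C x + b *\<^sub>C x"
    and scaleC_scaleC: "a *\<^sub>C (b *\<^sub>C x) = (a * b) *\<^sub>C x"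
    and scaleR_scaleC: "scaleR r x = complex_of_real r *\<^sub>C x"
    and cinner_commute: "cinner x y = cnj (cinner y x)"
    and cinner_add_left: "cinner (x + y) z = cinner x z + cinner y z"
    and cinner_scaleC_left: "cinner (a *\<^sub>C x) y = a * cinner x y"
    and inner_cinner: "inner x y = Re (cinner x y)"

lemma vector_space_scaleC: "vector_space (scaleC :: complex \<Rightarrow> 'a \<Rightarrow> 'a::complex_inner)"
proof
  fix x :: 'a
  show "1 *\<^sub>C x = x"
    using scaleR_scaleC[of 1 x] by simp
qed (simp_all add: scaleC_add_right scaleC_add_left scaleC_scaleC)

lemma cinner_self: "cinner x x = complex_of_real ((norm x)\<^sup>2)"
  by (rule complex_eqI)
    (use cinner_commute[of x x] in \<open>auto simp: dot_square_norm[symmetric] inner_cinner complex_eq_iff\<close>)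

class complex_hilbert_space = complex_inner + complete_space

abbreviation clinear :: "('a::complex_inner \<Rightarrow> 'b::complex_inner) \<Rightarrow> bool"
  where "clinear \<equiv> Vector_Spaces.linear scaleC scaleC"

definition bounded_clinear :: "('a::complex_inner \<Rightarrow> 'b::complex_inner) \<Rightarrow> bool"
  where "bounded_clinear f \<longleftrightarrow> clinear f \<and> bounded_linear f"

text \<open>
  The Hilbert space adjoint, in the style of \<^const>\<open>adjoint\<close>; it is meant for bounded
  operators on a Hilbert space, for which it exists and is unique.
\<close>

definition cadjoint :: "('a::complex_inner \<Rightarrow> 'b::complex_inner) \<Rightarrow> 'b \<Rightarrow> 'a"
  where "cadjoint f = (SOME g. \<forall>x y. cinner (f x) y = cinner x (g y))"

lemma cinner_ext:
  assumes "\<And>x. cinner x y = cinner x z"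
  shows "y = (z::'a::complex_inner)"
proof -
  have "inner x y = inner x z" for x
    by (simp add: inner_cinner assms)
  then show ?thesis
    by (metis inner_commute vector_eq_ldot)
qed

lemma cadjoint_unique:
  assumes "\<forall>x y. cinner (f x) y = cinner x (g y)"
  shows "cadjoint f = g"
proof -
  have "\<forall>x y. cinner (f x) y = cinner x (cadjoint f y)"
    unfolding cadjoint_def by (rule someI[of _ g]) (rule assms)
  then show ?thesis
    using assms by (intro ext cinner_ext) metis
qed

definition unitary :: "('a::complex_inner \<Rightarrow> 'b::complex_inner) \<Rightarrow> bool"
  where "unitary U \<longleftrightarrow> clinear U \<and> bij U \<and> (\<forall>x y. cinner (U x) (U y) = cinner x y)"

definition orthonormal_sequence :: "(nat \<Rightarrow> 'a::complex_inner) \<Rightarrow> bool"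
  where "orthonormal_sequence v \<longleftrightarrow> (\<forall>m n. cinner (v m) (v n) = (if m = n then 1 else 0))"


section \<open>The space of square integrable functions on the real line\<close>

definition square_integrable :: "(real \<Rightarrow> complex) \<Rightarrow> bool"
  where "square_integrable f \<longleftrightarrow>
    f \<in> borel_measurable lebesgue \<and> integrable lebesgue (\<lambda>s. (cmod (f s))\<^sup>2)"

definition L2_rel :: "(real \<Rightarrow> complex) \<Rightarrow> (real \<Rightarrow> complex) \<Rightarrow> bool"
  where "L2_rel f g \<longleftrightarrow>
    square_integrable f \<and> square_integrable g \<and> (AE s in lebesgue. f s = g s)"

lemma square_integrable_zero: "square_integrable (\<lambda>s. 0)"
  by (simp add: square_integrable_def)

lemma square_integrable_mult:
  assumes "square_integrable f"
  shows "square_integrable (\<lambda>s. c * f s)"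
  using assms by (auto simp: square_integrable_def norm_mult power_mult_distrib)

lemma square_integrable_cnj:
  assumes "square_integrable f"
  shows "square_integrable (\<lambda>s. cnj (f s))"
proof -
  have "cnj \<in> borel_measurable borel"
    by (intro borel_measurable_continuous_onI continuous_intros)
  then have "(\<lambda>s. cnj (f s)) \<in> borel_measurable lebesgue"
    using assms unfolding square_integrable_def by (auto intro: measurable_compose)
  with assms show ?thesis
    by (simp add: square_integrable_def)
qed

lemma square_integrable_add:
  assumes "square_integrable f" "square_integrable g"
  shows "square_integrable (\<lambda>s. f s + g s)"
proof -
  have [measurable]: "f \<in> borel_measurable lebesgue" "g \<in> borel_measurable lebesgue"
    using assms by (auto simp: square_integrable_def)
  have "integrable lebesgue (\<lambda>s. 2 * (cmod (f s))\<^sup>2 + 2 * (cmod (g s))\<^sup>2)"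
    using assms by (auto simp: square_integrable_def)
  then have "integrable lebesgue (\<lambda>s. (cmod (f s + g s))\<^sup>2)"
  proof (rule Bochner_Integration.integrable_bound)
    show "AE s in lebesgue. norm ((cmod (f s + g s))\<^sup>2)
        \<le> norm (2 * (cmod (f s))\<^sup>2 + 2 * (cmod (g s))\<^sup>2)"
    proof (rule AE_I2)
      fix s
      have "(cmod (f s + g s))\<^sup>2 \<le> (cmod (f s) + cmod (g s))\<^sup>2"
        by (intro power_mono norm_triangle_ineq) auto
      also have "\<dots> \<le> 2 * (cmod (f s))\<^sup>2 + 2 * (cmod (g s))\<^sup>2"
        using zero_le_power2[of "cmod (f s) - cmod (g s)"]
        by (simp add: power2_sum power2_diff)
      finally show "norm ((cmod (f s + g s))\<^sup>2) \<le> norm (2 * (cmod (f s))\<^sup>2 + 2 * (cmod (g s))\<^sup>2)"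
        by simp
    qed
  qed measurable
  then show ?thesis
    by (simp add: square_integrable_def)
qed

lemma integrable_mult_cnj:
  assumes "square_integrable f" "square_integrable g"
  shows "integrable lebesgue (\<lambda>s. f s * cnj (g s))"
proof -
  have [measurable]: "f \<in> borel_measurable lebesgue" "(\<lambda>s. cnj (g s)) \<in> borel_measurable lebesgue"
    using assms(1) square_integrable_cnj[OF assms(2)] unfolding square_integrable_def by blast+
  have "integrable lebesgue (\<lambda>s. (cmod (f s))\<^sup>2 + (cmod (g s))\<^sup>2)"
    using assms by (auto simp: square_integrable_def)
  then show ?thesis
  proof (rule Bochner_Integration.integrable_bound)
    show "AE s in lebesgue. norm (f s * cnj (g s)) \<le> norm ((cmod (f s))\<^sup>2 + (cmod (g s))\<^sup>2)"
    proof (rule AE_I2)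
      fix s
      have "2 * (cmod (f s) * cmod (g s)) \<le> (cmod (f s))\<^sup>2 + (cmod (g s))\<^sup>2"
        using zero_le_power2[of "cmod (f s) - cmod (g s)"]
        by (simp add: power2_diff)
      moreover have "0 \<le> cmod (f s) * cmod (g s)"
        by simp
      ultimately show "norm (f s * cnj (g s)) \<le> norm ((cmod (f s))\<^sup>2 + (cmod (g s))\<^sup>2)"
        unfolding norm_mult complex_mod_cnj real_norm_def by linarith
    qed
  qed measurable
qed

quotient_type L2 = "real \<Rightarrow> complex" / partial: L2_rel
proof (rule part_equivpI)
  show "\<exists>f. L2_rel f f"
    using square_integrable_zero by (auto simp: L2_rel_def)
  show "symp L2_rel"
    by (auto simp: symp_def L2_rel_def)
  show "transp L2_rel"
    by (auto simp: transp_def L2_rel_def elim: AE_mp)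
qed

instantiation L2 :: complex_inner
begin

lift_definition zero_L2 :: L2 is "\<lambda>s. 0"
  by (simp add: L2_rel_def square_integrable_zero)

lift_definition plus_L2 :: "L2 \<Rightarrow> L2 \<Rightarrow> L2" is "\<lambda>f g s. f s + g s"
  by (auto simp: L2_rel_def intro: square_integrable_add)

lift_definition scaleC_L2 :: "complex \<Rightarrow> L2 \<Rightarrow> L2" is "\<lambda>c f s. c * f s"
  by (auto simp: L2_rel_def intro: square_integrable_mult)

lift_definition cinner_L2 :: "L2 \<Rightarrow> L2 \<Rightarrow> complex"
  is "\<lambda>f g. LINT s|lebesgue. f s * cnj (g s)"
proof -
  fix f f' g g'
  assume *: "L2_rel f f'" "L2_rel g g'"
  show "(LINT s|lebesgue. f s * cnj (g s)) = (LINT s|lebesgue. f' s * cnj (g' s))"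
  proof (rule integral_cong_AE)
    show "AE s in lebesgue. f s * cnj (g s) = f' s * cnj (g' s)"
      using * by (auto simp: L2_rel_def)
  qed (use * in \<open>auto simp: L2_rel_def intro!: borel_measurable_integrable integrable_mult_cnj\<close>)
qed

definition uminus_L2 :: "L2 \<Rightarrow> L2"
  where "uminus_L2 f = (-1) *\<^sub>C f"

definition minus_L2 :: "L2 \<Rightarrow> L2 \<Rightarrow> L2"
  where "minus_L2 f g = f + - g" for f g :: L2

definition scaleR_L2 :: "real \<Rightarrow> L2 \<Rightarrow> L2"
  where "scaleR_L2 r f = complex_of_real r *\<^sub>C f"

definition inner_L2 :: "L2 \<Rightarrow> L2 \<Rightarrow> real"
  where "inner_L2 f g = Re (cinner f g)"

definition norm_L2 :: "L2 \<Rightarrow> real"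
  where "norm_L2 f = sqrt (inner f f)"

definition sgn_L2 :: "L2 \<Rightarrow> L2"
  where "sgn_L2 f = scaleR (inverse (norm f)) f" for f :: L2

definition dist_L2 :: "L2 \<Rightarrow> L2 \<Rightarrow> real"
  where "dist_L2 f g = norm (f - g)"

definition uniformity_L2 :: "(L2 \<times> L2) filter"
  where "uniformity_L2 = (INF e\<in>{0<..}. principal {(x, y). dist x y < e})"

definition open_L2 :: "L2 set \<Rightarrow> bool"
  where "open_L2 U = (\<forall>x\<in>U. eventually (\<lambda>(x', y). x' = x \<longrightarrow> y \<in> U) uniformity)"

lemma L2_algebra:
  fixes f g h :: L2
  shows "f + g + h = f + (g + h)" "f + g = g + f" "0 + f = f" "- f + f = 0"
    "c *\<^sub>C (f + g) = c *\<^sub>C f + c *\<^sub>C g" "(c + d) *\<^sub>C f = c *\<^sub>C f + d *\<^sub>C f"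
    "c *\<^sub>C d *\<^sub>C f = (c * d) *\<^sub>C f" "1 *\<^sub>C f = f"
  unfolding uminus_L2_def
  by (transfer; auto simp: L2_rel_def algebra_simps
      intro!: square_integrable_add square_integrable_mult square_integrable_zero)+

lemma L2_cinner:
  fixes f g h :: L2
  shows "cinner f g = cnj (cinner g f)"
    "cinner (f + g) h = cinner f h + cinner g h"
    "cinner (c *\<^sub>C f) g = c * cinner f g"
  subgoal by transfer (simp add: mult.commute flip: Bochner_Integration.integral_cnj)
  subgoal by transfer (simp add: L2_rel_def integrable_mult_cnj distrib_right)
  subgoal by transfer (simp add: mult.assoc)
  done

lemma L2_positive:
  fixes f :: L2
  shows "0 \<le> Re (cinner f f)" "Re (cinner f f) = 0 \<longleftrightarrow> f = 0"
proof -
  have *: "Re (LINT s|lebesgue. f s * cnj (f s)) = (LINT s|lebesgue. (cmod (f s))\<^sup>2)" for f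
  proof -
    have "(LINT s|lebesgue. f s * cnj (f s)) = (LINT s|lebesgue. complex_of_real ((cmod (f s))\<^sup>2))"
      by (simp add: complex_norm_square del: of_real_power)
    then show ?thesis
      by (simp only: integral_complex_of_real Re_complex_of_real)
  qed
  show "0 \<le> Re (cinner f f)"
    by transfer (simp add: *)
  show "Re (cinner f f) = 0 \<longleftrightarrow> f = 0"
  proof transfer
    fix f assume "L2_rel f f"
    then have "square_integrable f"
      by (simp add: L2_rel_def)
    then show "Re (LINT s|lebesgue. f s * cnj (f s)) = 0 \<longleftrightarrow> L2_rel f (\<lambda>s. 0)"
      unfolding * by (subst integral_nonneg_eq_0_iff_AE)
        (auto simp: square_integrable_def L2_rel_def)
  qed
qed

instance
proof
  fix f g h :: L2 and a b :: real and c d :: complex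
  show "f + g + h = f + (g + h)" "f + g = g + f" "0 + f = f" "- f + f = 0"
    by (rule L2_algebra)+
  show "f - g = f + - g"
    by (rule minus_L2_def)
  show "a *\<^sub>R (f + g) = a *\<^sub>R f + a *\<^sub>R g" "(a + b) *\<^sub>R f = a *\<^sub>R f + b *\<^sub>R f"
    "a *\<^sub>R b *\<^sub>R f = (a * b) *\<^sub>R f" "1 *\<^sub>R f = f"
    by (simp_all add: scaleR_L2_def L2_algebra)
  show "sgn f = inverse (norm f) *\<^sub>R f" "dist f g = norm (f - g)"
    "norm f = sqrt (inner f f)" "inner f g = Re (cinner f g)"
    "a *\<^sub>R f = complex_of_real a *\<^sub>C f"
    by (rule sgn_L2_def dist_L2_def norm_L2_def inner_L2_def scaleR_L2_def)+
  show "(uniformity :: (L2 \<times> L2) filter) = (INF e\<in>{0<..}. principal {(x, y). dist x y < e})"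
    by (rule uniformity_L2_def)
  show "open U = (\<forall>x\<in>U. eventually (\<lambda>(x', y). x' = x \<longrightarrow> y \<in> U) uniformity)" for U :: "L2 set"
    by (rule open_L2_def)
  show "c *\<^sub>C (f + g) = c *\<^sub>C f + c *\<^sub>C g" "(c + d) *\<^sub>C f = c *\<^sub>C f + d *\<^sub>C f"
    "c *\<^sub>C d *\<^sub>C f = (c * d) *\<^sub>C f"
    by (rule L2_algebra)+
  show "cinner f g = cnj (cinner g f)" "cinner (f + g) h = cinner f h + cinner g h"
    "cinner (c *\<^sub>C f) g = c * cinner f g"
    by (rule L2_cinner)+
  show "inner f g = inner g f"
    unfolding inner_L2_def by (subst L2_cinner(1)) simp
  show "inner (f + g) h = inner f h + inner g h" "inner (a *\<^sub>R f) g = a * inner f g"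
    by (simp_all add: inner_L2_def scaleR_L2_def L2_cinner(2,3))
  show "0 \<le> inner f f" "(inner f f = 0) = (f = 0)"
    by (simp_all add: inner_L2_def L2_positive)
qed

end


section \<open>Integral operators and smooth Carleman kernels\<close>

text \<open>
  The choice of representatives made by \<^const>\<open>rep_L2\<close> is immaterial, since both
  conditions below only depend on functions up to null sets.
\<close>

definition is_kernel_of :: "(real \<times> real \<Rightarrow> complex) \<Rightarrow> (L2 \<Rightarrow> L2) \<Rightarrow> bool"
  where "is_kernel_of K T \<longleftrightarrow>
    K \<in> borel_measurable lebesgue \<and>
    (\<forall>f. AE s in lebesgue.
      integrable lebesgue (\<lambda>t. K (s, t) * rep_L2 f t) \<and>
      rep_L2 (T f) s = (LINT t|lebesgue. K (s, t) * rep_L2 f t))"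

definition carleman_kernel :: "(real \<times> real \<Rightarrow> complex) \<Rightarrow> bool"
  where "carleman_kernel K \<longleftrightarrow>
    K \<in> borel_measurable lebesgue \<and> (AE s in lebesgue. square_integrable (\<lambda>t. K (s, t)))"

definition integral_operator :: "(L2 \<Rightarrow> L2) \<Rightarrow> bool"
  where "integral_operator T \<longleftrightarrow> clinear T \<and> (\<exists>K. is_kernel_of K T)"

definition carleman_operator :: "(L2 \<Rightarrow> L2) \<Rightarrow> bool"
  where "carleman_operator T \<longleftrightarrow> integral_operator T \<and> (\<exists>K. carleman_kernel K \<and> is_kernel_of K T)"

text \<open>Only meaningful at those \<open>s\<close> for which \<open>K (s, \<cdot>)\<close> is square integrable.\<close>

definition carleman_function :: "(real \<times> real \<Rightarrow> complex) \<Rightarrow> real \<Rightarrow> L2"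
  where "carleman_function K s = abs_L2 (\<lambda>t. cnj (K (s, t)))"

text \<open>Continuous functions vanishing at infinity.\<close>

definition C0 :: "('a::topological_space \<Rightarrow> 'b::real_normed_vector) set"
  where "C0 = {f. continuous_on UNIV f \<and>
    (\<forall>\<epsilon>>0. \<exists>X. compact X \<and> (\<forall>x. x \<notin> X \<longrightarrow> norm (f x) < \<epsilon>))}"

text \<open>
  \<open>C0_derivs m k\<close>: the function \<open>k\<close> and its norm derivatives up to order \<open>m\<close> exist
  and belong to \<^const>\<open>C0\<close>.
\<close>

fun C0_derivs :: "nat \<Rightarrow> (real \<Rightarrow> 'b::real_normed_vector) \<Rightarrow> bool" where
  "C0_derivs 0 k \<longleftrightarrow> k \<in> C0"
| "C0_derivs (Suc m) k \<longleftrightarrow> k \<in> C0 \<and>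
    (\<exists>k'. (\<forall>s. (k has_vector_derivative k' s) (at s)) \<and> C0_derivs m k')"

text \<open>
  \<open>C0_partial_derivs m K\<close>: the function \<open>K\<close> and all its iterated partial derivatives, pure
  and mixed (in any order of differentiation), of total order up to \<open>m\<close> exist and belong
  to \<^const>\<open>C0\<close>.
\<close>

fun C0_partial_derivs :: "nat \<Rightarrow> (real \<times> real \<Rightarrow> complex) \<Rightarrow> bool" where
  "C0_partial_derivs 0 K \<longleftrightarrow> K \<in> C0"
| "C0_partial_derivs (Suc m) K \<longleftrightarrow> K \<in> C0 \<and>
    (\<exists>K\<^sub>1 K\<^sub>2.
      (\<forall>s t. ((\<lambda>x. K (x, t)) has_vector_derivative K\<^sub>1 (s, t)) (at s)) \<and>
      (\<forall>s t. ((\<lambda>y. K (s, y)) has_vector_derivative K\<^sub>2 (s, t)) (at t)) \<and>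
      C0_partial_derivs m K\<^sub>1 \<and> C0_partial_derivs m K\<^sub>2)"

text \<open>
  Condition (ii) concerns the Carleman function as a function on the whole real line, hence
  all the sections \<open>K (s, \<cdot>)\<close> (and not only almost all of them) have to be square integrable.
\<close>

definition SK_kernel :: "nat \<Rightarrow> (real \<times> real \<Rightarrow> complex) \<Rightarrow> bool"
  where "SK_kernel m K \<longleftrightarrow>
    carleman_kernel K \<and>
    C0_partial_derivs m K \<and>
    (\<forall>s. square_integrable (\<lambda>t. K (s, t))) \<and> C0_derivs m (carleman_function K)"

definition SK_infinity_kernel :: "(real \<times> real \<Rightarrow> complex) \<Rightarrow> bool"
  where "SK_infinity_kernel K \<longleftrightarrow> (\<forall>m. SK_kernel m K)"

end

(*
  Let b(n,m) = <B x_m, x_n> be the matrix of an operator in an orthonormal basis x_n of H, and let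
  U map x_n to smooth functions w_n that form an orthonormal basis of L2.  The kernel of U B U^{-1}
  is the sum of b(n,m) w_n(s) cnj(w_m(t)), and it is an SK-infinity kernel as soon as
    (A) |B^* x_n| sup|w_n^(i)| is summable in n, for each i, and
    (B) |b(n,m)| sup|w_n^(i)| sup|w_m^(j)| = O(2^(-max(n,m))), for all i and j.
  The odd w_n are obtained from very wide Gaussians, so that their derivatives are small even
  against those of all previous basis functions; the even w_n only make the basis total.
  Dually, the even x_n are taken near v_k with k large: since B^* v_k tends to 0 and v_k tends
  weakly to 0, both |B^* x_n| and the entries |<x_n, B^* x_m>|, m < n, can be made as small as
  the already fixed functions w_0, ..., w_n require; the odd x_n only make the basis total.
  Hence every entry is small either by the choice of a vector or by the choice of a function.
  For a fixed operator B_r these smallness conditions are imposed from the step n = r on, which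
  allows countably many operators to be treated at once.
*)

theory Submission
  imports Defs "HOL-Probability.Sinc_Integral" "HOL-Computational_Algebra.Polynomial"
begin

section \<open>Complex inner product spaces\<close>

text \<open>Condition (A) only controls the Carleman function: its series converges in the L2 norm,
  which says nothing about pointwise values or derivatives in the second variable. Those involve the
  derivatives of w_m, for which even indices m offer no a priori bound; this is the obstacle that
  (B) removes. In (B) the larger index N = max(n,m) must pay for the whole entry. If N is odd, the
  sup norms of w_N have been divided in advance by the sum of those of all earlier functions. If N
  is even, the bound \<open>\<eta> N\<close> imposed on x_N contains the square of a common bound
  for w_0, ..., w_N, since two functions occur in the product. Hence the opposite parities, and
  hence the order of construction: the w_n come first and do not refer to any operator, the x_n
  second. Grouping the double series by N leaves at most 2(N+1) terms of size O(2^(-N)) in each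
  group. Smooth elements are also required to be integrable: against an L1 function, uniform
  smallness of the wide Gaussians becomes weak convergence to 0, which Gram-Schmidt needs in order
  to perturb them only slightly.\<close>

instance complex_hilbert_space \<subseteq> banach ..

lemma scaleC_one [simp]: "1 *\<^sub>C x = (x :: 'a::complex_inner)"
  using scaleR_scaleC[of 1 x] by simp

lemma scaleC_zero_left [simp]: "0 *\<^sub>C x = (0 :: 'a::complex_inner)"
  using scaleR_scaleC[of 0 x] by simp

lemma scaleC_minus_one: "(-1) *\<^sub>C x = (- x :: 'a::complex_inner)"
  using scaleR_scaleC[of "-1" x] by simp

lemma cinner_zero_left [simp]: "cinner 0 (y :: 'a::complex_inner) = 0"
  using cinner_add_left[of 0 0 y] by simp

lemma cinner_zero_right [simp]: "cinner (y :: 'a::complex_inner) 0 = 0"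
  by (subst cinner_commute) simp

lemma cinner_add_right: "cinner x (y + z) = cinner x y + cinner x (z :: 'a::complex_inner)"
  by (metis cinner_add_left cinner_commute complex_cnj_add)

lemma cinner_scaleC_right: "cinner x (a *\<^sub>C y) = cnj a * cinner x (y :: 'a::complex_inner)"
  by (metis cinner_commute cinner_scaleC_left complex_cnj_mult)

lemma cinner_diff_left: "cinner (x - y) z = cinner x z - cinner y (z :: 'a::complex_inner)"
  using cinner_add_left[of "x - y" y z] by simp

lemma cinner_diff_right: "cinner z (x - y) = cinner z x - cinner z (y :: 'a::complex_inner)"
  using cinner_add_right[of z "x - y" y] by simp

lemma cinner_sum_left: "cinner (\<Sum>i\<in>A. f i) z = (\<Sum>i\<in>A. cinner (f i) (z :: 'a::complex_inner))"
  by (induction A rule: infinite_finite_induct) (simp_all add: cinner_add_left)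

lemma cinner_sum_right: "cinner z (\<Sum>i\<in>A. f i) = (\<Sum>i\<in>A. cinner z (f i :: 'a::complex_inner))"
  by (induction A rule: infinite_finite_induct) (simp_all add: cinner_add_right)

lemma norm_scaleC [simp]: "norm (a *\<^sub>C x) = cmod a * norm (x :: 'a::complex_inner)"
proof -
  have "complex_of_real ((norm (a *\<^sub>C x))\<^sup>2) = (a * cnj a) * complex_of_real ((norm x)\<^sup>2)"
    by (simp only: cinner_self[symmetric]) (simp add: cinner_scaleC_left cinner_scaleC_right)
  also have "\<dots> = complex_of_real ((cmod a * norm x)\<^sup>2)"
    by (simp only: complex_norm_square[symmetric]) (simp add: power_mult_distrib)
  finally have "(norm (a *\<^sub>C x))\<^sup>2 = (cmod a * norm x)\<^sup>2"
    by (simp only: of_real_eq_iff)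
  then show ?thesis
    by (simp add: power2_eq_iff_nonneg)
qed

text \<open>Rotating x by a phase makes the inner product real and nonnegative, so that the real
  Cauchy-Schwarz inequality applies.\<close>

lemma norm_cinner_le: "cmod (cinner x y) \<le> norm x * norm (y :: 'a::complex_inner)"
proof -
  define u where "u = cnj (sgn (cinner x y))"
  have "cinner (u *\<^sub>C x) y = complex_of_real (cmod (cinner x y))"
    by (cases "cinner x y = 0")
      (simp_all add: u_def cinner_scaleC_left sgn_eq complex_norm_square[symmetric]
        mult.commute[of "cnj _"] power2_eq_square)
  then have "cmod (cinner x y) = inner (u *\<^sub>C x) y"
    by (simp add: inner_cinner)
  also have "\<dots> \<le> norm (u *\<^sub>C x) * norm y"
    by (rule norm_cauchy_schwarz)
  also have "\<dots> \<le> norm x * norm y"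
    by (intro mult_right_mono) (simp_all add: u_def norm_sgn)
  finally show ?thesis .
qed

lemma bounded_bilinear_cinner:
  "bounded_bilinear (cinner :: 'a::complex_inner \<Rightarrow> 'a \<Rightarrow> complex)"
  by unfold_locales
    (auto simp: cinner_add_left cinner_add_right scaleR_scaleC cinner_scaleC_left cinner_scaleC_right
      scaleR_conv_of_real intro!: exI[of _ 1] norm_cinner_le)

lemma bounded_bilinear_scaleC:
  "bounded_bilinear (scaleC :: complex \<Rightarrow> 'a::complex_inner \<Rightarrow> 'a)"
  by unfold_locales
    (auto simp: scaleC_add_left scaleC_add_right scaleC_scaleC scaleR_scaleC mult.commute
      scaleR_conv_of_real intro!: exI[of _ 1])

lemmas sums_cinner_left = bounded_linear.sums[OF bounded_bilinear.bounded_linear_left[OF bounded_bilinear_cinner]]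
lemmas sums_cinner_right = bounded_linear.sums[OF bounded_bilinear.bounded_linear_right[OF bounded_bilinear_cinner]]

lemma clinearI:
  assumes "\<And>x y. f (x + y) = f x + f y" "\<And>a x. f (a *\<^sub>C x) = a *\<^sub>C f x"
  shows "clinear f"
  using assms by (simp add: Vector_Spaces.linear_iff vector_space_scaleC)

lemma clinear_add: "clinear f \<Longrightarrow> f (x + y) = f x + f y"
  by (simp add: Vector_Spaces.linear_iff)

lemma clinear_scaleC: "clinear f \<Longrightarrow> f (a *\<^sub>C x) = a *\<^sub>C f x"
  by (simp add: Vector_Spaces.linear_iff)


section \<open>Orthonormal sequences\<close>

text \<open>Completeness is encoded by a trivial orthogonal complement rather than by a dense span:
  this is the form that Gram-Schmidt passes on and that coefficient comparison uses.\<close>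

definition total_sequence :: "(nat \<Rightarrow> 'a::complex_inner) \<Rightarrow> bool"
  where "total_sequence d \<longleftrightarrow> (\<forall>z. (\<forall>n. cinner z (d n) = 0) \<longrightarrow> z = 0)"

lemma total_sequenceD: "total_sequence d \<Longrightarrow> (\<And>n. cinner z (d n) = 0) \<Longrightarrow> z = 0"
  by (auto simp: total_sequence_def)

lemma total_sequence_eqI:
  assumes "total_sequence d" "\<And>n. cinner y (d n) = cinner z (d n)"
  shows "y = z"
  using total_sequenceD[OF assms(1), of "y - z"] assms(2) by (simp add: cinner_diff_left)

lemma orthonormal_sequence_cinner:
  "orthonormal_sequence e \<Longrightarrow> cinner (e m) (e n) = (if m = n then 1 else 0)"
  by (simp add: orthonormal_sequence_def)

lemma orthonormal_sequence_norm:
  assumes "orthonormal_sequence e"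
  shows "norm (e n) = 1"
  using cinner_self[of "e n"] orthonormal_sequence_cinner[OF assms, of n n]
  by (simp add: power2_eq_1_iff flip: of_real_power)
     (metis norm_ge_zero of_real_1 of_real_eq_iff power2_eq_1_iff zero_le_one not_one_le_zero neg_0_le_iff_le)

lemma cinner_orthonormal_sum:
  assumes "orthonormal_sequence e" "finite A"
  shows "cinner (\<Sum>i\<in>A. c i *\<^sub>C e i) (e m) = (if m \<in> A then c m else 0)"
  using assms(2) by (simp add: cinner_sum_left cinner_scaleC_left
      orthonormal_sequence_cinner[OF assms(1)] if_distrib[of "\<lambda>x. _ * x"] cong: if_cong)

lemma norm_orthonormal_sum:
  assumes "orthonormal_sequence e" "finite A"
  shows "(norm (\<Sum>i\<in>A. c i *\<^sub>C e i))\<^sup>2 = (\<Sum>i\<in>A. (cmod (c i))\<^sup>2)"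
proof -
  have "complex_of_real ((norm (\<Sum>i\<in>A. c i *\<^sub>C e i))\<^sup>2)
      = (\<Sum>m\<in>A. cnj (c m) * cinner (\<Sum>i\<in>A. c i *\<^sub>C e i) (e m))"
    by (simp only: cinner_self[symmetric] cinner_sum_right cinner_scaleC_right)
  also have "\<dots> = complex_of_real (\<Sum>i\<in>A. (cmod (c i))\<^sup>2)"
    by (simp add: cinner_orthonormal_sum[OF assms] complex_norm_square mult.commute
        del: of_real_power)
  finally show ?thesis
    by (simp only: of_real_eq_iff)
qed

text \<open>The cross term \<open>inner x p\<close> and the square of \<open>norm p\<close> are the
  same sum of squared coefficients, so the expanded square collapses.\<close>

lemma bessel_residual:
  assumes "orthonormal_sequence e" "finite A"
  shows "(norm (x - (\<Sum>i\<in>A. cinner x (e i) *\<^sub>C e i)))\<^sup>2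
    = (norm x)\<^sup>2 - (\<Sum>i\<in>A. (cmod (cinner x (e i)))\<^sup>2)"
proof -
  define p where "p = (\<Sum>i\<in>A. cinner x (e i) *\<^sub>C e i)"
  have "inner x p = (\<Sum>i\<in>A. (cmod (cinner x (e i)))\<^sup>2)"
    unfolding inner_cinner p_def cinner_sum_right cinner_scaleC_right
    by (simp add: mult.commute flip: complex_norm_square)
  moreover have "(norm p)\<^sup>2 = (\<Sum>i\<in>A. (cmod (cinner x (e i)))\<^sup>2)"
    unfolding p_def by (rule norm_orthonormal_sum[OF assms])
  moreover have "(norm (x - p))\<^sup>2 = (norm x)\<^sup>2 - 2 * inner x p + (norm p)\<^sup>2"
    by (simp add: power2_norm_eq_inner inner_diff_left inner_diff_right inner_commute)
  ultimately show ?thesis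
    by (simp add: p_def)
qed

lemma bessel:
  assumes "orthonormal_sequence e" "finite A"
  shows "(\<Sum>i\<in>A. (cmod (cinner x (e i)))\<^sup>2) \<le> (norm x)\<^sup>2"
  using bessel_residual[OF assms, of x] by (smt (verit) zero_le_power2)

lemma orthonormal_projection_norm_le:
  assumes "orthonormal_sequence e" "finite A"
  shows "norm (\<Sum>i\<in>A. cinner x (e i) *\<^sub>C e i) \<le> norm x"
  by (rule power2_le_imp_le) (use norm_orthonormal_sum[OF assms] bessel[OF assms, of x] in auto)

lemma bessel_summable:
  assumes "orthonormal_sequence e"
  shows "summable (\<lambda>i. (cmod (cinner x (e i)))\<^sup>2)"
  by (rule summableI_nonneg_bounded[of _ "(norm x)\<^sup>2"]) (auto intro: bessel[OF assms])

text \<open>By Bessel the squared coefficients are the terms of a convergent series.\<close>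

lemma orthonormal_sequence_weakly_null:
  assumes "orthonormal_sequence e"
  shows "(\<lambda>n. cinner (e n) x) \<longlonglongrightarrow> 0"
proof -
  have "(\<lambda>n. sqrt ((cmod (cinner x (e n)))\<^sup>2)) \<longlonglongrightarrow> sqrt 0"
    by (intro tendsto_real_sqrt summable_LIMSEQ_zero bessel_summable assms)
  then have "(\<lambda>n. cmod (cnj (cinner x (e n)))) \<longlonglongrightarrow> 0"
    by simp
  then show ?thesis
    by (simp only: cinner_commute[symmetric] tendsto_norm_zero_iff)
qed

lemma orthonormal_series_summable:
  fixes e :: "nat \<Rightarrow> 'a::complex_hilbert_space"
  assumes "orthonormal_sequence e" "summable (\<lambda>i. (cmod (c i))\<^sup>2)"
  shows "summable (\<lambda>i. c i *\<^sub>C e i)"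
  unfolding summable_Cauchy
proof (intro allI impI)
  fix \<epsilon> :: real
  assume "\<epsilon> > 0"
  then obtain N where N: "\<And>m n. m \<ge> N \<Longrightarrow> norm (\<Sum>i = m..<n. (cmod (c i))\<^sup>2) < \<epsilon>\<^sup>2"
    using assms(2) unfolding summable_Cauchy by (meson zero_less_power)
  have "norm (\<Sum>i = m..<n. c i *\<^sub>C e i) < \<epsilon>" if "m \<ge> N" for m n
  proof (rule power2_less_imp_less)
    show "(norm (\<Sum>i = m..<n. c i *\<^sub>C e i))\<^sup>2 < \<epsilon>\<^sup>2"
      using N[OF that, of n] by (simp add: norm_orthonormal_sum[OF assms(1)] sum_nonneg)
  qed (use \<open>\<epsilon> > 0\<close> in simp)
  then show "\<exists>N. \<forall>m\<ge>N. \<forall>n. norm (\<Sum>i = m..<n. c i *\<^sub>C e i) < \<epsilon>"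
    by blast
qed

lemma cinner_orthonormal_series:
  assumes "orthonormal_sequence e" "(\<lambda>i. c i *\<^sub>C e i) sums y"
  shows "cinner y (e m) = c m"
proof -
  have "(\<lambda>i. cinner (c i *\<^sub>C e i) (e m)) sums cinner y (e m)"
    by (rule sums_cinner_left[OF assms(2)])
  moreover have "cinner (c i *\<^sub>C e i) (e m) = (if i = m then c i else 0)" for i
    by (simp add: cinner_scaleC_left orthonormal_sequence_cinner[OF assms(1)])
  ultimately show ?thesis
    using sums_single[of m c] by (simp add: sums_unique2)
qed

lemma orthonormal_expansion:
  fixes e :: "nat \<Rightarrow> 'a::complex_hilbert_space"
  assumes "orthonormal_sequence e" "total_sequence e"
  shows "(\<lambda>i. cinner x (e i) *\<^sub>C e i) sums x"
proof -
  obtain y where y: "(\<lambda>i. cinner x (e i) *\<^sub>C e i) sums y"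
    using orthonormal_series_summable[OF assms(1) bessel_summable[OF assms(1)]]
    by (auto simp: summable_def)
  have "y = x"
    by (rule total_sequence_eqI[OF assms(2)]) (rule cinner_orthonormal_series[OF assms(1) y])
  with y show ?thesis
    by simp
qed

lemma parseval:
  fixes e :: "nat \<Rightarrow> 'a::complex_hilbert_space"
  assumes "orthonormal_sequence e" "total_sequence e"
  shows "(\<lambda>i. cinner x (e i) * cnj (cinner y (e i))) sums cinner x y"
  using sums_cinner_left[OF orthonormal_expansion[OF assms, of x], of y]
  by (simp add: cinner_scaleC_left cinner_commute[symmetric])

text \<open>U and its inverse V transport the coefficient sequences; linearity and both inverse laws
  are then read off from coefficients by totality, and isometry is Parseval on both sides.\<close>

lemma orthonormal_bases_unitary:
  fixes e :: "nat \<Rightarrow> 'a::complex_hilbert_space" and w :: "nat \<Rightarrow> 'b::complex_hilbert_space"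
  assumes e: "orthonormal_sequence e" "total_sequence e"
    and w: "orthonormal_sequence w" "total_sequence w"
  shows "\<exists>U. unitary U \<and> (\<forall>n. U (e n) = w n)"
proof -
  define U where "U x = (\<Sum>i. cinner x (e i) *\<^sub>C w i)" for x
  define V where "V y = (\<Sum>i. cinner y (w i) *\<^sub>C e i)" for y
  have U: "cinner (U x) (w n) = cinner x (e n)" for x n
    unfolding U_def
    by (intro cinner_orthonormal_series[OF w(1)] summable_sums
        orthonormal_series_summable[OF w(1)] bessel_summable e(1))
  have V: "cinner (V x) (e n) = cinner x (w n)" for x n
    unfolding V_def
    by (intro cinner_orthonormal_series[OF e(1)] summable_sums
        orthonormal_series_summable[OF e(1)] bessel_summable w(1))
  have "clinear U"
    by (intro clinearI total_sequence_eqI[OF w(2)]) (simp_all add: U cinner_add_left cinner_scaleC_left)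
  moreover have "bij U"
  proof (rule o_bij)
    show "V \<circ> U = id"
      by (intro ext total_sequence_eqI[OF e(2)]) (simp add: U V)
    show "U \<circ> V = id"
      by (intro ext total_sequence_eqI[OF w(2)]) (simp add: U V)
  qed
  moreover have "cinner (U x) (U y) = cinner x y" for x y
    using parseval[OF w, of "U x" "U y"] parseval[OF e, of x y] by (simp add: U sums_unique2)
  moreover have "U (e n) = w n" for n
    by (rule total_sequence_eqI[OF w(2)])
      (simp add: U orthonormal_sequence_cinner[OF w(1)] orthonormal_sequence_cinner[OF e(1)])
  ultimately show ?thesis
    unfolding unitary_def by blast
qed

text \<open>\<open>cadjoint\<close> is a choice, so its defining identity requires the existence of
  some adjoint. The candidate g y has the coefficients \<open>cinner y (f (e i))\<close>. They are
  square summable because testing f on their finite sum a gives |a|^2 = |<y, f a>| <= |y| |a|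
  C.\<close>

lemma bounded_clinear_has_adjoint:
  fixes f :: "'a::complex_hilbert_space \<Rightarrow> 'b::complex_inner" and e :: "nat \<Rightarrow> 'a"
  assumes "bounded_clinear f" and e: "orthonormal_sequence e" "total_sequence e"
  shows "cinner (f x) y = cinner x (cadjoint f y)"
proof -
  have lin: "clinear f" and bl: "bounded_linear f"
    using assms(1) by (auto simp: bounded_clinear_def)
  obtain C where C: "\<And>x. norm (f x) \<le> norm x * C"
    using bounded_linear.bounded[OF bl] by blast
  define c where "c y i = cinner y (f (e i))" for y i
  have "summable (\<lambda>i. (cmod (c y i))\<^sup>2)" for y
  proof (rule summableI_nonneg_bounded[of _ "(norm y * C)\<^sup>2"])
    fix n
    define a where "a = (\<Sum>i<n. c y i *\<^sub>C e i)"
    have na: "(norm a)\<^sup>2 = (\<Sum>i<n. (cmod (c y i))\<^sup>2)"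
      unfolding a_def by (rule norm_orthonormal_sum[OF e(1)]) simp
    have "f a = (\<Sum>i<n. c y i *\<^sub>C f (e i))"
      using bounded_linear.linear[OF bl] by (simp add: a_def linear_sum clinear_scaleC[OF lin])
    then have "cinner y (f a) = complex_of_real (\<Sum>i<n. (cmod (c y i))\<^sup>2)"
      by (simp add: cinner_sum_right cinner_scaleC_right c_def[symmetric] complex_norm_square
          mult.commute del: of_real_power)
    then have "(norm a)\<^sup>2 = cmod (cinner y (f a))"
      by (simp only: na norm_of_real) (simp add: sum_nonneg)
    also have "\<dots> \<le> norm y * norm (f a)"
      by (rule norm_cinner_le)
    also have "\<dots> \<le> norm y * (norm a * C)"
      by (intro mult_left_mono C) simp
    finally have *: "norm a * norm a \<le> norm a * (norm y * C)"
      by (simp add: power2_eq_square mult_ac)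
    have "norm a \<le> norm y * C"
    proof (cases "norm a = 0")
      case True
      \<comment> \<open>The sign of C is not part of its choice; evaluating the bound at a unit
        vector shows that C is nonnegative.\<close>
      have "0 \<le> norm (e 0) * C"
        using C[of "e 0"] norm_ge_zero order_trans by blast
      with True show ?thesis
        by (simp add: orthonormal_sequence_norm[OF e(1)])
    qed (use * in \<open>simp add: mult_le_cancel_left\<close>)
    then have "(norm a)\<^sup>2 \<le> (norm y * C)\<^sup>2"
      by (intro power_mono) auto
    then show "(\<Sum>i<n. (cmod (c y i))\<^sup>2) \<le> (norm y * C)\<^sup>2"
      by (simp add: na)
  qed simp
  then have sums: "(\<lambda>i. c y i *\<^sub>C e i) sums (\<Sum>i. c y i *\<^sub>C e i)" for y
    by (intro summable_sums orthonormal_series_summable e(1))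
  define g where "g y = (\<Sum>i. c y i *\<^sub>C e i)" for y
  have "cinner (f x) y = cinner x (g y)" for x y
  proof -
    have "(\<lambda>i. cinner (f (cinner x (e i) *\<^sub>C e i)) y) sums cinner (f x) y"
      by (intro sums_cinner_left bounded_linear.sums[OF bl] orthonormal_expansion e)
    then have "(\<lambda>i. cinner x (e i) * cnj (c y i)) sums cinner (f x) y"
      by (simp add: clinear_scaleC[OF lin] cinner_scaleC_left c_def cinner_commute[symmetric])
    moreover have "(\<lambda>i. cinner x (e i) * cnj (c y i)) sums cinner x (g y)"
      using sums_cinner_right[OF sums, of x y]
      by (simp add: cinner_scaleC_right g_def mult.commute)
    ultimately show ?thesis
      by (simp add: sums_unique2)
  qed
  then show ?thesis
    using cadjoint_unique[of f g] by simp
qed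


section \<open>Gram-Schmidt orthonormalisation along a weakly null sequence\<close>

definition complex_subspace :: "'a::complex_inner set \<Rightarrow> bool"
  where "complex_subspace S \<longleftrightarrow> (\<forall>x\<in>S. \<forall>y\<in>S. x + y \<in> S) \<and> (\<forall>a. \<forall>x\<in>S. a *\<^sub>C x \<in> S)"

text \<open>Relative to S, because \<open>sup_deriv i\<close> behaves as a seminorm only on
  \<open>smooth_L2\<close>.\<close>

definition seminorm_on :: "'a::complex_inner set \<Rightarrow> ('a \<Rightarrow> real) \<Rightarrow> bool"
  where "seminorm_on S p \<longleftrightarrow> (\<forall>x\<in>S. \<forall>y\<in>S. p (x + y) \<le> p x + p y) \<and>
    (\<forall>a. \<forall>x\<in>S. p (a *\<^sub>C x) = cmod a * p x)"

lemma complex_subspace_diff: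
  assumes "complex_subspace S" "x \<in> S" "y \<in> S"
  shows "x - y \<in> S"
proof -
  have "x + (-1) *\<^sub>C y \<in> S"
    using assms unfolding complex_subspace_def by blast
  then show ?thesis
    by (simp add: scaleC_minus_one)
qed

lemma complex_subspace_sum:
  assumes "complex_subspace S" "S \<noteq> {}" "\<And>i. i \<in> A \<Longrightarrow> f i \<in> S"
  shows "(\<Sum>i\<in>A. f i) \<in> S"
proof -
  have "0 \<in> S"
    using assms(1,2) unfolding complex_subspace_def by (metis all_not_in_conv scaleC_zero_left)
  then show ?thesis
    using assms(3) assms(1)
    by (induction A rule: infinite_finite_induct) (auto simp: complex_subspace_def)
qed

lemma seminorm_on_diff_le:
  assumes "complex_subspace S" "seminorm_on S p" "x \<in> S" "y \<in> S"
  shows "p (x - y) \<le> p x + p y"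
proof -
  have "(-1) *\<^sub>C y \<in> S"
    using assms unfolding complex_subspace_def by blast
  then have "p (x + (-1) *\<^sub>C y) \<le> p x + p ((-1) *\<^sub>C y)" "p ((-1) *\<^sub>C y) = p y"
    using assms unfolding seminorm_on_def by (blast, simp)
  then show ?thesis
    by (simp add: scaleC_minus_one)
qed

lemma seminorm_on_sum_le:
  assumes "complex_subspace S" "S \<noteq> {}" "seminorm_on S p" "\<And>i. i \<in> A \<Longrightarrow> f i \<in> S"
  shows "p (\<Sum>i\<in>A. f i) \<le> (\<Sum>i\<in>A. p (f i))"
proof -
  have "p 0 = 0"
    using assms(2,3) unfolding seminorm_on_def
    by (metis all_not_in_conv mult_zero_left norm_zero scaleC_zero_left)
  then show ?thesis
    using assms(4)
  proof (induction A rule: infinite_finite_induct)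
    case (insert i A)
    have "p (f i + sum f A) \<le> p (f i) + p (sum f A)"
      using insert.prems complex_subspace_sum[OF assms(1,2), of A f] assms(3)
      unfolding seminorm_on_def by auto
    with insert show ?case
      by auto
  qed auto
qed

lemma seminorm_on_cinner: "seminorm_on S (\<lambda>x. cmod (cinner x z))"
  by (simp add: seminorm_on_def cinner_add_left cinner_scaleC_left norm_triangle_ineq norm_mult)

lemma seminorm_on_divide:
  assumes "seminorm_on S p" "c > 0"
  shows "seminorm_on S (\<lambda>x. p x / c)"
  using assms by (auto simp: seminorm_on_def add_divide_distrib[symmetric] divide_right_mono)

definition orthonormal_upto :: "nat \<Rightarrow> (nat \<Rightarrow> 'a::complex_inner) \<Rightarrow> bool"
  where "orthonormal_upto n x \<longleftrightarrow> (\<forall>i<n. \<forall>j<n. cinner (x i) (x j) = (if i = j then 1 else 0))"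

lemma cinner_projection_residual:
  assumes "orthonormal_upto n x" "m < n"
  shows "cinner (d - (\<Sum>i<n. cinner d (x i) *\<^sub>C x i)) (x m) = 0"
proof -
  have "cinner (\<Sum>i<n. cinner d (x i) *\<^sub>C x i) (x m) = (\<Sum>i<n. if i = m then cinner d (x i) else 0)"
    unfolding cinner_sum_left cinner_scaleC_left
    using assms by (intro sum.cong) (auto simp: orthonormal_upto_def)
  then show ?thesis
    using assms(2) by (simp add: cinner_diff_left)
qed

text \<open>Far out, y k is almost a unit vector and almost orthogonal to the finitely many x m, so
  removing its projection q k changes neither the norm nor the seminorms much. With norm above 1/2
  and seminorms below 1/2, normalisation leaves every seminorm at most 1.\<close>

lemma weakly_null_perturbation:
  assumes S: "complex_subspace S"
    and x: "\<And>m. m < n \<Longrightarrow> x m \<in> S" "orthonormal_upto n x"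
    and y: "\<And>k. y k \<in> S" "(\<lambda>k. norm (y k)) \<longlonglongrightarrow> 1" "\<And>m. m < n \<Longrightarrow> (\<lambda>k. cinner (y k) (x m)) \<longlonglongrightarrow> 0"
    and J: "finite J" "\<And>p. p \<in> J \<Longrightarrow> seminorm_on S p" "\<And>p. p \<in> J \<Longrightarrow> (\<lambda>k. p (y k)) \<longlonglongrightarrow> 0"
  shows "\<exists>z\<in>S. norm z = 1 \<and> (\<forall>m<n. cinner z (x m) = 0) \<and> (\<forall>p\<in>J. p z \<le> 1)"
proof -
  define q where "q k = (\<Sum>m<n. cinner (y k) (x m) *\<^sub>C x m)" for k
  define z where "z k = y k - q k" for k
  have ne: "S \<noteq> {}"
    using y(1) by blast
  have term_S: "cinner (y k) (x m) *\<^sub>C x m \<in> S" if "m < n" for k m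
    using S x(1)[OF that] by (auto simp: complex_subspace_def)
  have q_S: "q k \<in> S" for k
    unfolding q_def by (rule complex_subspace_sum[OF S ne]) (use term_S in auto)
  have z_S: "z k \<in> S" for k
    unfolding z_def by (rule complex_subspace_diff[OF S y(1) q_S])
  have lim: "(\<lambda>k. p (y k) + (\<Sum>m<n. cmod (cinner (y k) (x m)) * p (x m))) \<longlonglongrightarrow> 0"
    if "(\<lambda>k. p (y k)) \<longlonglongrightarrow> 0" for p
    by (rule tendsto_eq_intros that tendsto_sum tendsto_mult_left_zero tendsto_norm_zero y(3) | simp)+
  have le: "p (z k) \<le> p (y k) + (\<Sum>m<n. cmod (cinner (y k) (x m)) * p (x m))"
    if p: "seminorm_on S p" for p k
  proof -
    have "p (z k) \<le> p (y k) + p (q k)"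
      unfolding z_def by (rule seminorm_on_diff_le[OF S p y(1) q_S])
    also have "p (q k) \<le> (\<Sum>m<n. p (cinner (y k) (x m) *\<^sub>C x m))"
      unfolding q_def by (rule seminorm_on_sum_le[OF S ne p]) (use term_S in auto)
    also have "\<dots> = (\<Sum>m<n. cmod (cinner (y k) (x m)) * p (x m))"
      by (intro sum.cong) (use p x(1) in \<open>auto simp: seminorm_on_def\<close>)
    finally show ?thesis
      by simp
  qed
  have small: "\<forall>\<^sub>F k in sequentially. p (z k) < 1 / 2" if "p \<in> J" for p
  proof (rule eventually_mono[OF order_tendstoD(2)[OF lim[OF J(3)[OF that]], of "1 / 2"]])
    show "p (z k) < 1 / 2"
      if "p (y k) + (\<Sum>m<n. cmod (cinner (y k) (x m)) * p (x m)) < 1 / 2" for k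
      by (rule le_less_trans[OF le[OF J(2)[OF \<open>p \<in> J\<close>]] that])
  qed simp
  have "norm (q k) \<le> (\<Sum>m<n. cmod (cinner (y k) (x m)) * norm (x m))" for k
    unfolding q_def by (rule order_trans[OF norm_sum]) simp
  moreover have "(\<lambda>k. (\<Sum>m<n. cmod (cinner (y k) (x m)) * norm (x m))) \<longlonglongrightarrow> 0"
    by (rule tendsto_eq_intros tendsto_sum tendsto_mult_left_zero tendsto_norm_zero y(3) | simp)+
  ultimately have "q \<longlonglongrightarrow> 0"
    by (rule Lim_null_comparison[OF always_eventually, rule_format])
  then have "(\<lambda>k. norm (q k)) \<longlonglongrightarrow> 0"
    by (rule tendsto_norm_zero)
  then have "(\<lambda>k. norm (y k) - norm (q k)) \<longlonglongrightarrow> 1 - 0"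
    by (intro tendsto_diff y(2))
  then have "\<forall>\<^sub>F k in sequentially. norm (y k) - norm (q k) > 1 / 2"
    by (rule order_tendstoD) simp
  then have "\<forall>\<^sub>F k in sequentially. norm (z k) > 1 / 2"
    by (rule eventually_mono) (use norm_triangle_ineq2[of "y _" "q _"] in \<open>simp add: z_def, smt (verit)\<close>)
  moreover have "\<forall>\<^sub>F k in sequentially. \<forall>p\<in>J. p (z k) < 1 / 2"
    using small J(1) by (simp add: eventually_ball_finite)
  ultimately have "\<forall>\<^sub>F k in sequentially. norm (z k) > 1 / 2 \<and> (\<forall>p\<in>J. p (z k) < 1 / 2)"
    by (rule eventually_conj)
  then obtain k where k: "norm (z k) > 1 / 2" "\<And>p. p \<in> J \<Longrightarrow> p (z k) < 1 / 2"
    by (auto simp: eventually_sequentially)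
  define u where "u = complex_of_real (1 / norm (z k)) *\<^sub>C z k"
  have "u \<in> S"
    using S z_S by (auto simp: u_def complex_subspace_def)
  moreover have "norm u = 1"
    using k(1) by (auto simp: u_def norm_divide)
  moreover have "\<forall>m<n. cinner u (x m) = 0"
    using cinner_projection_residual[OF x(2)] by (simp add: u_def cinner_scaleC_left z_def q_def)
  moreover have "p u \<le> 1" if "p \<in> J" for p
  proof -
    have "p u = p (z k) / norm (z k)"
      using J(2)[OF that] z_S by (simp add: seminorm_on_def u_def norm_divide)
    also have "\<dots> \<le> 1"
      using k(1) k(2)[OF that] by (simp add: divide_le_eq)
    finally show ?thesis .
  qed
  ultimately show ?thesis
    by blast
qed

text \<open>The new vector is the normalised residual of d. If d already lies in the span of the x
  m, there is no residual, and the spare unit vector u takes its place. That d is captured is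
  recorded through annihilators, to match \<open>total_sequence\<close>.\<close>

lemma gram_schmidt_step:
  assumes S: "complex_subspace S"
    and x: "\<And>m. m < n \<Longrightarrow> x m \<in> S" "orthonormal_upto n x"
    and "d \<in> S"
    and u: "u \<in> S" "norm u = 1" "\<And>m. m < n \<Longrightarrow> cinner u (x m) = 0"
  shows "\<exists>z\<in>S. norm z = 1 \<and> (\<forall>m<n. cinner z (x m) = 0) \<and>
    (\<forall>a. (\<forall>m<n. cinner a (x m) = 0) \<longrightarrow> cinner a z = 0 \<longrightarrow> cinner a d = 0)"
proof -
  define q where "q = (\<Sum>m<n. cinner d (x m) *\<^sub>C x m)"
  have "q \<in> S"
    unfolding q_def
    by (rule complex_subspace_sum[OF S]) (use S x(1) u(1) in \<open>auto simp: complex_subspace_def\<close>)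
  have aq: "cinner a q = 0" if "\<forall>m<n. cinner a (x m) = 0" for a
    unfolding q_def cinner_sum_right cinner_scaleC_right using that by simp
  show ?thesis
  proof (cases "d = q")
    case True
    then show ?thesis
      using u aq by blast
  next
    case False
    define z where "z = complex_of_real (1 / norm (d - q)) *\<^sub>C (d - q)"
    have "z \<in> S"
      using S complex_subspace_diff[OF S \<open>d \<in> S\<close> \<open>q \<in> S\<close>] by (auto simp: z_def complex_subspace_def)
    moreover have "norm z = 1"
      using False by (simp add: z_def norm_divide)
    moreover have "\<forall>m<n. cinner z (x m) = 0"
      using cinner_projection_residual[OF x(2)] by (simp add: z_def cinner_scaleC_left q_def)
    moreover have "cinner a d = 0" if "\<forall>m<n. cinner a (x m) = 0" "cinner a z = 0" for a
      using that(2) False aq[OF that(1)]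
      by (simp add: z_def cinner_scaleC_right cinner_diff_right)
    ultimately show ?thesis
      by blast
  qed
qed

lemma orthonormal_sequenceI:
  assumes "\<And>n. norm (x n) = 1" "\<And>m n. m < n \<Longrightarrow> cinner (x n) (x m) = 0"
  shows "orthonormal_sequence x"
proof -
  have "cinner (x m) (x n) = 0" if "m \<noteq> n" for m n
    using assms(2)[of m n] assms(2)[of n m] that cinner_commute[of "x m" "x n"]
    by (cases m n rule: linorder_cases) auto
  then show ?thesis
    by (auto simp: orthonormal_sequence_def cinner_self assms(1))
qed

text \<open>
  The steps in \<open>G\<close> exhaust the given sequence \<open>d\<close>; the other steps are free, and are used to
  pick a vector near the tail of the weakly null sequence \<open>y\<close>, hence small for finitely many
  seminorms that may depend on the vectors already chosen.
\<close>

lemma interleaved_gram_schmidt: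
  fixes S :: "'a::complex_inner set" and G :: "nat \<Rightarrow> bool"
  assumes S: "complex_subspace S"
    and d: "\<And>n. d n \<in> S"
    and y: "\<And>k. y k \<in> S" "(\<lambda>k. norm (y k)) \<longlonglongrightarrow> 1"
      "\<And>z. z \<in> S \<Longrightarrow> (\<lambda>k. cinner (y k) z) \<longlonglongrightarrow> 0"
    and J: "\<And>n x. (\<And>m. m < n \<Longrightarrow> x m \<in> S) \<Longrightarrow> finite (J n x)"
      "\<And>n x p. (\<And>m. m < n \<Longrightarrow> x m \<in> S) \<Longrightarrow> p \<in> J n x \<Longrightarrow> seminorm_on S p"
      "\<And>n x p. (\<And>m. m < n \<Longrightarrow> x m \<in> S) \<Longrightarrow> p \<in> J n x \<Longrightarrow> (\<lambda>k. p (y k)) \<longlonglongrightarrow> 0"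
    and J_cong: "\<And>n x x'. (\<And>m. m < n \<Longrightarrow> x m = x' m) \<Longrightarrow> J n x = J n x'"
  obtains x where "orthonormal_sequence x" "\<And>n. x n \<in> S"
    "\<And>n a. G n \<Longrightarrow> (\<And>m. m \<le> n \<Longrightarrow> cinner a (x m) = 0) \<Longrightarrow> cinner a (d n) = 0"
    "\<And>n p. \<not> G n \<Longrightarrow> p \<in> J n x \<Longrightarrow> p (x n) \<le> 1"
proof -
  define P where "P x n z \<longleftrightarrow> z \<in> S \<and> norm z = 1 \<and> (\<forall>m<n. cinner z (x m) = 0) \<and>
    (G n \<longrightarrow> (\<forall>a. (\<forall>m<n. cinner a (x m) = 0) \<longrightarrow> cinner a z = 0 \<longrightarrow> cinner a (d n) = 0)) \<and>
    (\<not> G n \<longrightarrow> (\<forall>p\<in>J n x. p z \<le> 1))" for x :: "nat \<Rightarrow> 'a" and n z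
  have "\<exists>x. \<forall>n. P x n (x n)"
  \<comment> \<open>The choice at n must see all earlier vectors, because J depends on them;
    \<open>J_cong\<close> guarantees that it depends on nothing else.\<close>
  proof (rule dependent_wellorder_choice)
    show "P x n z = P x' n z" if "\<And>m. m < n \<Longrightarrow> x m = x' m" for z x x' n
      using that J_cong[of n x x', OF that] by (simp add: P_def)
  next
    fix n x
    assume IH: "\<And>m. m < n \<Longrightarrow> P x m (x m)"
    have x_S: "\<And>m. m < n \<Longrightarrow> x m \<in> S"
      using IH by (auto simp: P_def)
    have orth: "orthonormal_upto n x"
      unfolding orthonormal_upto_def
    proof (intro allI impI)
      fix i j
      assume "i < n" "j < n"
      have *: "cinner (x i) (x j) = 0" if "j < i" "i < n" for i j
        using IH[OF that(2)] that(1) by (auto simp: P_def)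
      have "norm (x i) = 1"
        using IH[OF \<open>i < n\<close>] by (auto simp: P_def)
      then show "cinner (x i) (x j) = (if i = j then 1 else 0)"
        using *[of i j] *[of j i] \<open>i < n\<close> \<open>j < n\<close> cinner_commute[of "x i" "x j"]
        by (cases i j rule: linorder_cases) (auto simp: cinner_self)
    qed
    \<comment> \<open>A small unit vector is produced at every step: it is the new vector at a free
      step and the fallback of Gram-Schmidt at a step in G.\<close>
    obtain u where u: "u \<in> S" "norm u = 1" "\<forall>m<n. cinner u (x m) = 0" "\<forall>p\<in>J n x. p u \<le> 1"
      using weakly_null_perturbation[OF S x_S orth y(1,2) y(3)[OF x_S] J(1)[of n x] J(2)[of n x] J(3)[of n x]] x_S
      by blast
    show "\<exists>z. P x n z"
    proof (cases "G n")
      case True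
      then show ?thesis
        using gram_schmidt_step[OF S x_S orth d[of n] u(1,2)] u(3) unfolding P_def by metis
    next
      case False
      then show ?thesis
        using u unfolding P_def by blast
    qed
  qed
  then obtain x where x: "\<And>n. P x n (x n)"
    by blast
  show thesis
  proof
    show "orthonormal_sequence x"
      using x by (intro orthonormal_sequenceI) (auto simp: P_def)
    show "x n \<in> S" for n
      using x by (simp add: P_def)
    show "cinner a (d n) = 0" if "G n" "\<And>m. m \<le> n \<Longrightarrow> cinner a (x m) = 0" for n a
      using x[of n] that by (simp add: P_def)
    show "p (x n) \<le> 1" if "\<not> G n" "p \<in> J n x" for n p
      using x[of n] that by (simp add: P_def)
  qed
qed

section \<open>Smooth functions vanishing at infinity with all derivatives\<close>

text \<open>All derivatives are carried as one sequence, with F i the derivative of order i of F 0.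
  Statements about every order are then uniform in i, whereas \<open>C0_derivs\<close> asserts
  existence order by order.\<close>

definition smooth_C0 :: "(nat \<Rightarrow> real \<Rightarrow> 'b::real_normed_vector) \<Rightarrow> bool"
  where "smooth_C0 F \<longleftrightarrow>
    (\<forall>i. F i \<in> C0 \<and> (\<forall>s. (F i has_vector_derivative F (Suc i) s) (at s)))"

lemma smooth_C0_imp_C0_derivs:
  assumes "smooth_C0 F"
  shows "C0_derivs m (F i)"
proof (induction m arbitrary: i)
  case (Suc m)
  have "F i \<in> C0" "\<forall>s. (F i has_vector_derivative F (Suc i) s) (at s)"
    using assms by (auto simp: smooth_C0_def)
  with Suc[of "Suc i"] show ?case
    by auto
qed (use assms in \<open>simp add: smooth_C0_def\<close>)

text \<open>In a doubly indexed family, a mixed derivative depends only on how often each variable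
  is differentiated, so the same members serve for every order of differentiation.\<close>

lemma C0_partial_derivs_family:
  assumes "\<And>i j. K i j \<in> C0"
    "\<And>i j s t. ((\<lambda>x. K i j (x, t)) has_vector_derivative K (Suc i) j (s, t)) (at s)"
    "\<And>i j s t. ((\<lambda>y. K i j (s, y)) has_vector_derivative K i (Suc j) (s, t)) (at t)"
  shows "C0_partial_derivs m (K i j)"
proof (induction m arbitrary: i j)
  case (Suc m)
  show ?case
    unfolding C0_partial_derivs.simps
    by (intro conjI exI[of _ "K (Suc i) j"] exI[of _ "K i (Suc j)"] allI assms Suc)
qed (use assms(1) in simp)

lemma C0_continuous: "f \<in> C0 \<Longrightarrow> continuous_on UNIV f"
  by (simp add: C0_def)

lemma C0_D:
  assumes "f \<in> C0" "\<epsilon> > 0"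
  obtains X where "compact X" "\<And>x. x \<notin> X \<Longrightarrow> norm (f x) < \<epsilon>"
  using assms unfolding C0_def by blast

lemma C0_bounded:
  assumes "f \<in> C0"
  obtains B where "\<And>x. norm (f x) \<le> B"
proof -
  obtain X where X: "compact X" "\<And>x. x \<notin> X \<Longrightarrow> norm (f x) < 1"
    using C0_D[OF assms, of 1] by auto
  have "bounded (f ` X)"
    using X(1) C0_continuous[OF assms]
    by (intro compact_imp_bounded compact_continuous_image) (auto intro: continuous_on_subset)
  then obtain B where B: "\<And>x. x \<in> X \<Longrightarrow> norm (f x) \<le> B"
    unfolding bounded_iff by blast
  have "norm (f x) \<le> max B 1" for x
    using B[of x] X(2)[of x] by (cases "x \<in> X") auto
  then show thesis
    using that by blast
qed

lemma C0_bdd_above: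
  assumes "f \<in> C0"
  shows "bdd_above (range (\<lambda>x. norm (f x)))"
  using C0_bounded[OF assms] by (metis bdd_aboveI2)

lemma C0_zero: "(\<lambda>x. 0) \<in> C0"
  unfolding C0_def by (auto intro: exI[of _ "{}"])

lemma C0_add:
  assumes "f \<in> C0" "g \<in> C0"
  shows "(\<lambda>x. f x + g x) \<in> C0"
  unfolding C0_def
proof (intro CollectI conjI allI impI)
  show "continuous_on UNIV (\<lambda>x. f x + g x)"
    using assms by (intro continuous_intros C0_continuous)
  fix \<epsilon> :: real
  assume "\<epsilon> > 0"
  then obtain X Y where "compact X" "\<And>x. x \<notin> X \<Longrightarrow> norm (f x) < \<epsilon> / 2"
    "compact Y" "\<And>x. x \<notin> Y \<Longrightarrow> norm (g x) < \<epsilon> / 2"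
    using C0_D[OF assms(1), of "\<epsilon> / 2"] C0_D[OF assms(2), of "\<epsilon> / 2"] by (metis half_gt_zero)
  then show "\<exists>X. compact X \<and> (\<forall>x. x \<notin> X \<longrightarrow> norm (f x + g x) < \<epsilon>)"
    by (intro exI[of _ "X \<union> Y"])
      (use norm_add_less[of "f _" "\<epsilon> / 2" "g _" "\<epsilon> / 2"] in \<open>auto simp: compact_Un\<close>)
qed

lemma C0_sum:
  assumes "\<And>i. i \<in> A \<Longrightarrow> f i \<in> C0"
  shows "(\<lambda>x. \<Sum>i\<in>A. f i x) \<in> C0"
  using assms by (induction A rule: infinite_finite_induct) (auto intro: C0_zero C0_add)

lemma C0_norm_le:
  assumes "f \<in> C0" "continuous_on UNIV g" "\<And>x. norm (g x) \<le> c * norm (f x)"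
  shows "g \<in> C0"
  unfolding C0_def
proof (intro CollectI conjI allI impI assms(2))
  fix \<epsilon> :: real
  assume "\<epsilon> > 0"
  \<comment> \<open>The constant c may be zero or negative; b is a positive substitute by which
    \<epsilon> can be divided.\<close>
  define b where "b = max c 1"
  have b: "b > 0" "norm (g x) \<le> b * norm (f x)" for x
    using order_trans[OF assms(3) mult_right_mono[of c b "norm (f x)"]] by (auto simp: b_def)
  obtain X where X: "compact X" "\<And>x. x \<notin> X \<Longrightarrow> norm (f x) < \<epsilon> / b"
    using C0_D[OF assms(1), of "\<epsilon> / b"] \<open>\<epsilon> > 0\<close> b(1) by auto
  have "norm (g x) < \<epsilon>" if "x \<notin> X" for x
    using le_less_trans[OF b(2), of x \<epsilon>] X(2)[OF that] b(1) by (simp add: field_simps)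
  with X(1) show "\<exists>X. compact X \<and> (\<forall>x. x \<notin> X \<longrightarrow> norm (g x) < \<epsilon>)"
    by blast
qed

section \<open>Uniform limits, series and termwise differentiation\<close>

lemma C0_uniform_limit:
  assumes "\<And>n. f n \<in> C0" "uniform_limit UNIV f g sequentially"
  shows "g \<in> C0"
  unfolding C0_def
proof (intro CollectI conjI allI impI)
  show "continuous_on UNIV g"
    by (rule uniform_limit_theorem[OF _ assms(2)]) (simp_all add: C0_continuous assms(1))
  fix \<epsilon> :: real
  assume "\<epsilon> > 0"
  then have "\<forall>\<^sub>F n in sequentially. \<forall>x\<in>UNIV. dist (f n x) (g x) < \<epsilon> / 2"
    using assms(2) half_gt_zero unfolding uniform_limit_iff by blast
  then obtain n where n: "\<And>x. dist (f n x) (g x) < \<epsilon> / 2"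
    by (auto simp: eventually_sequentially)
  obtain X where X: "compact X" "\<And>x. x \<notin> X \<Longrightarrow> norm (f n x) < \<epsilon> / 2"
    using C0_D[OF assms(1), of "\<epsilon> / 2"] \<open>\<epsilon> > 0\<close> by auto
  have "norm (g x) < \<epsilon>" if "x \<notin> X" for x
    using n[of x] X(2)[OF that] norm_triangle_ineq4[of "f n x" "f n x - g x"] by (simp add: dist_norm)
  with X(1) show "\<exists>X. compact X \<and> (\<forall>x. x \<notin> X \<longrightarrow> norm (g x) < \<epsilon>)"
    by blast
qed

text \<open>The majorant is required only from N on, since the decay of the matrix entries starts at
  an index that depends on the operator and on the orders of differentiation.\<close>

lemma eventually_bounded_series_uniform_limit:
  fixes f :: "nat \<Rightarrow> 'a \<Rightarrow> 'b::banach"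
  assumes "\<And>n x. n \<ge> N \<Longrightarrow> norm (f n x) \<le> b n" "summable b"
  shows "uniform_limit UNIV (\<lambda>n x. \<Sum>k<n. f k x) (\<lambda>x. \<Sum>k. f k x) sequentially"
    and "summable (\<lambda>n. f n x)"
proof -
  have 1: "\<forall>\<^sub>F n in sequentially. \<forall>x\<in>UNIV. norm (f n x) \<le> b n"
    using assms(1) by (auto simp: eventually_sequentially)
  show "uniform_limit UNIV (\<lambda>n x. \<Sum>k<n. f k x) (\<lambda>x. \<Sum>k. f k x) sequentially"
    by (rule Weierstrass_m_test_ev[OF 1 assms(2)])
  show "summable (\<lambda>n. f n x)"
    by (rule summable_comparison_test'[OF assms(2)]) (use assms(1) in auto)
qed

lemma C0_suminf:
  fixes f :: "nat \<Rightarrow> 'a::topological_space \<Rightarrow> 'b::banach"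
  assumes "\<And>n. f n \<in> C0" "\<And>n x. n \<ge> N \<Longrightarrow> norm (f n x) \<le> b n" "summable b"
  shows "(\<lambda>x. \<Sum>k. f k x) \<in> C0"
  by (rule C0_uniform_limit[OF _ eventually_bounded_series_uniform_limit(1)[OF assms(2,3)]])
    (auto intro: C0_sum assms(1))

lemma has_vector_derivative_suminf:
  fixes f :: "nat \<Rightarrow> real \<Rightarrow> 'b::banach"
  assumes der: "\<And>n s. (f n has_vector_derivative f' n s) (at s)"
    and f: "\<And>n s. n \<ge> N \<Longrightarrow> norm (f n s) \<le> b n" "summable b"
    and f': "\<And>n s. n \<ge> N' \<Longrightarrow> norm (f' n s) \<le> b' n" "summable b'"
  shows "((\<lambda>s. \<Sum>n. f n s) has_vector_derivative (\<Sum>n. f' n s)) (at s)"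
proof -
  define g' where "g' s = (\<Sum>n. f' n s)" for s
  have ul: "uniform_limit UNIV (\<lambda>n x. \<Sum>k<n. f' k x) g' sequentially"
    unfolding g'_def by (rule eventually_bounded_series_uniform_limit(1)[OF f'])
  have "\<exists>g. \<forall>x\<in>UNIV. (\<lambda>n. f n x) sums g x \<and> (g has_derivative (\<lambda>h. h *\<^sub>R g' x)) (at x within UNIV)"
  proof (rule has_derivative_series)
    show "(f n has_derivative (\<lambda>h. h *\<^sub>R f' n x)) (at x within UNIV)" for n x
      using der[of n x] by (simp add: has_vector_derivative_def)
    show "(\<lambda>n. f n 0) sums (\<Sum>n. f n 0)"
      by (rule summable_sums[OF eventually_bounded_series_uniform_limit(2)[OF f]])
    fix e :: real
    assume "e > 0"
    then have "\<forall>\<^sub>F n in sequentially. \<forall>x\<in>UNIV. dist (\<Sum>k<n. f' k x) (g' x) < e"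
      using ul unfolding uniform_limit_iff by blast
    then show "\<forall>\<^sub>F n in sequentially. \<forall>x\<in>UNIV. \<forall>h. norm ((\<Sum>i<n. h *\<^sub>R f' i x) - h *\<^sub>R g' x) \<le> e * norm h"
    proof (rule eventually_mono, intro ballI allI)
      fix n x h
      assume "\<forall>x\<in>UNIV. dist (\<Sum>k<n. f' k x) (g' x) < e"
      then have "norm ((\<Sum>k<n. f' k x) - g' x) \<le> e"
        by (auto simp: dist_norm intro: less_imp_le)
      moreover have "(\<Sum>i<n. h *\<^sub>R f' i x) - h *\<^sub>R g' x = h *\<^sub>R ((\<Sum>k<n. f' k x) - g' x)"
        by (simp add: scaleR_sum_right scaleR_diff_right)
      ultimately show "norm ((\<Sum>i<n. h *\<^sub>R f' i x) - h *\<^sub>R g' x) \<le> e * norm h"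
        by (simp add: mult.commute[of e] mult_left_mono)
    qed
  qed simp_all
  then obtain g where g: "\<And>x. (\<lambda>n. f n x) sums g x" "\<And>x. (g has_derivative (\<lambda>h. h *\<^sub>R g' x)) (at x)"
    by auto
  have "g = (\<lambda>s. \<Sum>n. f n s)"
    using g(1) by (auto simp: sums_iff)
  with g(2) show ?thesis
    by (simp add: has_vector_derivative_def g'_def)
qed


section \<open>The space L2\<close>

lemma L2_rel_self: "square_integrable \<phi> \<Longrightarrow> L2_rel \<phi> \<phi>"
  by (simp add: L2_rel_def)

lemma abs_rep_L2 [simp]: "abs_L2 (rep_L2 f) = f"
  by (rule Quotient3_abs_rep[OF Quotient3_L2])

lemma square_integrable_rep_L2: "square_integrable (rep_L2 f)"
  using Quotient3_rep_reflp[OF Quotient3_L2] by (auto simp: L2_rel_def)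

lemma rep_abs_L2:
  assumes "square_integrable \<phi>"
  shows "AE s in lebesgue. rep_L2 (abs_L2 \<phi>) s = \<phi> s"
  using rep_abs_rsp_left[OF Quotient3_L2, of \<phi> \<phi>] L2_rel_self[OF assms] by (auto simp: L2_rel_def)

lemma abs_L2_eqI:
  assumes "square_integrable \<phi>" "square_integrable \<psi>" "AE s in lebesgue. \<phi> s = \<psi> s"
  shows "abs_L2 \<phi> = abs_L2 \<psi>"
  using Quotient3_rel_abs[OF Quotient3_L2] assms by (auto simp: L2_rel_def)

lemma abs_L2_eqD:
  assumes "square_integrable \<phi>" "square_integrable \<psi>" "abs_L2 \<phi> = abs_L2 \<psi>"
  shows "AE s in lebesgue. \<phi> s = \<psi> s"
  using rep_abs_L2[OF assms(1)] rep_abs_L2[OF assms(2)] unfolding assms(3) by eventually_elim simp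

lemma square_integrable_diff:
  assumes "square_integrable f" "square_integrable g"
  shows "square_integrable (\<lambda>s. f s - g s)"
  using square_integrable_add[OF assms(1) square_integrable_mult[OF assms(2), of "-1"]] by simp

lemma square_integrable_sum:
  "(\<And>i. i \<in> A \<Longrightarrow> square_integrable (f i)) \<Longrightarrow> square_integrable (\<lambda>s. \<Sum>i\<in>A. f i s)"
  by (induction A rule: infinite_finite_induct)
    (auto intro: square_integrable_zero square_integrable_add)

lemma abs_L2_zero: "abs_L2 (\<lambda>s. 0) = 0"
  by (simp add: zero_L2_def)

lemma abs_L2_add:
  "square_integrable f \<Longrightarrow> square_integrable g \<Longrightarrow> abs_L2 (\<lambda>s. f s + g s) = abs_L2 f + abs_L2 g"
  by (simp add: plus_L2.abs_eq L2_rel_self)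

lemma abs_L2_scaleC:
  "square_integrable f \<Longrightarrow> abs_L2 (\<lambda>s. c * f s) = c *\<^sub>C abs_L2 f"
  by (simp add: scaleC_L2.abs_eq L2_rel_self)

lemma abs_L2_diff:
  assumes "square_integrable f" "square_integrable g"
  shows "abs_L2 (\<lambda>s. f s - g s) = abs_L2 f - abs_L2 g"
  using abs_L2_add[OF assms(1) square_integrable_mult[OF assms(2), of "-1"]]
  by (simp only: abs_L2_scaleC[OF assms(2)] scaleC_minus_one) simp

lemma abs_L2_sum:
  "(\<And>i. i \<in> A \<Longrightarrow> square_integrable (f i)) \<Longrightarrow>
    abs_L2 (\<lambda>s. \<Sum>i\<in>A. f i s) = (\<Sum>i\<in>A. abs_L2 (f i))"
  by (induction A rule: infinite_finite_induct)
    (auto simp: abs_L2_zero abs_L2_add square_integrable_sum)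

lemma cinner_abs_L2:
  "square_integrable f \<Longrightarrow> square_integrable g \<Longrightarrow>
    cinner (abs_L2 f) (abs_L2 g) = (LINT s|lebesgue. f s * cnj (g s))"
  by (simp add: cinner_L2.abs_eq L2_rel_self)

lemma norm_abs_L2:
  assumes "square_integrable f"
  shows "(norm (abs_L2 f))\<^sup>2 = (LINT s|lebesgue. (cmod (f s))\<^sup>2)"
proof -
  have "complex_of_real ((norm (abs_L2 f))\<^sup>2) = (LINT s|lebesgue. complex_of_real ((cmod (f s))\<^sup>2))"
    by (simp only: cinner_self[symmetric] cinner_abs_L2[OF assms assms] complex_norm_square)
  then show ?thesis
    by (simp only: integral_complex_of_real of_real_eq_iff)
qed

lemma nn_norm_abs_L2:
  assumes "square_integrable f"
  shows "(\<integral>\<^sup>+s. ennreal ((cmod (f s))\<^sup>2) \<partial>lebesgue) = ennreal ((norm (abs_L2 f))\<^sup>2)"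
  using assms by (simp add: norm_abs_L2 square_integrable_def nn_integral_eq_integral)

lemma square_integrable_measurable [measurable_dest]:
  "square_integrable f \<Longrightarrow> f \<in> borel_measurable lebesgue"
  by (simp add: square_integrable_def)

lemma square_integrable_AE_eq:
  assumes "square_integrable f" "AE s in lebesgue. f s = g s"
  shows "square_integrable g"
proof -
  have f: "f \<in> borel_measurable lebesgue" "integrable lebesgue (\<lambda>s. (cmod (f s))\<^sup>2)"
    using assms(1) by (auto simp: square_integrable_def)
  have g [measurable]: "g \<in> borel_measurable lebesgue"
    by (rule borel_measurable_AE[OF f(1) assms(2)])
  have "integrable lebesgue (\<lambda>s. (cmod (g s))\<^sup>2)"
    by (rule integrable_cong_AE_imp[OF f(2)]) (use assms(2) in \<open>auto elim: eventually_mono\<close>)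
  with g show ?thesis
    by (simp add: square_integrable_def)
qed

text \<open>Fatou's lemma for the squared differences: the integral of their pointwise limit is at
  most the limit of the squared L2 distances, which is 0. This is how series of L2 elements are
  later identified with pointwise sums.\<close>

lemma L2_limit_AE_eq_pointwise_limit:
  assumes \<phi>: "\<And>n. square_integrable (\<phi> n)"
    and lim: "(\<lambda>n. abs_L2 (\<phi> n)) \<longlonglongrightarrow> f"
    and ptw: "AE s in lebesgue. (\<lambda>n. \<phi> n s) \<longlonglongrightarrow> \<psi> s"
  shows "AE s in lebesgue. rep_L2 f s = \<psi> s"
proof -
  define g where "g n s = ennreal ((cmod (\<phi> n s - rep_L2 f s))\<^sup>2)" for n s
  have sq: "square_integrable (\<lambda>s. \<phi> n s - rep_L2 f s)" for n
    by (intro square_integrable_diff \<phi> square_integrable_rep_L2)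
  have g_meas [measurable]: "g n \<in> borel_measurable lebesgue" for n
    unfolding g_def using square_integrable_measurable[OF sq[of n]] by measurable
  have "(\<integral>\<^sup>+s. g n s \<partial>lebesgue) = ennreal ((norm (abs_L2 (\<phi> n) - f))\<^sup>2)" for n
    unfolding g_def nn_norm_abs_L2[OF sq] abs_L2_diff[OF \<phi> square_integrable_rep_L2] by simp
  moreover have "(\<lambda>n. ennreal ((norm (abs_L2 (\<phi> n) - f))\<^sup>2)) \<longlonglongrightarrow> ennreal (0\<^sup>2)"
    by (intro tendsto_ennrealI tendsto_power tendsto_norm_zero LIM_zero lim)
  ultimately have "(\<lambda>n. \<integral>\<^sup>+s. g n s \<partial>lebesgue) \<longlonglongrightarrow> 0"
    by simp
  then have "liminf (\<lambda>n. \<integral>\<^sup>+s. g n s \<partial>lebesgue) = 0"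
    by (simp add: lim_imp_Liminf)
  then have "(\<integral>\<^sup>+s. liminf (\<lambda>n. g n s) \<partial>lebesgue) = 0"
    using nn_integral_liminf[of g lebesgue] g_meas by simp
  then have "AE s in lebesgue. liminf (\<lambda>n. g n s) = 0"
    by (subst (asm) nn_integral_0_iff_AE) auto
  then show ?thesis
    using ptw
  proof eventually_elim
    case (elim s)
    have "(\<lambda>n. g n s) \<longlonglongrightarrow> ennreal ((cmod (\<psi> s - rep_L2 f s))\<^sup>2)"
      unfolding g_def by (intro tendsto_intros tendsto_ennrealI elim)
    then have "liminf (\<lambda>n. g n s) = ennreal ((cmod (\<psi> s - rep_L2 f s))\<^sup>2)"
      by (simp add: lim_imp_Liminf)
    with elim(1) show ?case
      by simp
  qed
qed

section \<open>Completeness of L2\<close>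

lemma integrable_inverse_1_plus_square_lebesgue: "integrable lebesgue (\<lambda>x::real. inverse (1 + x\<^sup>2))"
proof -
  have "integrable lborel (\<lambda>x::real. inverse (1 + x\<^sup>2))"
    using integrable_inverse_1_plus_square by (simp add: set_integrable_def)
  then show ?thesis
    by (simp add: integrable_completion)
qed

lemma square_integrable_bounded_integrable:
  assumes "integrable lebesgue f" "\<And>s. cmod (f s) \<le> B"
  shows "square_integrable f"
proof -
  have [measurable]: "f \<in> borel_measurable lebesgue"
    using assms(1) by (rule borel_measurable_integrable)
  have "integrable lebesgue (\<lambda>s. B * cmod (f s))"
    using assms(1) by simp
  then have "integrable lebesgue (\<lambda>s. (cmod (f s))\<^sup>2)"
  proof (rule Bochner_Integration.integrable_bound)
    show "AE s in lebesgue. norm ((cmod (f s))\<^sup>2) \<le> norm (B * cmod (f s))"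
    proof (rule AE_I2)
      fix s
      have "(cmod (f s))\<^sup>2 \<le> B * cmod (f s)"
        unfolding power2_eq_square by (intro mult_right_mono assms(2)) simp
      then show "norm ((cmod (f s))\<^sup>2) \<le> norm (B * cmod (f s))"
        by simp
    qed
  qed measurable
  then show ?thesis
    by (simp add: square_integrable_def)
qed

lemma square_integrable_inverse_1_plus_square:
  "square_integrable (\<lambda>x. complex_of_real (inverse (1 + x\<^sup>2)))"
  by (rule square_integrable_bounded_integrable[of _ 1])
    (simp_all add: integrable_inverse_1_plus_square_lebesgue norm_inverse inverse_le_1_iff
      del: of_real_inverse)

lemma square_integrable_cmod:
  assumes "square_integrable f"
  shows "square_integrable (\<lambda>s. complex_of_real (cmod (f s)))"
proof -
  have [measurable]: "f \<in> borel_measurable lebesgue"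
    by (rule square_integrable_measurable[OF assms])
  have "(\<lambda>s. complex_of_real (cmod (f s))) \<in> borel_measurable lebesgue"
    by measurable
  with assms show ?thesis
    by (simp add: square_integrable_def)
qed

text \<open>Cauchy-Schwarz applied to the moduli of f and g, which have the same L2 norms as f and
  g.\<close>

lemma integral_cmod_mult_le:
  assumes f: "square_integrable f" and g: "square_integrable g"
  shows "(LINT s|lebesgue. cmod (f s * g s)) \<le> norm (abs_L2 f) * norm (abs_L2 g)"
proof -
  let ?f = "\<lambda>s. complex_of_real (cmod (f s))" and ?g = "\<lambda>s. complex_of_real (cmod (g s))"
  have "norm (abs_L2 (\<lambda>s. complex_of_real (cmod (h s)))) = norm (abs_L2 h)"
    if "square_integrable h" for h
    by (rule power2_eq_imp_eq)
      (simp_all add: norm_abs_L2[OF square_integrable_cmod[OF that]] norm_abs_L2[OF that])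
  then have "norm (abs_L2 ?f) = norm (abs_L2 f)" "norm (abs_L2 ?g) = norm (abs_L2 g)"
    using f g by blast+
  moreover have "(LINT s|lebesgue. cmod (f s * g s)) \<le> cmod (LINT s|lebesgue. ?f s * cnj (?g s))"
    by (simp add: norm_mult flip: of_real_mult)
  moreover have "(LINT s|lebesgue. ?f s * cnj (?g s)) = cinner (abs_L2 ?f) (abs_L2 ?g)"
    by (rule cinner_abs_L2[symmetric]) (intro square_integrable_cmod f g)+
  ultimately show ?thesis
    using norm_cinner_le[of "abs_L2 ?f" "abs_L2 ?g"] by simp
qed

text \<open>
  Riesz-Fischer: multiplied by a strictly positive square integrable weight, an L2-Cauchy
  sequence becomes L1-Cauchy, hence has a subsequence that converges almost everywhere.
\<close>

instance L2 :: complex_hilbert_space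
proof
  fix X :: "nat \<Rightarrow> L2"
  assume X: "Cauchy X"
  define \<phi> where "\<phi> n = rep_L2 (X n)" for n
  define \<rho> where "\<rho> x = complex_of_real (inverse (1 + x\<^sup>2))" for x :: real
  have \<rho>_pos: "1 + x\<^sup>2 \<noteq> 0" for x :: real
    by (smt (verit) zero_le_power2)
  have \<phi>: "square_integrable (\<phi> n)" for n
    by (simp add: \<phi>_def square_integrable_rep_L2)
  have \<rho>: "square_integrable \<rho>"
    unfolding \<rho>_def[abs_def] by (rule square_integrable_inverse_1_plus_square)
  have \<phi>_diff: "square_integrable (\<lambda>s. \<phi> m s - \<phi> n s)" "abs_L2 (\<lambda>s. \<phi> m s - \<phi> n s) = X m - X n" for m n
    by (simp_all add: square_integrable_diff abs_L2_diff \<phi>) (simp add: \<phi>_def)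
  have "\<exists>r. strict_mono r \<and> (AE x in lebesgue. Cauchy (\<lambda>i. \<rho> x * \<phi> (r i) x))"
  proof (rule cauchy_L1_AE_cauchy_subseq[of lebesgue "\<lambda>n x. \<rho> x * \<phi> n x"])
    show "integrable lebesgue (\<lambda>x. \<rho> x * \<phi> n x)" for n
      using integrable_mult_cnj[OF \<rho> square_integrable_cnj[OF \<phi>]] by simp
    fix e :: real
    assume "e > 0"
    define b where "b = norm (abs_L2 \<rho>) + 1"
    have "b > 0"
      by (simp add: b_def add_nonneg_pos)
    then obtain N where N: "\<And>i j. i \<ge> N \<Longrightarrow> j \<ge> N \<Longrightarrow> norm (X i - X j) < e / b"
      using X \<open>e > 0\<close> unfolding Cauchy_def dist_norm by (meson divide_pos_pos)
    have "(LINT x|lebesgue. norm (\<rho> x * \<phi> i x - \<rho> x * \<phi> j x)) < e" if "i \<ge> N" "j \<ge> N" for i j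
    proof -
      have "(LINT x|lebesgue. norm (\<rho> x * \<phi> i x - \<rho> x * \<phi> j x)) \<le> norm (abs_L2 \<rho>) * norm (X i - X j)"
        using integral_cmod_mult_le[OF \<rho> \<phi>_diff(1)[of i j]] by (simp add: \<phi>_diff(2) right_diff_distrib)
      also have "\<dots> \<le> b * norm (X i - X j)"
        by (simp add: b_def mult_right_mono)
      also have "\<dots> < e"
        using N[OF that] \<open>b > 0\<close> by (simp add: pos_less_divide_eq mult.commute)
      finally show ?thesis .
    qed
    then show "\<exists>N. \<forall>i\<ge>N. \<forall>j\<ge>N. (LINT x|lebesgue. norm (\<rho> x * \<phi> i x - \<rho> x * \<phi> j x)) < e"
      by blast
  qed blast
  then obtain r where r: "strict_mono r" "AE x in lebesgue. Cauchy (\<lambda>i. \<rho> x * \<phi> (r i) x)"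
    by blast
  define \<psi> where "\<psi> x = lim (\<lambda>i. \<phi> (r i) x)" for x
  have \<psi>: "AE x in lebesgue. (\<lambda>i. \<phi> (r i) x) \<longlonglongrightarrow> \<psi> x"
    using r(2)
  proof eventually_elim
    case (elim x)
    then obtain l where "(\<lambda>i. \<rho> x * \<phi> (r i) x) \<longlonglongrightarrow> l"
      by (auto simp: Cauchy_convergent_iff convergent_def)
    then have "(\<lambda>i. inverse (\<rho> x) * (\<rho> x * \<phi> (r i) x)) \<longlonglongrightarrow> inverse (\<rho> x) * l"
      by (intro tendsto_mult tendsto_const)
    moreover have "\<rho> x \<noteq> 0"
      using \<rho>_pos[of x] by (simp add: \<rho>_def del: of_real_inverse)
    ultimately have "(\<lambda>i. \<phi> (r i) x) \<longlonglongrightarrow> inverse (\<rho> x) * l"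
      by (simp add: mult.assoc[symmetric])
    then show ?case
      by (auto simp: \<psi>_def convergent_def convergent_LIMSEQ_iff[symmetric])
  qed
  have [measurable]: "\<phi> n \<in> borel_measurable lebesgue" for n
    by (rule square_integrable_measurable[OF \<phi>])
  have \<psi>_meas [measurable]: "\<psi> \<in> borel_measurable lebesgue"
    unfolding \<psi>_def[abs_def] by measurable
  \<comment> \<open>Fatou along the subsequence bounds the distance of \<phi> m from the pointwise
    limit \<psi>. Stated with nonnegative integrals, the bound yields both the square integrability
    of \<psi> - \<phi> m and the convergence of the whole sequence.\<close>
  have tail: "\<exists>N. \<forall>m\<ge>N. (\<integral>\<^sup>+s. ennreal ((cmod (\<psi> s - \<phi> m s))\<^sup>2) \<partial>lebesgue) \<le> ennreal (e\<^sup>2)"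
    if "e > 0" for e
  proof -
    obtain N where N: "\<And>i j. i \<ge> N \<Longrightarrow> j \<ge> N \<Longrightarrow> norm (X i - X j) < e"
      using CauchyD[OF X \<open>e > 0\<close>] by blast
    have "(\<integral>\<^sup>+s. ennreal ((cmod (\<psi> s - \<phi> m s))\<^sup>2) \<partial>lebesgue) \<le> ennreal (e\<^sup>2)" if "m \<ge> N" for m
    proof -
      have "(\<integral>\<^sup>+s. ennreal ((cmod (\<psi> s - \<phi> m s))\<^sup>2) \<partial>lebesgue)
          = (\<integral>\<^sup>+s. liminf (\<lambda>i. ennreal ((cmod (\<phi> (r i) s - \<phi> m s))\<^sup>2)) \<partial>lebesgue)"
      proof (rule nn_integral_cong_AE, use \<psi> in eventually_elim)
        case (elim s)
        have "(\<lambda>i. ennreal ((cmod (\<phi> (r i) s - \<phi> m s))\<^sup>2)) \<longlonglongrightarrow> ennreal ((cmod (\<psi> s - \<phi> m s))\<^sup>2)"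
          by (intro tendsto_intros tendsto_ennrealI elim)
        from lim_imp_Liminf[OF sequentially_bot this] show ?case
          by (rule sym)
      qed
      also have "\<dots> \<le> liminf (\<lambda>i. \<integral>\<^sup>+s. ennreal ((cmod (\<phi> (r i) s - \<phi> m s))\<^sup>2) \<partial>lebesgue)"
        by (rule nn_integral_liminf) measurable
      also have "\<dots> \<le> ennreal (e\<^sup>2)"
      proof (rule Liminf_le)
        have "(\<integral>\<^sup>+s. ennreal ((cmod (\<phi> (r i) s - \<phi> m s))\<^sup>2) \<partial>lebesgue) \<le> ennreal (e\<^sup>2)" if "i \<ge> N" for i
          unfolding nn_norm_abs_L2[OF \<phi>_diff(1)] \<phi>_diff(2)
          using N[of "r i" m] \<open>m \<ge> N\<close> order_trans[OF that seq_suble[OF r(1)]]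
          by (intro ennreal_leI power_mono) auto
        then show "\<forall>\<^sub>F i in sequentially. (\<integral>\<^sup>+s. ennreal ((cmod (\<phi> (r i) s - \<phi> m s))\<^sup>2) \<partial>lebesgue) \<le> ennreal (e\<^sup>2)"
          by (auto simp: eventually_sequentially)
      qed simp
      finally show ?thesis .
    qed
    then show ?thesis
      by blast
  qed
  have sq: "square_integrable (\<lambda>s. \<psi> s - \<phi> m s)"
    if "(\<integral>\<^sup>+s. ennreal ((cmod (\<psi> s - \<phi> m s))\<^sup>2) \<partial>lebesgue) \<le> ennreal c" for m c
    unfolding square_integrable_def
    by (intro conjI integrableI_nonneg) (use that in \<open>auto intro: le_less_trans\<close>)
  obtain m where m: "square_integrable (\<lambda>s. \<psi> s - \<phi> m s)"
    using tail[OF zero_less_one] sq by blast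
  have \<psi>_sq: "square_integrable \<psi>"
    using square_integrable_add[OF m \<phi>[of m]] by simp
  have "X \<longlonglongrightarrow> abs_L2 \<psi>"
  proof (rule LIMSEQ_I)
    fix e :: real
    assume "e > 0"
    then obtain N where N: "\<And>m. m \<ge> N \<Longrightarrow>
        (\<integral>\<^sup>+s. ennreal ((cmod (\<psi> s - \<phi> m s))\<^sup>2) \<partial>lebesgue) \<le> ennreal ((e / 2)\<^sup>2)"
      using tail[of "e / 2"] by auto
    have "norm (X m - abs_L2 \<psi>) < e" if "m \<ge> N" for m
    proof -
      have "abs_L2 (\<lambda>s. \<psi> s - \<phi> m s) = abs_L2 \<psi> - X m"
        by (simp add: abs_L2_diff \<psi>_sq \<phi>) (simp add: \<phi>_def)
      then have "(norm (abs_L2 \<psi> - X m))\<^sup>2 \<le> (e / 2)\<^sup>2"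
        using N[OF that] nn_norm_abs_L2[OF square_integrable_diff[OF \<psi>_sq \<phi>[of m]]] by simp
      then have "norm (abs_L2 \<psi> - X m) \<le> e / 2"
        using \<open>e > 0\<close> by (simp add: power2_le_iff_abs_le)
      with \<open>e > 0\<close> show ?thesis
        by (simp add: norm_minus_commute)
    qed
    then show "\<exists>N. \<forall>m\<ge>N. norm (X m - abs_L2 \<psi>) < e"
      by blast
  qed
  then show "convergent X"
    by (auto simp: convergent_def)
qed


section \<open>Smooth elements of L2\<close>

text \<open>Integrability has two uses: with boundedness it gives square integrability, and it makes
  inner products with uniformly small functions small.\<close>

definition smooth_L2 :: "L2 set"
  where "smooth_L2 = {abs_L2 (F 0) | F. smooth_C0 F \<and> integrable lebesgue (F 0)}"

text \<open>The choice is unique for elements of \<open>smooth_L2\<close>: continuous functions that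
  agree almost everywhere are equal, and the first function determines its derivatives
  (\<open>smooth_rep_abs_L2\<close>).\<close>

definition smooth_rep :: "L2 \<Rightarrow> nat \<Rightarrow> real \<Rightarrow> complex"
  where "smooth_rep w = (SOME F. smooth_C0 F \<and> integrable lebesgue (F 0) \<and> w = abs_L2 (F 0))"

definition sup_deriv :: "nat \<Rightarrow> L2 \<Rightarrow> real"
  where "sup_deriv i w = (SUP s. cmod (smooth_rep w i s))"

lemma smooth_C0_D:
  assumes "smooth_C0 F"
  shows "F i \<in> C0" "(F i has_vector_derivative F (Suc i) s) (at s)"
  using assms by (auto simp: smooth_C0_def)

text \<open>The set where they differ is open and null, and a nonempty open set has positive
  measure.\<close>

lemma continuous_AE_eq:
  fixes f g :: "real \<Rightarrow> complex"
  assumes "continuous_on UNIV f" "continuous_on UNIV g" "AE s in lebesgue. f s = g s"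
  shows "f = g"
proof -
  define U where "U = {s. f s \<noteq> g s}"
  have "open U"
    unfolding U_def by (rule open_Collect_neq[OF assms(1,2)])
  moreover have "U \<in> null_sets lebesgue"
    using assms(3) \<open>open U\<close> by (subst (asm) AE_iff_null) (auto simp: U_def)
  ultimately have "U = {}"
    using open_not_negligible negligible_iff_null_sets by blast
  then show ?thesis
    by (auto simp: U_def)
qed

lemma smooth_C0_unique:
  fixes F G :: "nat \<Rightarrow> real \<Rightarrow> complex"
  assumes "smooth_C0 F" "smooth_C0 G" "F 0 = G 0"
  shows "F = G"
proof
  fix i
  show "F i = G i"
  proof (induction i)
    case (Suc i)
    show ?case
      using smooth_C0_D(2)[OF assms(1), of i] smooth_C0_D(2)[OF assms(2), of i]
      unfolding Suc by (intro ext) (rule vector_derivative_unique_at)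
  qed (rule assms(3))
qed

lemma smooth_C0_square_integrable:
  assumes "smooth_C0 F" "integrable lebesgue (F 0)"
  shows "square_integrable (F 0)"
  using C0_bounded[OF smooth_C0_D(1)[OF assms(1)], of 0] square_integrable_bounded_integrable[OF assms(2)]
  by metis

lemma smooth_rep_abs_L2:
  assumes "smooth_C0 F" "integrable lebesgue (F 0)"
  shows "smooth_rep (abs_L2 (F 0)) = F"
proof -
  define G where "G = smooth_rep (abs_L2 (F 0))"
  have "\<exists>G. smooth_C0 G \<and> integrable lebesgue (G 0) \<and> abs_L2 (F 0) = abs_L2 (G 0)"
    using assms by blast
  then have G: "smooth_C0 G" "integrable lebesgue (G 0)" "abs_L2 (F 0) = abs_L2 (G 0)"
    unfolding G_def smooth_rep_def by (rule someI2_ex; simp)+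
  have "AE s in lebesgue. F 0 s = G 0 s"
    by (intro abs_L2_eqD smooth_C0_square_integrable assms G)
  then have "F 0 = G 0"
    by (intro continuous_AE_eq C0_continuous smooth_C0_D(1) assms G)
  then show ?thesis
    using smooth_C0_unique[OF assms(1) G(1)] by (simp add: G_def)
qed

lemma smooth_L2I: "smooth_C0 F \<Longrightarrow> integrable lebesgue (F 0) \<Longrightarrow> abs_L2 (F 0) \<in> smooth_L2"
  by (auto simp: smooth_L2_def)

lemma smooth_L2_smooth_rep:
  assumes "w \<in> smooth_L2"
  shows "smooth_C0 (smooth_rep w)" "integrable lebesgue (smooth_rep w 0)"
    "square_integrable (smooth_rep w 0)" "abs_L2 (smooth_rep w 0) = w"
proof -
  obtain F where "smooth_C0 F" "integrable lebesgue (F 0)" "w = abs_L2 (F 0)"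
    using assms by (auto simp: smooth_L2_def)
  then show "smooth_C0 (smooth_rep w)" "integrable lebesgue (smooth_rep w 0)"
    "square_integrable (smooth_rep w 0)" "abs_L2 (smooth_rep w 0) = w"
    using smooth_C0_square_integrable by (auto simp: smooth_rep_abs_L2)
qed

lemma smooth_C0_add:
  assumes "smooth_C0 F" "smooth_C0 G"
  shows "smooth_C0 (\<lambda>i s. F i s + G i s)"
  unfolding smooth_C0_def
  by (intro allI conjI C0_add has_vector_derivative_add smooth_C0_D assms)

lemma C0_mult_left:
  fixes f :: "'a::topological_space \<Rightarrow> 'b::real_normed_algebra"
  assumes "f \<in> C0"
  shows "(\<lambda>x. c * f x) \<in> C0"
  by (rule C0_norm_le[OF assms, of _ "norm c"])
    (rule continuous_on_mult_left[OF C0_continuous[OF assms]], rule norm_mult_ineq)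

lemma smooth_C0_mult_left:
  fixes F :: "nat \<Rightarrow> real \<Rightarrow> 'b::real_normed_algebra"
  assumes "smooth_C0 F"
  shows "smooth_C0 (\<lambda>i s. c * F i s)"
  unfolding smooth_C0_def
  by (intro allI conjI C0_mult_left has_vector_derivative_mult_right smooth_C0_D assms)

lemma smooth_L2_add:
  assumes "w \<in> smooth_L2" "w' \<in> smooth_L2"
  shows "w + w' \<in> smooth_L2" "smooth_rep (w + w') = (\<lambda>i s. smooth_rep w i s + smooth_rep w' i s)"
proof -
  note w = smooth_L2_smooth_rep[OF assms(1)] smooth_L2_smooth_rep[OF assms(2)]
  have eq: "w + w' = abs_L2 (\<lambda>s. smooth_rep w 0 s + smooth_rep w' 0 s)"
    by (simp add: abs_L2_add w)
  have *: "smooth_C0 (\<lambda>i s. smooth_rep w i s + smooth_rep w' i s)"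
    "integrable lebesgue (\<lambda>s. smooth_rep w 0 s + smooth_rep w' 0 s)"
    by (auto intro!: smooth_C0_add w)
  show "w + w' \<in> smooth_L2" "smooth_rep (w + w') = (\<lambda>i s. smooth_rep w i s + smooth_rep w' i s)"
    using smooth_L2I[OF *] smooth_rep_abs_L2[OF *] by (simp_all add: eq)
qed

lemma smooth_L2_scaleC:
  assumes "w \<in> smooth_L2"
  shows "a *\<^sub>C w \<in> smooth_L2" "smooth_rep (a *\<^sub>C w) = (\<lambda>i s. a * smooth_rep w i s)"
proof -
  note w = smooth_L2_smooth_rep[OF assms(1)]
  have eq: "a *\<^sub>C w = abs_L2 (\<lambda>s. a * smooth_rep w 0 s)"
    by (simp add: abs_L2_scaleC w)
  have *: "smooth_C0 (\<lambda>i s. a * smooth_rep w i s)"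
    "integrable lebesgue (\<lambda>s. a * smooth_rep w 0 s)"
    by (auto intro!: smooth_C0_mult_left w)
  show "a *\<^sub>C w \<in> smooth_L2" "smooth_rep (a *\<^sub>C w) = (\<lambda>i s. a * smooth_rep w i s)"
    using smooth_L2I[OF *] smooth_rep_abs_L2[OF *] by (simp_all add: eq)
qed

lemma complex_subspace_smooth_L2: "complex_subspace smooth_L2"
  by (simp add: complex_subspace_def smooth_L2_add smooth_L2_scaleC)

lemma smooth_rep_le_sup_deriv:
  assumes "w \<in> smooth_L2"
  shows "cmod (smooth_rep w i s) \<le> sup_deriv i w"
  unfolding sup_deriv_def
  by (rule cSUP_upper[OF UNIV_I C0_bdd_above[OF smooth_C0_D(1)[OF smooth_L2_smooth_rep(1)[OF assms]]]])

lemma sup_deriv_le: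
  assumes "\<And>s. cmod (smooth_rep w i s) \<le> B"
  shows "sup_deriv i w \<le> B"
  unfolding sup_deriv_def by (rule cSUP_least) (auto intro: assms)

lemma sup_deriv_nonneg: "w \<in> smooth_L2 \<Longrightarrow> 0 \<le> sup_deriv i w"
  using smooth_rep_le_sup_deriv[of w i 0] norm_ge_zero order_trans by blast

lemma seminorm_on_sup_deriv: "seminorm_on smooth_L2 (sup_deriv i)"
  unfolding seminorm_on_def
proof (intro conjI ballI allI)
  fix w w'
  assume w: "w \<in> smooth_L2" and w': "w' \<in> smooth_L2"
  show "sup_deriv i (w + w') \<le> sup_deriv i w + sup_deriv i w'"
    by (rule sup_deriv_le)
      (auto simp: smooth_L2_add w w' intro!: norm_triangle_le add_mono smooth_rep_le_sup_deriv)
next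
  fix a w
  assume w: "w \<in> smooth_L2"
  \<comment> \<open>One inequality for all scalars is enough: the reverse one is its instance for
    the scalar 1/a and the vector \<open>a *\<^sub>C w\<close>.\<close>
  have le: "sup_deriv i (a *\<^sub>C w) \<le> cmod a * sup_deriv i w" if "w \<in> smooth_L2" for a w
    by (rule sup_deriv_le)
      (auto simp: smooth_L2_scaleC that norm_mult intro!: mult_left_mono smooth_rep_le_sup_deriv)
  show "sup_deriv i (a *\<^sub>C w) = cmod a * sup_deriv i w"
  proof (cases "a = 0")
    case True
    then show ?thesis
      using le[OF w, of 0] sup_deriv_nonneg[OF smooth_L2_scaleC(1)[OF w], of i a] by simp
  next
    case False
    have "sup_deriv i w \<le> cmod (1 / a) * sup_deriv i (a *\<^sub>C w)"
      using le[OF smooth_L2_scaleC(1)[OF w], of "1 / a" a] False by (simp add: scaleC_scaleC)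
    then have "cmod a * sup_deriv i w \<le> sup_deriv i (a *\<^sub>C w)"
      using False by (simp add: norm_divide field_simps)
    with le[OF w, of a] show ?thesis
      by simp
  qed
qed


section \<open>Exponentials of even powers\<close>

text \<open>The polynomial by which exp (-R) is multiplied in its i-th derivative; the recursion is
  the product rule.\<close>

primrec exp_poly_factor :: "real poly \<Rightarrow> nat \<Rightarrow> real poly" where
  "exp_poly_factor R 0 = 1"
| "exp_poly_factor R (Suc i) = pderiv (exp_poly_factor R i) - exp_poly_factor R i * pderiv R"

definition exp_poly_deriv :: "real poly \<Rightarrow> nat \<Rightarrow> real \<Rightarrow> complex"
  where "exp_poly_deriv R i s = complex_of_real (poly (exp_poly_factor R i) s * exp (- poly R s))"

lemma exp_poly_deriv_0: "exp_poly_deriv R 0 s = complex_of_real (exp (- poly R s))"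
  by (simp add: exp_poly_deriv_def)

lemma exp_poly_deriv_has_vector_derivative:
  "(exp_poly_deriv R i has_vector_derivative exp_poly_deriv R (Suc i) s) (at s)"
proof -
  have "((\<lambda>s. poly (exp_poly_factor R i) s * exp (- poly R s)) has_real_derivative
      poly (exp_poly_factor R (Suc i)) s * exp (- poly R s)) (at s)"
    by (auto intro!: derivative_eq_intros poly_DERIV simp: algebra_simps)
  then show ?thesis
    unfolding exp_poly_deriv_def
    by (intro has_vector_derivative_of_real) (simp add: has_real_derivative_iff_has_vector_derivative)
qed

text \<open>Gives exp (- u^(2(k+1))) <= e * exp (- u^2), a comparison with the Gaussian that is
  uniform in k. It serves for the decay estimates and again as the majorant in dominated
  convergence.\<close>

lemma even_power_ge: "(u::real)\<^sup>2 - 1 \<le> u ^ (2 * Suc k)"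
proof (cases "u\<^sup>2 \<le> 1")
  case True
  then show ?thesis
    using zero_le_even_power'[of u "Suc k"] by (simp del: power_Suc)
next
  case False
  then have "(u\<^sup>2) ^ 1 \<le> (u\<^sup>2) ^ Suc k"
    by (intro power_increasing) auto
  then show ?thesis
    by (simp only: power_mult power_one_right)
qed

text \<open>With u = p s + q one has |s| <= C exp |u|, so the n-th power costs only n|u| in the
  exponent. By \<open>even_power_ge\<close> that exponent is at most n|u| - u^2 + 1, and completing
  the square bounds it by 1 + n^2/4.\<close>

lemma monomial_exp_even_power_bounded:
  fixes p q :: real
  assumes "p \<noteq> 0"
  shows "\<exists>B. \<forall>s. \<bar>s ^ n * exp (- ((p * s + q) ^ (2 * Suc k)))\<bar> \<le> B"
proof -
  define C where "C = (1 + \<bar>q\<bar>) / \<bar>p\<bar>"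
  have "\<bar>s ^ n * exp (- ((p * s + q) ^ (2 * Suc k)))\<bar> \<le> C ^ n * exp (1 + real n ^ 2 / 4)" for s
  proof -
    define u where "u = p * s + q"
    have "\<bar>p\<bar> * \<bar>s\<bar> = \<bar>u - q\<bar>"
      by (simp add: u_def abs_mult)
    also have "\<dots> \<le> (1 + \<bar>q\<bar>) * (1 + \<bar>u\<bar>)"
      using mult_nonneg_nonneg[of "\<bar>q\<bar>" "\<bar>u\<bar>"] abs_triangle_ineq4[of u q]
      unfolding distrib_left distrib_right by linarith
    also have "\<dots> \<le> (1 + \<bar>q\<bar>) * exp \<bar>u\<bar>"
      by (intro mult_left_mono exp_ge_add_one_self) auto
    finally have "\<bar>s\<bar> \<le> C * exp \<bar>u\<bar>"
      using assms by (simp add: C_def field_simps)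
    then have "\<bar>s\<bar> ^ n \<le> (C * exp \<bar>u\<bar>) ^ n"
      by (intro power_mono) auto
    also have "\<dots> = C ^ n * exp (n * \<bar>u\<bar>)"
      by (simp add: power_mult_distrib exp_of_nat_mult)
    finally have "\<bar>s ^ n * exp (- (u ^ (2 * Suc k)))\<bar> \<le> C ^ n * exp (n * \<bar>u\<bar>) * exp (- (u ^ (2 * Suc k)))"
      by (simp add: abs_mult power_abs mult_right_mono del: power_Suc)
    also have "\<dots> = C ^ n * exp (n * \<bar>u\<bar> - u ^ (2 * Suc k))"
      by (simp add: exp_diff exp_minus divide_inverse del: power_Suc)
    also have "\<dots> \<le> C ^ n * exp (1 + real n ^ 2 / 4)"
    proof -
      have "0 \<le> (\<bar>u\<bar> - n / 2)\<^sup>2"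
        by simp
      then have "n * \<bar>u\<bar> - u ^ (2 * Suc k) \<le> 1 + real n ^ 2 / 4"
        using even_power_ge[of u k] by (simp add: power2_eq_square field_simps del: power_Suc)
      then show ?thesis
        by (intro mult_left_mono) (auto simp: C_def)
    qed
    finally show ?thesis
      by (simp only: u_def)
  qed
  then show ?thesis
    by blast
qed

lemma poly_exp_even_power_bounded:
  fixes p q :: real
  assumes "p \<noteq> 0"
  shows "\<exists>B. \<forall>s. \<bar>poly P s * exp (- ((p * s + q) ^ (2 * Suc k)))\<bar> \<le> B"
proof -
  have "\<forall>n. \<exists>B. \<forall>s. \<bar>s ^ n * exp (- ((p * s + q) ^ (2 * Suc k)))\<bar> \<le> B"
    using monomial_exp_even_power_bounded[OF assms] by blast
  from choice[OF this]
  obtain B where B: "\<And>n s. \<bar>s ^ n * exp (- ((p * s + q) ^ (2 * Suc k)))\<bar> \<le> B n"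
    by blast
  have "\<bar>poly P s * exp (- ((p * s + q) ^ (2 * Suc k)))\<bar> \<le> (\<Sum>n\<le>degree P. \<bar>coeff P n\<bar> * B n)" for s
  proof -
    have "\<bar>poly P s * exp (- ((p * s + q) ^ (2 * Suc k)))\<bar>
        = \<bar>\<Sum>n\<le>degree P. coeff P n * (s ^ n * exp (- ((p * s + q) ^ (2 * Suc k))))\<bar>"
      by (simp add: poly_altdef sum_distrib_right mult.assoc del: power_Suc)
    also have "\<dots> \<le> (\<Sum>n\<le>degree P. \<bar>coeff P n * (s ^ n * exp (- ((p * s + q) ^ (2 * Suc k))))\<bar>)"
      by (rule sum_abs)
    also have "\<dots> \<le> (\<Sum>n\<le>degree P. \<bar>coeff P n\<bar> * B n)"
      by (intro sum_mono, subst abs_mult) (intro mult_left_mono B abs_ge_zero)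
    finally show ?thesis .
  qed
  then show ?thesis
    by blast
qed

lemma C0_inverse_1_plus_square: "(\<lambda>x::real. inverse (1 + x\<^sup>2)) \<in> C0"
  unfolding C0_def
proof (intro CollectI conjI allI impI)
  have pos: "1 + x\<^sup>2 > 0" for x :: real
    by (simp add: add_pos_nonneg)
  show "continuous_on UNIV (\<lambda>x::real. inverse (1 + x\<^sup>2))"
    by (intro continuous_intros ballI less_imp_neq[OF pos, symmetric])
  fix \<epsilon> :: real
  assume "\<epsilon> > 0"
  have "norm (inverse (1 + x\<^sup>2)) < \<epsilon>" if "x \<notin> {- (1 / \<epsilon> + 1)..1 / \<epsilon> + 1}" for x
  proof -
    have "\<bar>x\<bar> \<ge> 1 / \<epsilon> + 1"
      using that by (simp only: atLeastAtMost_iff) linarith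
    moreover have "1 / \<epsilon> > 0"
      using \<open>\<epsilon> > 0\<close> by simp
    ultimately have "\<bar>x\<bar> \<le> \<bar>x\<bar> * \<bar>x\<bar>"
      using mult_right_mono[of 1 "\<bar>x\<bar>" "\<bar>x\<bar>"] by linarith
    with \<open>\<bar>x\<bar> \<ge> 1 / \<epsilon> + 1\<close> have "1 / \<epsilon> < 1 + x\<^sup>2"
      by (simp add: power2_eq_square)
    then show ?thesis
      using less_imp_inverse_less[of "1 / \<epsilon>" "1 + x\<^sup>2"] \<open>\<epsilon> > 0\<close> pos[of x]
      by (simp add: abs_of_pos)
  qed
  then show "\<exists>X. compact X \<and> (\<forall>x::real. x \<notin> X \<longrightarrow> norm (inverse (1 + x\<^sup>2)) < \<epsilon>)"
    using compact_Icc by blast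
qed

text \<open>The exponent is 2(k+1), so k = 0 already gives a Gaussian. For large k, exp of minus
  this polynomial is close to 1 where |p s + q| < 1 and close to 0 where |p s + q| > 1.\<close>

definition plateau_poly :: "real \<Rightarrow> real \<Rightarrow> nat \<Rightarrow> real poly"
  where "plateau_poly p q k = [:q, p:] ^ (2 * Suc k)"

lemma poly_plateau_poly: "poly (plateau_poly p q k) s = (p * s + q) ^ (2 * Suc k)"
  by (simp only: plateau_poly_def poly_power) (simp add: algebra_simps)

text \<open>Since every polynomial factor is harmless, the factor 1 + s^2, written
  \<open>[:1, 0, 1:]\<close>, can be multiplied in, which turns boundedness into decay. The
  resulting majorant gives both vanishing at infinity and integrability.\<close>

lemma exp_poly_deriv_plateau_bound:
  assumes "p \<noteq> 0"
  obtains B where "\<And>s. cmod (exp_poly_deriv (plateau_poly p q k) i s) \<le> B * norm (inverse (1 + s\<^sup>2))"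
proof -
  let ?P = "exp_poly_factor (plateau_poly p q k) i"
  obtain B where B: "\<And>s. \<bar>poly (?P * [:1, 0, 1:]) s * exp (- ((p * s + q) ^ (2 * Suc k)))\<bar> \<le> B"
    using poly_exp_even_power_bounded[OF assms] by blast
  have "cmod (exp_poly_deriv (plateau_poly p q k) i s) \<le> B * norm (inverse (1 + s\<^sup>2))" for s
  proof -
    have pos: "1 + s\<^sup>2 > 0"
      by (simp add: add_pos_nonneg)
    have "cmod (exp_poly_deriv (plateau_poly p q k) i s) * (1 + s\<^sup>2)
        = \<bar>poly (?P * [:1, 0, 1:]) s * exp (- ((p * s + q) ^ (2 * Suc k)))\<bar>"
    proof -
      have "poly (?P * [:1, 0, 1:]) s = poly ?P s * (1 + s\<^sup>2)"
        by (simp add: power2_eq_square distrib_left)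
      with pos show ?thesis
        unfolding exp_poly_deriv_def norm_of_real poly_plateau_poly
        by (simp only: abs_mult) (simp del: power_Suc)
    qed
    with B[of s] pos show ?thesis
      by (simp add: field_simps)
  qed
  then show thesis
    using that by blast
qed

lemma smooth_C0_exp_poly_deriv_plateau:
  assumes "p \<noteq> 0"
  shows "smooth_C0 (exp_poly_deriv (plateau_poly p q k))"
    and "integrable lebesgue (exp_poly_deriv (plateau_poly p q k) 0)"
proof -
  have cont: "continuous_on UNIV (exp_poly_deriv (plateau_poly p q k) i)" for i
    by (intro continuous_at_imp_continuous_on ballI
        has_vector_derivative_continuous[OF exp_poly_deriv_has_vector_derivative])
  show "smooth_C0 (exp_poly_deriv (plateau_poly p q k))"
    unfolding smooth_C0_def
  proof (intro allI conjI exp_poly_deriv_has_vector_derivative)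
    fix i
    obtain B where "\<And>s. cmod (exp_poly_deriv (plateau_poly p q k) i s) \<le> B * norm (inverse (1 + s\<^sup>2))"
      using exp_poly_deriv_plateau_bound[OF assms] by blast
    then show "exp_poly_deriv (plateau_poly p q k) i \<in> C0"
      by (rule C0_norm_le[OF C0_inverse_1_plus_square cont])
  qed
  obtain B where B: "\<And>s. cmod (exp_poly_deriv (plateau_poly p q k) 0 s) \<le> B * norm (inverse (1 + s\<^sup>2))"
    using exp_poly_deriv_plateau_bound[OF assms] by blast
  show "integrable lebesgue (exp_poly_deriv (plateau_poly p q k) 0)"
  proof (rule Bochner_Integration.integrable_bound)
    show "integrable lebesgue (\<lambda>s. B * inverse (1 + s\<^sup>2))"
      by (intro integrable_mult_right integrable_inverse_1_plus_square_lebesgue)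
    have "exp_poly_deriv (plateau_poly p q k) 0 \<in> borel_measurable borel"
      by (rule borel_measurable_continuous_onI[OF cont])
    then show "exp_poly_deriv (plateau_poly p q k) 0 \<in> borel_measurable lebesgue"
      by (simp add: measurable_completion)
    show "AE s in lebesgue. norm (exp_poly_deriv (plateau_poly p q k) 0 s) \<le> norm (B * inverse (1 + s\<^sup>2))"
    proof (rule AE_I2)
      fix s
      show "norm (exp_poly_deriv (plateau_poly p q k) 0 s) \<le> norm (B * inverse (1 + s\<^sup>2))"
        by (rule order_trans[OF B]) (simp only: norm_mult real_norm_def mult_right_mono abs_ge_self abs_ge_zero)
    qed
  qed
qed


section \<open>A total sequence of test functions\<close>

text \<open>
  The functions \<open>exp (- (p * s + q) ^ (2 * k))\<close> converge boundedly to the indicator of an interval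
  as \<open>k\<close> grows, so a function orthogonal to all of them has vanishing integral over every interval.
\<close>

lemma plateau_tendsto_indicator:
  fixes u :: real
  assumes "\<bar>u\<bar> \<noteq> 1"
  shows "(\<lambda>k. exp (- (u ^ (2 * Suc k)))) \<longlonglongrightarrow> (if \<bar>u\<bar> < 1 then 1 else 0)"
  unfolding power_mult[of u 2]
proof (cases "\<bar>u\<bar> < 1")
  case True
  then have "norm (u\<^sup>2) < 1"
    by (simp only: real_norm_def abs_power2 abs_square_less_1)
  then have "(\<lambda>k. (u\<^sup>2) ^ Suc k) \<longlonglongrightarrow> 0"
    by (rule LIMSEQ_Suc[OF LIMSEQ_power_zero])
  then have "(\<lambda>k. exp (- ((u\<^sup>2) ^ Suc k))) \<longlonglongrightarrow> exp (- 0)"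
    by (intro tendsto_exp tendsto_minus)
  with True show "(\<lambda>k. exp (- ((u\<^sup>2) ^ Suc k))) \<longlonglongrightarrow> (if \<bar>u\<bar> < 1 then 1 else 0)"
    by (simp del: power_Suc)
next
  case False
  with assms have "u\<^sup>2 > 1"
    using one_less_power[of "\<bar>u\<bar>" 2] by simp
  then have lim: "(\<lambda>k. inverse ((u\<^sup>2) ^ Suc k)) \<longlonglongrightarrow> 0"
    by (rule LIMSEQ_Suc[OF LIMSEQ_inverse_realpow_zero])
  have le: "exp (- ((u\<^sup>2) ^ Suc k)) \<le> inverse ((u\<^sup>2) ^ Suc k)" for k
  proof -
    have "(u\<^sup>2) ^ Suc k > 0"
      using less_trans[OF zero_less_one \<open>u\<^sup>2 > 1\<close>] by (rule zero_less_power)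
    then show ?thesis
      using exp_ge_add_one_self[of "(u\<^sup>2) ^ Suc k"] unfolding exp_minus
      by (intro le_imp_inverse_le) linarith+
  qed
  have "(\<lambda>k. exp (- ((u\<^sup>2) ^ Suc k))) \<longlonglongrightarrow> 0"
    by (rule tendsto_sandwich[OF always_eventually always_eventually tendsto_const lim])
      (use le in \<open>simp_all del: power_Suc\<close>)
  with False show "(\<lambda>k. exp (- ((u\<^sup>2) ^ Suc k))) \<longlonglongrightarrow> (if \<bar>u\<bar> < 1 then 1 else 0)"
    by (simp del: power_Suc)
qed

text \<open>The affine map s -> p s + q takes (a, b) onto (-1, 1). Dominated convergence applies
  with e times the modulus of the k = 0 product as majorant; the endpoints, where the plateaus do
  not tend to the indicator, form a null set.\<close>

lemma integral_interval_zero_if_orthogonal_to_plateaus: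
  assumes f: "square_integrable f" and "a < b"
    and p: "p = 2 / (b - a)" and q: "q = - (a + b) / (b - a)"
    and orth: "\<And>k. (LINT s|lebesgue. f s * cnj (exp_poly_deriv (plateau_poly p q k) 0 s)) = 0"
  shows "(LINT s|lebesgue. indicator {a<..<b} s *\<^sub>R f s) = 0"
proof -
  let ?F = "\<lambda>k. exp_poly_deriv (plateau_poly p q k) 0"
  have "p \<noteq> 0"
    using p \<open>a < b\<close> by simp
  have F_sq: "square_integrable (?F k)" for k
    by (rule smooth_C0_square_integrable[OF smooth_C0_exp_poly_deriv_plateau[OF \<open>p \<noteq> 0\<close>]])
  have prod: "integrable lebesgue (\<lambda>s. f s * cnj (?F k s))" for k
    by (rule integrable_mult_cnj[OF f F_sq])
  have f_meas [measurable]: "f \<in> borel_measurable lebesgue"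
    by (rule square_integrable_measurable[OF f])
  have u_eq: "p * s + q = (2 * s - (a + b)) / (b - a)" for s
    unfolding p q by (simp add: diff_divide_distrib add_divide_distrib)
  have abs_u: "\<bar>p * s + q\<bar> < 1 \<longleftrightarrow> s \<in> {a<..<b}" for s
  proof -
    have "\<bar>p * s + q\<bar> < 1 \<longleftrightarrow> \<bar>2 * s - (a + b)\<bar> < b - a"
      using \<open>a < b\<close> by (simp add: u_eq abs_divide divide_less_eq)
    then show ?thesis
      by auto
  qed
  have "(\<lambda>k. LINT s|lebesgue. f s * cnj (?F k s)) \<longlonglongrightarrow> (LINT s|lebesgue. indicator {a<..<b} s *\<^sub>R f s)"
  proof (rule integral_dominated_convergence)
    show "(\<lambda>s. indicator {a<..<b} s *\<^sub>R f s) \<in> borel_measurable lebesgue"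
      by (intro borel_measurable_scaleR borel_measurable_indicator f_meas) simp
    show "(\<lambda>s. f s * cnj (?F k s)) \<in> borel_measurable lebesgue" for k
      by (rule borel_measurable_integrable[OF prod])
    show "integrable lebesgue (\<lambda>s. exp 1 * cmod (f s * cnj (?F 0 s)))"
      by (intro integrable_mult_right integrable_norm prod)
    show "AE s in lebesgue. cmod (f s * cnj (?F k s)) \<le> exp 1 * cmod (f s * cnj (?F 0 s))" for k
    proof (rule AE_I2)
      fix s
      have "exp (- ((p * s + q) ^ (2 * Suc k))) \<le> exp (1 - (p * s + q)\<^sup>2)"
        using even_power_ge[of "p * s + q" k] by (simp del: power_Suc)
      then have "cmod (?F k s) \<le> exp 1 * cmod (?F 0 s)"
        unfolding exp_poly_deriv_0 norm_of_real poly_plateau_poly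
        by (simp add: exp_diff exp_minus divide_inverse power2_eq_square del: power_Suc)
      then show "cmod (f s * cnj (?F k s)) \<le> exp 1 * cmod (f s * cnj (?F 0 s))"
        by (simp add: norm_mult mult.left_commute[of "exp 1"] mult_left_mono)
    qed
    have "AE s in lebesgue. s \<noteq> a" "AE s in lebesgue. s \<noteq> b"
      by (intro AE_completion AE_lborel_singleton)+
    then show "AE s in lebesgue. (\<lambda>k. f s * cnj (?F k s)) \<longlonglongrightarrow> indicator {a<..<b} s *\<^sub>R f s"
    proof eventually_elim
      case (elim s)
      have "p * s + q \<noteq> 1" "p * s + q \<noteq> - 1"
        using \<open>a < b\<close> elim unfolding u_eq by (simp_all add: divide_eq_eq)
      then have "\<bar>p * s + q\<bar> \<noteq> 1"
        by linarith
      note lim = plateau_tendsto_indicator[OF this]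
      have "(if \<bar>p * s + q\<bar> < 1 then 1 else 0) = (indicator {a<..<b} s :: real)"
        unfolding abs_u by (simp add: indicator_def)
      with lim have "(\<lambda>k. ?F k s) \<longlonglongrightarrow> complex_of_real (indicator {a<..<b} s)"
        unfolding exp_poly_deriv_0 poly_plateau_poly by (intro tendsto_of_real) (simp only:)
      then have "(\<lambda>k. f s * cnj (?F k s)) \<longlonglongrightarrow> f s * cnj (complex_of_real (indicator {a<..<b} s))"
        by (intro tendsto_intros)
      then show ?case
        by (simp add: scaleR_conv_of_real mult.commute)
    qed
  qed
  then show ?thesis
    unfolding orth by (simp add: LIMSEQ_const_iff)
qed

text \<open>Dynkin's argument: the open rays are stable under intersection and generate the Borel
  sets. The vanishing total integral settles complements, countable additivity settles disjoint
  unions.\<close>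

lemma integral_zero_borel_sets:
  fixes g :: "real \<Rightarrow> complex"
  assumes g: "integrable lebesgue g" "(LINT s|lebesgue. g s) = 0"
    and rays: "\<And>x. (LINT s|lebesgue. indicator {x<..} s *\<^sub>R g s) = 0"
    and A: "A \<in> sets borel"
  shows "(LINT s|lebesgue. indicator A s *\<^sub>R g s) = 0"
proof -
  have borel: "sets borel = sigma_sets UNIV (range (greaterThan :: real \<Rightarrow> real set))"
    by (subst borel_Ioi) (simp add: sets_measure_of)
  have leb: "A \<in> sets lebesgue" if "A \<in> sigma_sets UNIV (range (greaterThan :: real \<Rightarrow> real set))" for A
    using that by (simp flip: borel)
  have int: "integrable lebesgue (\<lambda>s. indicator A s *\<^sub>R g s)" if "A \<in> sets lebesgue" for A
    using that g(1) by (rule integrable_mult_indicator)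
  have Int: "Int_stable (range (greaterThan :: real \<Rightarrow> real set))"
  proof (rule Int_stableI)
    fix A B :: "real set"
    assume "A \<in> range greaterThan" "B \<in> range greaterThan"
    then obtain a b where "A = {a<..}" "B = {b<..}"
      by auto
    then have "A \<inter> B = {max a b<..}"
      by auto
    then show "A \<inter> B \<in> range greaterThan"
      by auto
  qed
  show ?thesis
  proof (rule sigma_sets_induct_disjoint[OF Int _ A[unfolded borel], rotated],
      goal_cases basic empty compl union closed)
    case (compl A)
    have "(LINT s|lebesgue. indicator (UNIV - A) s *\<^sub>R g s) = (LINT s|lebesgue. g s - indicator A s *\<^sub>R g s)"
      by (intro Bochner_Integration.integral_cong) (auto simp: indicator_def)
    also have "\<dots> = 0"
      using compl(2) g by (subst Bochner_Integration.integral_diff) (auto intro: int leb compl(1))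
    finally show ?case .
  next
    case (union A)
    have A: "A i \<in> sets lebesgue" for i
      using union(2) by (intro leb) auto
    have "(LINT s:(\<Union>i. A i)|lebesgue. g s) = (\<Sum>i. LINT s:A i|lebesgue. g s)"
    proof (rule lebesgue_integral_countable_add)
      show "set_integrable lebesgue (\<Union>i. A i) g"
        unfolding set_integrable_def by (intro int sets.countable_UN) (use A in auto)
    qed (use A union(1) in \<open>auto simp: disjoint_family_on_def\<close>)
    then show ?case
      using union(3) by (simp add: set_lebesgue_integral_def)
  qed (auto simp: rays)
qed

text \<open>A Lebesgue set is a Borel set up to a null set, so all integrals over measurable sets
  vanish; real and imaginary parts are then compared with the density 0.\<close>

lemma AE_zero_if_integral_zero_rays:
  fixes g :: "real \<Rightarrow> complex"
  assumes g: "integrable lebesgue g" "(LINT s|lebesgue. g s) = 0"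
    and rays: "\<And>x. (LINT s|lebesgue. indicator {x<..} s *\<^sub>R g s) = 0"
  shows "AE s in lebesgue. g s = 0"
proof -
  have zero: "(LINT s|lebesgue. indicator A s *\<^sub>R g s) = 0" if "A \<in> sets lebesgue" for A
  proof -
    from that obtain B N N' where A: "A = B \<union> N" "N \<subseteq> N'" "N' \<in> null_sets lborel" "B \<in> sets lborel"
      by (rule sets_completionE)
    have "AE s in lebesgue. s \<notin> N'"
      by (intro AE_completion AE_not_in A)
    then have "AE s in lebesgue. indicator A s *\<^sub>R g s = indicator B s *\<^sub>R g s"
      by eventually_elim (use A in \<open>auto simp: indicator_def\<close>)
    then have "(LINT s|lebesgue. indicator A s *\<^sub>R g s) = (LINT s|lebesgue. indicator B s *\<^sub>R g s)"
      using A that g(1)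
      by (intro integral_cong_AE borel_measurable_integrable integrable_mult_indicator) auto
    also have "\<dots> = 0"
      by (rule integral_zero_borel_sets[OF g rays]) (use A in simp)
    finally show ?thesis .
  qed
  have int: "integrable lebesgue (\<lambda>s. indicator A s *\<^sub>R g s)" if "A \<in> sets lebesgue" for A
    using that g(1) by (rule integrable_mult_indicator)
  have "AE s in lebesgue. Re (g s) = 0"
  proof (rule density_unique_real)
    show "(LINT s:A|lebesgue. Re (g s)) = (LINT s:A|lebesgue. 0)" if "A \<in> sets lebesgue" for A
      using integral_Re[OF int[OF that]] zero[OF that] by (simp add: set_lebesgue_integral_def)
  qed (use g in auto)
  moreover have "AE s in lebesgue. Im (g s) = 0"
  proof (rule density_unique_real)
    show "(LINT s:A|lebesgue. Im (g s)) = (LINT s:A|lebesgue. 0)" if "A \<in> sets lebesgue" for A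
      using integral_Im[OF int[OF that]] zero[OF that] by (simp add: set_lebesgue_integral_def)
  qed (use g in auto)
  ultimately show ?thesis
    by eventually_elim (simp add: complex_eq_iff)
qed

text \<open>Triples of rational p, q and natural k are enumerated by \<open>from_nat\<close>. For p
  = 0 the function would be a nonzero constant, hence not in L2, so p is replaced by 1.\<close>

definition plateau_sequence :: "nat \<Rightarrow> L2"
  where "plateau_sequence n = (case from_nat n of (p, q, k) \<Rightarrow>
    abs_L2 (exp_poly_deriv (plateau_poly (if p = 0 then 1 else real_of_rat p) (real_of_rat q) k) 0))"

lemma plateau_sequence_in_smooth_L2: "plateau_sequence n \<in> smooth_L2"
  unfolding plateau_sequence_def
  by (auto split: prod.split intro!: smooth_L2I smooth_C0_exp_poly_deriv_plateau)

lemma total_plateau_sequence: "total_sequence plateau_sequence"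
  unfolding total_sequence_def
proof (intro allI impI)
  fix z
  assume z: "\<forall>n. cinner z (plateau_sequence n) = 0"
  define f where "f = rep_L2 z"
  have f: "square_integrable f"
    by (simp add: f_def square_integrable_rep_L2)
  have f_meas [measurable]: "f \<in> borel_measurable lebesgue"
    by (rule square_integrable_measurable[OF f])
  have rat: "(LINT s|lebesgue. indicator {real_of_rat a<..<real_of_rat b} s *\<^sub>R f s) = 0" for a b
  proof (cases "a < b")
    case True
    define p q where "p = 2 / (b - a)" and "q = - (a + b) / (b - a)"
    have "p \<noteq> 0"
      using True by (simp add: p_def)
    have pq: "real_of_rat p = 2 / (real_of_rat b - real_of_rat a)"
      "real_of_rat q = - (real_of_rat a + real_of_rat b) / (real_of_rat b - real_of_rat a)"
      by (simp_all add: p_def q_def of_rat_divide of_rat_diff of_rat_add of_rat_minus)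
    show ?thesis
    proof (rule integral_interval_zero_if_orthogonal_to_plateaus[OF f _ pq])
      fix k
      let ?F = "exp_poly_deriv (plateau_poly (real_of_rat p) (real_of_rat q) k)"
      have F: "smooth_C0 ?F" "integrable lebesgue (?F 0)"
        using \<open>p \<noteq> 0\<close> by (auto intro!: smooth_C0_exp_poly_deriv_plateau)
      have "plateau_sequence (to_nat (p, q, k)) = abs_L2 (?F 0)"
        using \<open>p \<noteq> 0\<close> by (simp add: plateau_sequence_def)
      then have "cinner z (abs_L2 (?F 0)) = 0"
        using z by metis
      then have "cinner (abs_L2 f) (abs_L2 (?F 0)) = 0"
        by (simp add: f_def)
      then show "(LINT s|lebesgue. f s * cnj (?F 0 s)) = 0"
        using cinner_abs_L2[OF f smooth_C0_square_integrable[OF F]] by simp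
    qed (use True in \<open>simp add: of_rat_less\<close>)
  next
    case False
    then have "{real_of_rat a<..<real_of_rat b} = {}"
      by (simp add: of_rat_less_eq)
    then show ?thesis
      by simp
  qed
  \<comment> \<open>An L2 function need not be integrable on the whole line, so the argument is
    carried out for f cut off to bounded intervals.\<close>
  have bounded_int: "integrable lebesgue (\<lambda>s. indicator {a<..<b} s *\<^sub>R f s)" for a b
  proof -
    have "integrable lebesgue (\<lambda>s. complex_of_real (indicator {a<..<b} s))"
      by (intro integrable_of_real integrable_real_indicator) (cases "a \<le> b"; simp)+
    then have "square_integrable (\<lambda>s. complex_of_real (indicator {a<..<b} s))"
      by (rule square_integrable_bounded_integrable[of _ 1]) (simp add: indicator_def)
    from integrable_mult_cnj[OF f this] show ?thesis
      by (simp add: scaleR_conv_of_real mult.commute)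
  qed
  \<comment> \<open>Rational left endpoints decrease to an arbitrary real x. The right endpoint may
    stay a natural number: a ray cuts (-N, N) in an interval that still ends at N.\<close>
  have interval: "(LINT s|lebesgue. indicator {x<..<real N} s *\<^sub>R f s) = 0" for x and N :: nat
  proof -
    have "\<forall>n. \<exists>r. x < real_of_rat r \<and> real_of_rat r < x + inverse (real (Suc n))"
      by (intro allI of_rat_dense) simp
    from choice[OF this] obtain r where r: "\<And>n. x < real_of_rat (r n)"
      "\<And>n. real_of_rat (r n) < x + inverse (real (Suc n))"
      by blast
    have r_lim: "(\<lambda>n. real_of_rat (r n)) \<longlonglongrightarrow> x"
    proof (rule tendsto_sandwich[OF _ _ tendsto_const])
      show "(\<lambda>n. x + inverse (real (Suc n))) \<longlonglongrightarrow> x"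
        using tendsto_add[OF tendsto_const LIMSEQ_inverse_real_of_nat, of x] by simp
    qed (use r in \<open>auto intro!: always_eventually less_imp_le\<close>)
    have "(\<lambda>n. LINT s|lebesgue. indicator {real_of_rat (r n)<..<real N} s *\<^sub>R f s)
        \<longlonglongrightarrow> (LINT s|lebesgue. indicator {x<..<real N} s *\<^sub>R f s)"
    proof (rule integral_dominated_convergence)
      show "integrable lebesgue (\<lambda>s. norm (indicator {x<..<real N} s *\<^sub>R f s))"
        by (intro integrable_norm bounded_int)
      show "AE s in lebesgue. norm (indicator {real_of_rat (r n)<..<real N} s *\<^sub>R f s)
          \<le> norm (indicator {x<..<real N} s *\<^sub>R f s)" for n
        using r(1)[of n] by (intro AE_I2) (auto simp: indicator_def)
      show "AE s in lebesgue. (\<lambda>n. indicator {real_of_rat (r n)<..<real N} s *\<^sub>R f s)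
          \<longlonglongrightarrow> indicator {x<..<real N} s *\<^sub>R f s"
      proof (rule AE_I2, rule tendsto_eventually)
        fix s
        show "\<forall>\<^sub>F n in sequentially. indicator {real_of_rat (r n)<..<real N} s *\<^sub>R f s
            = indicator {x<..<real N} s *\<^sub>R f s"
        proof (cases "x < s")
          case True
          with order_tendstoD(2)[OF r_lim True] show ?thesis
            by (auto elim!: eventually_mono simp: indicator_def)
        next
          case False
          then have "\<not> real_of_rat (r n) < s" for n
            using r(1)[of n] by simp
          with False show ?thesis
            by (simp add: indicator_def)
        qed
      qed
    qed (auto intro!: borel_measurable_integrable bounded_int)
    moreover have "\<exists>b::rat. real N = real_of_rat b"
      by (metis of_rat_of_nat_eq)
    ultimately show ?thesis
      using rat by (auto simp: LIMSEQ_const_iff)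
  qed
  have "AE s in lebesgue. \<forall>N::nat. indicator {- real N<..<real N} s *\<^sub>R f s = 0"
    unfolding AE_all_countable
  proof (intro allI AE_zero_if_integral_zero_rays bounded_int)
    fix N :: nat and x :: real
    show "(LINT s|lebesgue. indicator {- real N<..<real N} s *\<^sub>R f s) = 0"
      by (rule interval)
    have "indicator {x<..} s *\<^sub>R indicator {- real N<..<real N} s *\<^sub>R f s
        = indicator {max x (- real N)<..<real N} s *\<^sub>R f s" for s
      by (auto simp: indicator_def)
    then show "(LINT s|lebesgue. indicator {x<..} s *\<^sub>R indicator {- real N<..<real N} s *\<^sub>R f s) = 0"
      by (simp only: interval)
  qed
  then have "AE s in lebesgue. f s = 0"
  proof eventually_elim
    case (elim s)
    obtain N :: nat where "\<bar>s\<bar> < real N"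
      using reals_Archimedean2 by blast
    then show ?case
      using elim[rule_format, of N] by (auto simp: indicator_def abs_less_iff)
  qed
  then have "abs_L2 f = abs_L2 (\<lambda>s. 0)"
    by (intro abs_L2_eqI f square_integrable_zero)
  then show "z = 0"
    by (simp add: f_def abs_L2_zero)
qed


section \<open>Wide Gaussians\<close>

lemma C0_dilate:
  fixes f :: "real \<Rightarrow> 'b::real_normed_vector"
  assumes "f \<in> C0" "c \<noteq> 0"
  shows "(\<lambda>s. f (c * s)) \<in> C0"
  unfolding C0_def
proof (intro CollectI conjI allI impI)
  show "continuous_on UNIV (\<lambda>s. f (c * s))"
    by (intro continuous_on_compose2[OF C0_continuous[OF assms(1)]] continuous_intros) auto
  fix \<epsilon> :: real
  assume "\<epsilon> > 0"
  then obtain X where X: "compact X" "\<And>x. x \<notin> X \<Longrightarrow> norm (f x) < \<epsilon>"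
    using C0_D[OF assms(1)] by blast
  have "norm (f (c * s)) < \<epsilon>" if "s \<notin> (\<lambda>x. inverse c *\<^sub>R x) ` X" for s
  proof (rule X(2))
    show "c * s \<notin> X"
      using that assms(2) by (auto simp: image_iff dest!: bspec[of X _ "c * s"])
  qed
  with compact_scaling[OF X(1)] show "\<exists>X. compact X \<and> (\<forall>s. s \<notin> X \<longrightarrow> norm (f (c * s)) < \<epsilon>)"
    by blast
qed

lemma smooth_C0_dilate:
  fixes F :: "nat \<Rightarrow> real \<Rightarrow> complex"
  assumes "smooth_C0 F" "c \<noteq> 0"
  shows "smooth_C0 (\<lambda>i s. complex_of_real (c ^ i) * F i (c * s))"
  unfolding smooth_C0_def
proof (intro allI conjI C0_mult_left C0_dilate smooth_C0_D(1)[OF assms(1)] assms(2))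
  fix i s
  have "((\<lambda>s. c * s) has_vector_derivative c) (at s)"
    by (auto intro!: derivative_eq_intros)
  from vector_diff_chain_at[OF this smooth_C0_D(2)[OF assms(1), of i]]
  have "((\<lambda>s. F i (c * s)) has_vector_derivative c *\<^sub>R F (Suc i) (c * s)) (at s)"
    by (simp add: o_def)
  from has_vector_derivative_mult_right[OF this, of "complex_of_real (c ^ i)"]
  show "((\<lambda>s. complex_of_real (c ^ i) * F i (c * s)) has_vector_derivative
      complex_of_real (c ^ Suc i) * F (Suc i) (c * s)) (at s)"
    by (simp add: scaleR_conv_of_real mult_ac)
qed

lemma lebesgue_dilate:
  fixes f :: "real \<Rightarrow> 'b::{banach, second_countable_topology}"
  assumes "continuous_on UNIV f" "c > 0"
  shows "integrable lebesgue f \<Longrightarrow> integrable lebesgue (\<lambda>s. f (c * s))"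
    and "(LINT s|lebesgue. f (c * s)) = (1 / c) *\<^sub>R (LINT s|lebesgue. f s)"
proof -
  have f: "f \<in> borel_measurable borel"
    by (rule borel_measurable_continuous_onI[OF assms(1)])
  have fc: "(\<lambda>s. f (c * s)) \<in> borel_measurable borel"
    by (intro borel_measurable_continuous_onI continuous_on_compose2[OF assms(1)] continuous_intros) auto
  show "integrable lebesgue (\<lambda>s. f (c * s))" if "integrable lebesgue f"
    using that lborel_integrable_real_affine[of f c 0] assms(2) f fc
    by (simp add: integrable_completion)
  show "(LINT s|lebesgue. f (c * s)) = (1 / c) *\<^sub>R (LINT s|lebesgue. f s)"
    using lborel_integral_real_affine[of c f 0] assms(2) f fc
    by (simp add: integral_completion)
qed

text \<open>These are the L2-normalised dilates sqrt c * E (c s) / \<gamma> of a Gaussian with c =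
  1/(k+1). The derivative of order i is bounded by a multiple of sqrt c * c^i, which tends to 0
  already for i = 0. Against an integrable z, the inner product is at most this sup norm times the
  L1 norm of z.\<close>

lemma wide_gaussians:
  obtains y :: "nat \<Rightarrow> L2" where "\<And>k. y k \<in> smooth_L2" "\<And>k. norm (y k) = 1"
    "\<And>i. (\<lambda>k. sup_deriv i (y k)) \<longlonglongrightarrow> 0"
    "\<And>z. z \<in> smooth_L2 \<Longrightarrow> (\<lambda>k. cinner (y k) z) \<longlonglongrightarrow> 0"
proof -
  \<comment> \<open>The polynomial is s^2, so E i is the i-th derivative of exp (- s^2).\<close>
  define E where "E = exp_poly_deriv (plateau_poly 1 0 0)"
  have E: "smooth_C0 E" "integrable lebesgue (E 0)"
    unfolding E_def by (rule smooth_C0_exp_poly_deriv_plateau; simp)+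
  have E_sq: "square_integrable (E 0)"
    by (rule smooth_C0_square_integrable[OF E])
  define \<gamma> where "\<gamma> = norm (abs_L2 (E 0))"
  have "\<gamma> \<noteq> 0"
  proof
    assume "\<gamma> = 0"
    then have "abs_L2 (E 0) = abs_L2 (\<lambda>s. 0)"
      by (simp add: \<gamma>_def abs_L2_zero)
    then have "E 0 = (\<lambda>s. 0)"
      by (intro continuous_AE_eq abs_L2_eqD E_sq square_integrable_zero continuous_on_const
          C0_continuous[OF smooth_C0_D(1)[OF E(1)]])
    from fun_cong[OF this, of 0] show False
      by (simp add: E_def exp_poly_deriv_0)
  qed
  then have "\<gamma> > 0"
    by (simp add: \<gamma>_def)
  define c where "c k = inverse (real (Suc k))" for k
  have c: "c k > 0" "c k \<le> 1" for k
    by (simp_all add: c_def inverse_le_1_iff)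
  have c_lim: "c \<longlonglongrightarrow> 0"
    unfolding c_def[abs_def] by (rule LIMSEQ_inverse_real_of_nat)
  define W where "W k i s = complex_of_real (sqrt (c k) / \<gamma>) * (complex_of_real (c k ^ i) * E i (c k * s))"
    for k i s
  have E_cont: "continuous_on UNIV (E i)" for i
    by (rule C0_continuous[OF smooth_C0_D(1)[OF E(1)]])
  have W_smooth: "smooth_C0 (W k)" for k
    unfolding W_def using c(1)[of k] by (intro smooth_C0_mult_left smooth_C0_dilate E(1)) simp
  have W_int: "integrable lebesgue (W k 0)" for k
    unfolding W_def using c(1)[of k]
    by (intro integrable_mult_right) (auto intro!: lebesgue_dilate E_cont E(2))
  have W_sq: "square_integrable (W k 0)" for k
    by (rule smooth_C0_square_integrable[OF W_smooth W_int])
  define y where "y k = abs_L2 (W k 0)" for k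
  have y: "y k \<in> smooth_L2" "smooth_rep (y k) = W k" for k
    unfolding y_def by (auto intro: smooth_L2I smooth_rep_abs_L2 W_smooth W_int)
  have norm_y: "norm (y k) = 1" for k
  proof -
    have "(norm (y k))\<^sup>2 = (LINT s|lebesgue. c k / \<gamma>\<^sup>2 * (cmod (E 0 (c k * s)))\<^sup>2)"
      unfolding y_def norm_abs_L2[OF W_sq] using c(1)[of k] \<open>\<gamma> > 0\<close>
      by (simp add: W_def norm_mult power_mult_distrib norm_divide power_divide)
    also have "\<dots> = c k / \<gamma>\<^sup>2 * (LINT s|lebesgue. (cmod (E 0 (c k * s)))\<^sup>2)"
      by simp
    also have "(LINT s|lebesgue. (cmod (E 0 (c k * s)))\<^sup>2) = (1 / c k) *\<^sub>R (LINT s|lebesgue. (cmod (E 0 s))\<^sup>2)"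
      by (rule lebesgue_dilate(2)[of "\<lambda>s. (cmod (E 0 s))\<^sup>2"]) (intro continuous_intros E_cont c)+
    also have "(LINT s|lebesgue. (cmod (E 0 s))\<^sup>2) = \<gamma>\<^sup>2"
      by (simp add: \<gamma>_def norm_abs_L2[OF E_sq])
    finally have "(norm (y k))\<^sup>2 = 1"
      using c(1)[of k] \<open>\<gamma> > 0\<close> by simp
    then show ?thesis
      using power2_eq_1_iff[of "norm (y k)"] norm_ge_zero[of "y k"] by linarith
  qed
  have W_bound: "\<exists>B. \<forall>k s. cmod (W k i s) \<le> sqrt (c k) * B" for i
  proof -
    obtain B where B: "\<And>s. cmod (E i s) \<le> B"
      using C0_bounded[OF smooth_C0_D(1)[OF E(1)]] by blast
    have "cmod (W k i s) \<le> sqrt (c k) * (B / \<gamma>)" for k s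
    proof -
      have "c k ^ i * cmod (E i (c k * s)) \<le> 1 * B"
        using c[of k] by (intro mult_mono B power_le_one) (auto simp: less_imp_le)
      then have "sqrt (c k) / \<gamma> * (c k ^ i * cmod (E i (c k * s))) \<le> sqrt (c k) / \<gamma> * (1 * B)"
        using c(1)[of k] \<open>\<gamma> > 0\<close> by (intro mult_left_mono) auto
      moreover have "cmod (W k i s) = sqrt (c k) / \<gamma> * (c k ^ i * cmod (E i (c k * s)))"
        using c(1)[of k] \<open>\<gamma> > 0\<close> by (simp add: W_def norm_mult norm_divide norm_power)
      ultimately show ?thesis
        by simp
    qed
    then show ?thesis
      by blast
  qed
  have sqrt_c_lim: "(\<lambda>k. sqrt (c k) * B) \<longlonglongrightarrow> 0" for B
    using tendsto_mult[OF tendsto_real_sqrt[OF c_lim] tendsto_const, of B] by simp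
  show thesis
  proof (rule that[of y])
    show "(\<lambda>k. sup_deriv i (y k)) \<longlonglongrightarrow> 0" for i
    proof -
      obtain B where "\<And>k s. cmod (W k i s) \<le> sqrt (c k) * B"
        using W_bound by blast
      then have "sup_deriv i (y k) \<le> sqrt (c k) * B" for k
        by (intro sup_deriv_le) (simp add: y)
      then show ?thesis
        by (intro tendsto_sandwich[OF _ _ tendsto_const sqrt_c_lim])
          (auto intro!: always_eventually sup_deriv_nonneg y)
    qed
    show "(\<lambda>k. cinner (y k) z) \<longlonglongrightarrow> 0" if z: "z \<in> smooth_L2" for z
    proof -
      obtain B where B: "\<And>k s. cmod (W k 0 s) \<le> sqrt (c k) * B"
        using W_bound by blast
      define g where "g = smooth_rep z 0"
      have g: "integrable lebesgue g" "square_integrable g" "z = abs_L2 g"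
        using smooth_L2_smooth_rep[OF z] by (simp_all add: g_def)
      have "norm (cinner (y k) z) \<le> sqrt (c k) * (B * (LINT s|lebesgue. cmod (g s)))" for k
      proof -
        have "cmod (cinner (y k) z) = cmod (LINT s|lebesgue. W k 0 s * cnj (g s))"
          by (simp add: y_def g(3) cinner_abs_L2[OF W_sq g(2)])
        also have "\<dots> \<le> (LINT s|lebesgue. cmod (W k 0 s * cnj (g s)))"
          by (rule integral_norm_bound)
        also have "\<dots> \<le> (LINT s|lebesgue. (sqrt (c k) * B) * cmod (g s))"
          using B[of k]
          by (intro integral_mono integrable_norm integrable_mult_right integrable_mult_cnj W_sq g)
            (auto simp: norm_mult intro!: mult_right_mono)
        finally show ?thesis
          by (simp add: mult.assoc)
      qed
      then show ?thesis
        by (intro Lim_null_comparison[OF _ sqrt_c_lim] always_eventually allI)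
    qed
  qed (use y norm_y in auto)
qed

text \<open>Even steps 2n capture \<open>plateau_sequence n\<close> and yield totality; odd steps
  are free. The bound at n involves only earlier functions, so it is a fixed positive number when w
  n is chosen. Only orders up to n are controlled there, which keeps the seminorms finite in number
  and still reaches every order eventually.\<close>

lemma smooth_orthonormal_basis:
  obtains w :: "nat \<Rightarrow> L2" where "orthonormal_sequence w" "total_sequence w" "\<And>n. w n \<in> smooth_L2"
    "\<And>n i. odd n \<Longrightarrow> i \<le> n \<Longrightarrow>
      sup_deriv i (w n) \<le> (1 / 2) ^ n / (1 + (\<Sum>m<n. \<Sum>j\<le>n. sup_deriv j (w m)))"
proof -
  obtain y where y: "\<And>k. y k \<in> smooth_L2" "\<And>k. norm (y k) = 1"
    "\<And>i. (\<lambda>k. sup_deriv i (y k)) \<longlonglongrightarrow> 0"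
    "\<And>z. z \<in> smooth_L2 \<Longrightarrow> (\<lambda>k. cinner (y k) z) \<longlonglongrightarrow> 0"
    using wide_gaussians by blast
  define \<delta> where "\<delta> n w = (1 / 2) ^ n / (1 + (\<Sum>m<n. \<Sum>j\<le>n. sup_deriv j (w m)))" for n :: nat and w
  define J where "J n w = (\<lambda>i v. sup_deriv i v / \<delta> n w) ` {..n}" for n w
  have \<delta>_pos: "\<delta> n w > 0" if "\<And>m. m < n \<Longrightarrow> w m \<in> smooth_L2" for n w
    unfolding \<delta>_def using that
    by (intro divide_pos_pos add_pos_nonneg sum_nonneg sup_deriv_nonneg) auto
  obtain w where w: "orthonormal_sequence w" "\<And>n. w n \<in> smooth_L2"
    "\<And>n a. even n \<Longrightarrow> (\<And>m. m \<le> n \<Longrightarrow> cinner a (w m) = 0) \<Longrightarrow> cinner a (plateau_sequence (n div 2)) = 0"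
    "\<And>n p. \<not> even n \<Longrightarrow> p \<in> J n w \<Longrightarrow> p (w n) \<le> 1"
  proof (rule interleaved_gram_schmidt[where S = smooth_L2 and G = even and J = J and y = y
        and d = "\<lambda>n. plateau_sequence (n div 2)"])
    show "seminorm_on smooth_L2 p" if "\<And>m. m < n \<Longrightarrow> x m \<in> smooth_L2" "p \<in> J n x" for n x p
      using that(2) \<delta>_pos[OF that(1)] by (auto simp: J_def intro!: seminorm_on_divide seminorm_on_sup_deriv)
    show "(\<lambda>k. p (y k)) \<longlonglongrightarrow> 0" if "\<And>m. m < n \<Longrightarrow> x m \<in> smooth_L2" "p \<in> J n x" for n x p
      using that(2) y(3) by (auto simp: J_def intro!: tendsto_divide_zero)
    show "J n x = J n x'" if "\<And>m. m < n \<Longrightarrow> x m = x' m" for n x x'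
      unfolding J_def \<delta>_def using that by simp
  qed (auto simp: complex_subspace_smooth_L2 plateau_sequence_in_smooth_L2 y J_def)
  show thesis
  proof (rule that[of w])
    show "total_sequence w"
      unfolding total_sequence_def
    proof (intro allI impI total_sequenceD[OF total_plateau_sequence])
      show "cinner z (plateau_sequence n) = 0" if "\<forall>n. cinner z (w n) = 0" for z n
        using w(3)[of "2 * n" z] that by simp
    qed
    show "sup_deriv i (w n) \<le> (1 / 2) ^ n / (1 + (\<Sum>m<n. \<Sum>j\<le>n. sup_deriv j (w m)))"
      if "odd n" "i \<le> n" for n i
    proof -
      have "(\<lambda>v. sup_deriv i v / \<delta> n w) \<in> J n w"
        using that(2) by (simp add: J_def)
      with w(4) that(1) have "sup_deriv i (w n) / \<delta> n w \<le> 1"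
        by blast
      then show ?thesis
        using \<delta>_pos[of n w] w(2) by (simp add: divide_le_eq) (simp add: \<delta>_def)
    qed
  qed (use w in auto)
qed


section \<open>Smooth Carleman kernels from decaying matrices\<close>

lemma C0_tensor:
  fixes f g :: "real \<Rightarrow> complex"
  assumes "f \<in> C0" "g \<in> C0"
  shows "(\<lambda>z. f (fst z) * g (snd z)) \<in> C0"
  unfolding C0_def
proof (intro CollectI conjI allI impI)
  show "continuous_on UNIV (\<lambda>z. f (fst z) * g (snd z))"
    by (intro continuous_intros continuous_on_compose2[OF C0_continuous[OF assms(1)]]
        continuous_on_compose2[OF C0_continuous[OF assms(2)]]) auto
  fix \<epsilon> :: real
  assume "\<epsilon> > 0"
  obtain B B' where B: "\<And>x. cmod (f x) \<le> B" "\<And>x. cmod (g x) \<le> B'"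
    using C0_bounded[OF assms(1)] C0_bounded[OF assms(2)] by metis
  define b where "b = max 1 (max B B')"
  have b: "b > 0" "cmod (f x) \<le> b" "cmod (g x) \<le> b" for x
    using B[of x] by (auto simp: b_def)
  obtain X Y where X: "compact X" "\<And>x. x \<notin> X \<Longrightarrow> cmod (f x) < \<epsilon> / b"
    and Y: "compact Y" "\<And>x. x \<notin> Y \<Longrightarrow> cmod (g x) < \<epsilon> / b"
    using C0_D[OF assms(1), of "\<epsilon> / b"] C0_D[OF assms(2), of "\<epsilon> / b"] \<open>\<epsilon> > 0\<close> b(1)
    by (metis divide_pos_pos)
  have "norm (f (fst z) * g (snd z)) < \<epsilon>" if "z \<notin> X \<times> Y" for z
  proof (cases "fst z \<in> X")
    case True
    then have "cmod (g (snd z)) < \<epsilon> / b"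
      using that by (intro Y) (auto simp: mem_Times_iff)
    have "cmod (f (fst z)) * cmod (g (snd z)) \<le> b * cmod (g (snd z))"
      by (intro mult_right_mono b) simp
    also have "\<dots> < b * (\<epsilon> / b)"
      using \<open>cmod (g (snd z)) < \<epsilon> / b\<close> b(1) by (rule mult_strict_left_mono)
    finally show ?thesis
      using b(1) by (simp add: norm_mult)
  next
    case False
    then have "cmod (f (fst z)) < \<epsilon> / b"
      by (rule X)
    have "cmod (f (fst z)) * cmod (g (snd z)) \<le> cmod (f (fst z)) * b"
      by (intro mult_left_mono b) simp
    also have "\<dots> < (\<epsilon> / b) * b"
      using \<open>cmod (f (fst z)) < \<epsilon> / b\<close> b(1) by (rule mult_strict_right_mono)
    finally show ?thesis
      using b(1) by (simp add: norm_mult)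
  qed
  with compact_Times[OF X(1) Y(1)]
  show "\<exists>X. compact X \<and> (\<forall>z. z \<notin> X \<longrightarrow> norm (f (fst z) * g (snd z)) < \<epsilon>)"
    by blast
qed

lemma C0_cnj: "f \<in> C0 \<Longrightarrow> (\<lambda>x. cnj (f x)) \<in> C0"
  by (rule C0_norm_le[of f _ 1]) (auto intro: continuous_on_cnj C0_continuous)

text \<open>The projections are contractions, so they may be applied to a moving vector: the error P
  n (y n - l) is no larger than y n - l, and P n l tends to l.\<close>

lemma orthonormal_projection_tendsto:
  fixes e :: "nat \<Rightarrow> 'a::complex_hilbert_space"
  assumes e: "orthonormal_sequence e" "total_sequence e" and "y \<longlonglongrightarrow> l"
  shows "(\<lambda>n. \<Sum>i<n. cinner (y n) (e i) *\<^sub>C e i) \<longlonglongrightarrow> l"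
proof -
  define P where "P n z = (\<Sum>i<n. cinner z (e i) *\<^sub>C e i)" for n z
  have "norm (P n (y n) - P n l) \<le> norm (y n - l)" for n
  proof -
    have "cinner (y n - l) (e i) *\<^sub>C e i = cinner (y n) (e i) *\<^sub>C e i - cinner l (e i) *\<^sub>C e i" for i
      using scaleC_add_left[of "cinner (y n - l) (e i)" "cinner l (e i)" "e i"]
      by (simp add: cinner_diff_left)
    then have "P n (y n) - P n l = P n (y n - l)"
      by (simp add: P_def sum_subtractf)
    then show ?thesis
      using orthonormal_projection_norm_le[OF e(1), of "{..<n}" "y n - l"] by (simp add: P_def)
  qed
  moreover have "(\<lambda>n. norm (y n - l)) \<longlonglongrightarrow> 0"
    using assms(3) by (intro tendsto_norm_zero LIM_zero)
  ultimately have "(\<lambda>n. P n (y n) - P n l) \<longlonglongrightarrow> 0"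
    by (intro Lim_null_comparison[of "\<lambda>n. P n (y n) - P n l" "\<lambda>n. norm (y n - l)"] always_eventually allI)
  moreover have "(\<lambda>n. P n l) \<longlonglongrightarrow> l"
    using orthonormal_expansion[OF e, of l] by (simp add: sums_def P_def)
  ultimately have "(\<lambda>n. (P n (y n) - P n l) + P n l) \<longlonglongrightarrow> 0 + l"
    by (rule tendsto_add)
  then show ?thesis
    by (simp add: P_def)
qed

section \<open>Double series summed by the larger index\<close>

text \<open>The pairs form an L shape with two arms of N + 1 points; the common corner is counted
  twice.\<close>

lemma card_max_fibre_le: "card {p. max (fst p) (snd p) = (N::nat)} \<le> 2 * Suc N"
proof -
  have sub: "{p. max (fst p) (snd p) = N} \<subseteq> {N} \<times> {..N} \<union> {..N} \<times> {N}"
    by (auto simp: max_def split: if_splits)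
  have "card {p. max (fst p) (snd p) = N} \<le> card ({N} \<times> {..N} \<union> {..N} \<times> {N})"
    by (rule card_mono[OF _ sub]) simp
  also have "\<dots> \<le> card ({N} \<times> {..N}) + card ({..N} \<times> {N})"
    by (rule card_Un_le)
  finally show ?thesis
    by (simp add: card_cartesian_product)
qed

text \<open>Partial sums over the blocks are square partial sums, the form in which the kernel can
  be compared with projections in L2.\<close>

lemma sum_max_fibres:
  "(\<Sum>N<M. \<Sum>p | max (fst p) (snd p) = N. h p) = (\<Sum>n<M. \<Sum>m<M. h (n, m :: nat))"
proof -
  have "(\<Sum>N<M. \<Sum>p | p \<in> {..<M} \<times> {..<M} \<and> max (fst p) (snd p) = N. h p) = (\<Sum>p\<in>{..<M} \<times> {..<M}. h p)"
    by (rule sum.group) auto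
  moreover have "{p. p \<in> {..<M} \<times> {..<M} \<and> max (fst p) (snd p) = N} = {p. max (fst p) (snd p) = N}" if "N < M" for N
    using that by auto
  ultimately show ?thesis
    by (simp add: sum.cartesian_product)
qed

text \<open>
  In the application \<open>t n\<close> is the image of \<open>w n\<close> under the adjoint of the operator, so that
  \<open>cinner (t n) (w m)\<close> are the entries of the matrix of the adjoint.
\<close>

locale decaying_matrix =
  fixes w t :: "nat \<Rightarrow> L2"
  assumes orthonormal_w: "orthonormal_sequence w"
    and total_w: "total_sequence w"
    and smooth_w: "\<And>n. w n \<in> smooth_L2"
    and rows_summable: "\<And>i. summable (\<lambda>n. sup_deriv i (w n) * norm (t n))"
    and entries_decay: "\<And>i j. \<exists>C M. \<forall>n m. M \<le> max n m \<longrightarrow>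
      cmod (cinner (t n) (w m)) * sup_deriv i (w n) * sup_deriv j (w m) \<le> C * (1 / 2) ^ max n m"
begin

definition W :: "nat \<Rightarrow> nat \<Rightarrow> real \<Rightarrow> complex"
  where "W n = smooth_rep (w n)"

text \<open>The terms of larger index N, differentiated i times in the first and j times in the
  second variable. Each block is a finite sum, so one majorant in N controls the double
  series.\<close>

definition block :: "nat \<Rightarrow> nat \<Rightarrow> nat \<Rightarrow> real \<times> real \<Rightarrow> complex"
  where "block i j N z = (\<Sum>p | max (fst p) (snd p) = N.
    cnj (cinner (t (fst p)) (w (snd p))) * (W (fst p) i (fst z) * cnj (W (snd p) j (snd z))))"

definition kernel :: "nat \<Rightarrow> nat \<Rightarrow> real \<times> real \<Rightarrow> complex"
  where "kernel i j z = (\<Sum>N. block i j N z)"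

definition carleman :: "nat \<Rightarrow> real \<Rightarrow> L2"
  where "carleman i s = (\<Sum>n. cnj (W n i s) *\<^sub>C t n)"

lemma smooth_W: "smooth_C0 (W n)"
  and square_integrable_W: "square_integrable (W n 0)"
  and abs_L2_W: "abs_L2 (W n 0) = w n"
  by (simp_all add: W_def smooth_L2_smooth_rep smooth_w)

lemma W_le: "cmod (W n i s) \<le> sup_deriv i (w n)"
  by (simp add: W_def smooth_rep_le_sup_deriv smooth_w)

lemma block_bound:
  "\<exists>b M. summable b \<and> (\<forall>N\<ge>M. \<forall>z. cmod (block i j N z) \<le> b N)"
proof -
  obtain C M where C: "\<And>n m. M \<le> max n m \<Longrightarrow>
      cmod (cinner (t n) (w m)) * sup_deriv i (w n) * sup_deriv j (w m) \<le> C * (1 / 2) ^ max n m"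
    using entries_decay by blast
  \<comment> \<open>The factor 2(N+1) bounds the number of pairs in the block; the sum of (N+1)
    2^(-N) is a differentiated geometric series.\<close>
  define b where "b N = 2 * C * (real (Suc N) * (1 / 2) ^ N)" for N
  have "summable b"
    unfolding b_def[abs_def]
    using geometric_deriv_sums[of "1 / 2 :: real"] by (intro summable_mult) (auto simp: summable_def)
  moreover have "cmod (block i j N z) \<le> b N" if "N \<ge> M" for N z
  proof -
    have "cmod (block i j N z) \<le> real (card {p. max (fst p) (snd p) = N}) * (C * (1 / 2) ^ N)"
      unfolding block_def
    proof (rule sum_norm_bound)
      fix p
      assume "p \<in> {p. max (fst p) (snd p) = N}"
      then have p: "max (fst p) (snd p) = N"
        by simp
      have "cmod (cnj (cinner (t (fst p)) (w (snd p))) * (W (fst p) i (fst z) * cnj (W (snd p) j (snd z))))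
          \<le> cmod (cinner (t (fst p)) (w (snd p))) * (sup_deriv i (w (fst p)) * sup_deriv j (w (snd p)))"
        unfolding norm_mult complex_mod_cnj
        by (intro mult_left_mono mult_mono W_le) (auto intro: sup_deriv_nonneg smooth_w)
      also have "\<dots> \<le> C * (1 / 2) ^ N"
        using C[of "fst p" "snd p"] that by (simp add: p mult.assoc)
      finally show "cmod (cnj (cinner (t (fst p)) (w (snd p))) * (W (fst p) i (fst z) * cnj (W (snd p) j (snd z))))
          \<le> C * (1 / 2) ^ N" .
    qed
    also have "\<dots> \<le> real (2 * Suc N) * (C * (1 / 2) ^ N)"
    proof (rule mult_right_mono)
      show "real (card {p. max (fst p) (snd p) = N}) \<le> real (2 * Suc N)"
        using card_max_fibre_le by (simp only: of_nat_le_iff)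
      \<comment> \<open>Nonnegativity of the bound is not part of the choice of C; it follows from
        the diagonal pair (N, N).\<close>
      have "0 \<le> cmod (cinner (t N) (w N)) * sup_deriv i (w N) * sup_deriv j (w N)"
        by (intro mult_nonneg_nonneg sup_deriv_nonneg smooth_w) simp
      then show "0 \<le> C * (1 / 2) ^ N"
        using C[of N N] that by simp
    qed
    finally show ?thesis
      by (simp add: b_def algebra_simps)
  qed
  ultimately show ?thesis
    by blast
qed

lemma block_C0: "block i j N \<in> C0"
  unfolding block_def
  by (intro C0_sum C0_mult_left C0_tensor C0_cnj smooth_C0_D(1)[OF smooth_W])

lemma summable_block: "summable (\<lambda>N. block i j N z)"
proof -
  obtain b M where b: "summable b" "\<And>N z. N \<ge> M \<Longrightarrow> cmod (block i j N z) \<le> b N"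
    using block_bound[of i j] by blast
  show ?thesis
    by (rule eventually_bounded_series_uniform_limit(2)[OF b(2,1)])
qed

lemma kernel_C0: "kernel i j \<in> C0"
proof -
  obtain b M where b: "summable b" "\<And>N z. N \<ge> M \<Longrightarrow> cmod (block i j N z) \<le> b N"
    using block_bound[of i j] by blast
  show ?thesis
    unfolding kernel_def[abs_def] by (rule C0_suminf[OF block_C0 b(2,1)])
qed

lemma kernel_has_vector_derivative:
  "((\<lambda>x. kernel i j (x, y)) has_vector_derivative kernel (Suc i) j (s, y)) (at s)"
  "((\<lambda>y. kernel i j (s, y)) has_vector_derivative kernel i (Suc j) (s, y)) (at y)"
proof -
  note W' = smooth_C0_D(2)[OF smooth_W]
  obtain b M where b: "summable b" "\<And>N z. N \<ge> M \<Longrightarrow> cmod (block i j N z) \<le> b N"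
    using block_bound[of i j] by blast
  obtain b1 M1 where b1: "summable b1" "\<And>N z. N \<ge> M1 \<Longrightarrow> cmod (block (Suc i) j N z) \<le> b1 N"
    using block_bound[of "Suc i" j] by blast
  obtain b2 M2 where b2: "summable b2" "\<And>N z. N \<ge> M2 \<Longrightarrow> cmod (block i (Suc j) N z) \<le> b2 N"
    using block_bound[of i "Suc j"] by blast
  show "((\<lambda>x. kernel i j (x, y)) has_vector_derivative kernel (Suc i) j (s, y)) (at s)"
    unfolding kernel_def
  proof (rule has_vector_derivative_suminf[OF _ b(2)[of _ "(_, y)"] b(1) b1(2)[of _ "(_, y)"] b1(1)])
    show "((\<lambda>x. block i j N (x, y)) has_vector_derivative block (Suc i) j N (s, y)) (at s)" for N s
      unfolding block_def fst_conv snd_conv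
      by (rule has_vector_derivative_sum, rule has_vector_derivative_mult_right,
          rule has_vector_derivative_mult_left, rule W')
  qed
  show "((\<lambda>y. kernel i j (s, y)) has_vector_derivative kernel i (Suc j) (s, y)) (at y)"
    unfolding kernel_def
  proof (rule has_vector_derivative_suminf[OF _ b(2)[of _ "(s, _)"] b(1) b2(2)[of _ "(s, _)"] b2(1)])
    show "((\<lambda>y. block i j N (s, y)) has_vector_derivative block i (Suc j) N (s, y)) (at y)" for N y
      unfolding block_def fst_conv snd_conv
      by (rule has_vector_derivative_sum, rule has_vector_derivative_mult_right,
          rule has_vector_derivative_mult_right, rule has_vector_derivative_cnj, rule W')
  qed
qed

lemma carleman_sums: "(\<lambda>n. cnj (W n i s) *\<^sub>C t n) sums carleman i s"
  unfolding carleman_def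
  by (intro summable_sums summable_comparison_test'[OF rows_summable[of i]])
    (simp add: mult_right_mono W_le)

lemma smooth_C0_carleman: "smooth_C0 carleman"
  unfolding smooth_C0_def
proof (intro allI conjI)
  have bound: "norm (cnj (W n i s) *\<^sub>C t n) \<le> sup_deriv i (w n) * norm (t n)" for n i s
    by (simp add: mult_right_mono W_le)
  have lin: "bounded_linear (\<lambda>c. c *\<^sub>C t n)" for n
    by (rule bounded_bilinear.bounded_linear_left[OF bounded_bilinear_scaleC])
  fix i s
  show "carleman i \<in> C0"
    unfolding carleman_def[abs_def]
  proof (rule C0_suminf[OF _ bound rows_summable])
    show "(\<lambda>s. cnj (W n i s) *\<^sub>C t n) \<in> C0" for n
    proof (rule C0_norm_le[OF smooth_C0_D(1)[OF smooth_W]])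
      show "continuous_on UNIV (\<lambda>s. cnj (W n i s) *\<^sub>C t n)"
        by (intro bounded_linear.continuous_on[OF lin] continuous_intros C0_continuous
            smooth_C0_D(1)[OF smooth_W])
      show "norm (cnj (W n i s) *\<^sub>C t n) \<le> norm (t n) * norm (W n i s)" for s
        by simp
    qed
  qed
  show "(carleman i has_vector_derivative carleman (Suc i) s) (at s)"
    unfolding carleman_def[abs_def]
    by (rule has_vector_derivative_suminf[OF _ bound rows_summable bound rows_summable])
      (intro bounded_linear.has_vector_derivative[OF lin] has_vector_derivative_cnj
        smooth_C0_D(2)[OF smooth_W])
qed

text \<open>
  The square partial sums of the kernel converge pointwise to the kernel, and in norm to the
  Carleman function because they are finite-dimensional projections of its partial sums.
\<close>

lemma carleman_eq_kernel_section: "AE y in lebesgue. rep_L2 (carleman 0 s) y = cnj (kernel 0 0 (s, y))"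
proof (rule L2_limit_AE_eq_pointwise_limit)
  define \<phi> where "\<phi> M y = (\<Sum>n<M. \<Sum>m<M. cnj (W n 0 s) * cinner (t n) (w m) * W m 0 y)" for M y
  show "square_integrable (\<phi> M)" for M
    unfolding \<phi>_def by (intro square_integrable_sum square_integrable_mult square_integrable_W)
  have "abs_L2 (\<phi> M) = (\<Sum>m<M. cinner (\<Sum>n<M. cnj (W n 0 s) *\<^sub>C t n) (w m) *\<^sub>C w m)" for M
  proof -
    have "abs_L2 (\<phi> M) = (\<Sum>n<M. \<Sum>m<M. (cnj (W n 0 s) * cinner (t n) (w m)) *\<^sub>C w m)"
      unfolding \<phi>_def
      by (simp only: abs_L2_sum square_integrable_sum square_integrable_mult square_integrable_W
          abs_L2_scaleC abs_L2_W)
    also have "\<dots> = (\<Sum>m<M. \<Sum>n<M. (cnj (W n 0 s) * cinner (t n) (w m)) *\<^sub>C w m)"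
      by (rule sum.swap)
    also have "\<dots> = (\<Sum>m<M. cinner (\<Sum>n<M. cnj (W n 0 s) *\<^sub>C t n) (w m) *\<^sub>C w m)"
      by (simp add: cinner_sum_left cinner_scaleC_left
          linear_sum[OF bounded_linear.linear[OF bounded_bilinear.bounded_linear_left[OF bounded_bilinear_scaleC]]])
    finally show ?thesis .
  qed
  moreover have "(\<lambda>M. \<Sum>m<M. cinner (\<Sum>n<M. cnj (W n 0 s) *\<^sub>C t n) (w m) *\<^sub>C w m) \<longlonglongrightarrow> carleman 0 s"
    by (rule orthonormal_projection_tendsto[OF orthonormal_w total_w])
      (use carleman_sums in \<open>simp add: sums_def\<close>)
  ultimately show "(\<lambda>M. abs_L2 (\<phi> M)) \<longlonglongrightarrow> carleman 0 s"
    by simp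
  show "AE y in lebesgue. (\<lambda>M. \<phi> M y) \<longlonglongrightarrow> cnj (kernel 0 0 (s, y))"
  proof (rule AE_I2)
    fix y
    have "(\<Sum>N<M. block 0 0 N (s, y)) = cnj (\<phi> M y)" for M
      unfolding block_def sum_max_fibres by (simp add: \<phi>_def mult_ac)
    moreover have "(\<lambda>M. \<Sum>N<M. block 0 0 N (s, y)) \<longlonglongrightarrow> kernel 0 0 (s, y)"
      unfolding kernel_def by (rule summable_LIMSEQ[OF summable_block])
    ultimately have "(\<lambda>M. cnj (\<phi> M y)) \<longlonglongrightarrow> kernel 0 0 (s, y)"
      by simp
    then show "(\<lambda>M. \<phi> M y) \<longlonglongrightarrow> cnj (kernel 0 0 (s, y))"
      using tendsto_cnj by fastforce
  qed
qed

text \<open>This holds at every s, as condition (ii) demands: the Carleman series converges at every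
  s, and the section agrees almost everywhere with the conjugate of its sum.\<close>

lemma square_integrable_kernel_section: "square_integrable (\<lambda>y. kernel 0 0 (s, y))"
  using square_integrable_cnj[OF square_integrable_AE_eq[OF square_integrable_rep_L2 carleman_eq_kernel_section]]
  by simp

lemma carleman_function_kernel: "carleman_function (kernel 0 0) = carleman 0"
proof
  fix s
  have "abs_L2 (rep_L2 (carleman 0 s)) = abs_L2 (\<lambda>y. cnj (kernel 0 0 (s, y)))"
    by (intro abs_L2_eqI square_integrable_rep_L2 square_integrable_cnj
        square_integrable_kernel_section carleman_eq_kernel_section)
  then show "carleman_function (kernel 0 0) s = carleman 0 s"
    by (simp add: carleman_function_def)
qed

lemma kernel_measurable: "kernel 0 0 \<in> borel_measurable lebesgue"
proof -
  have "kernel 0 0 \<in> borel_measurable borel"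
    by (intro borel_measurable_continuous_onI C0_continuous kernel_C0)
  then show ?thesis
    by (simp add: measurable_completion)
qed

lemma carleman_kernel_kernel: "carleman_kernel (kernel 0 0)"
  by (simp add: carleman_kernel_def kernel_measurable square_integrable_kernel_section)

lemma SK_infinity_kernel_kernel: "SK_infinity_kernel (kernel 0 0)"
  unfolding SK_infinity_kernel_def SK_kernel_def
  by (intro allI conjI carleman_kernel_kernel square_integrable_kernel_section
      C0_partial_derivs_family kernel_C0 kernel_has_vector_derivative)
    (simp add: carleman_function_kernel smooth_C0_imp_C0_derivs smooth_C0_carleman)

text \<open>The expansion of T f in the basis w converges to T f in L2. By the hypothesis its
  coefficients are <f, t n>, so it also converges at every point s to <f,
  \<open>carleman 0 s\<close>>, which is the integral against the kernel; the two limits agree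
  almost everywhere.\<close>

lemma kernel_is_kernel_of:
  assumes T: "\<And>f n. cinner (T f) (w n) = cinner f (t n)"
  shows "is_kernel_of (kernel 0 0) T"
  unfolding is_kernel_of_def
proof (intro conjI allI kernel_measurable)
  fix f
  have int: "integrable lebesgue (\<lambda>y. kernel 0 0 (s, y) * rep_L2 f y)" for s
    using integrable_mult_cnj[OF square_integrable_kernel_section square_integrable_cnj[OF square_integrable_rep_L2]]
    by simp
  have "cinner f (carleman 0 s) = (LINT y|lebesgue. kernel 0 0 (s, y) * rep_L2 f y)" for s
  proof -
    have "cinner f (carleman 0 s) = cinner (abs_L2 (rep_L2 f)) (abs_L2 (\<lambda>y. cnj (kernel 0 0 (s, y))))"
      by (simp add: carleman_function_kernel[symmetric] carleman_function_def)
    also have "\<dots> = (LINT y|lebesgue. rep_L2 f y * cnj (cnj (kernel 0 0 (s, y))))"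
      by (intro cinner_abs_L2 square_integrable_rep_L2 square_integrable_cnj
          square_integrable_kernel_section)
    finally show ?thesis
      by (simp only: complex_cnj_cnj mult.commute)
  qed
  moreover have "AE s in lebesgue. rep_L2 (T f) s = cinner f (carleman 0 s)"
  proof (rule L2_limit_AE_eq_pointwise_limit)
    define \<phi> where "\<phi> M s = (\<Sum>n<M. cinner (T f) (w n) * W n 0 s)" for M s
    show "square_integrable (\<phi> M)" for M
      unfolding \<phi>_def by (intro square_integrable_sum square_integrable_mult square_integrable_W)
    have "abs_L2 (\<phi> M) = (\<Sum>n<M. cinner (T f) (w n) *\<^sub>C w n)" for M
      unfolding \<phi>_def
      by (simp only: abs_L2_sum square_integrable_mult square_integrable_W abs_L2_scaleC abs_L2_W)
    then show "(\<lambda>M. abs_L2 (\<phi> M)) \<longlonglongrightarrow> T f"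
      using orthonormal_expansion[OF orthonormal_w total_w, of "T f"] by (simp add: sums_def)
    show "AE s in lebesgue. (\<lambda>M. \<phi> M s) \<longlonglongrightarrow> cinner f (carleman 0 s)"
    proof (rule AE_I2)
      fix s
      have "(\<lambda>n. cinner f (cnj (W n 0 s) *\<^sub>C t n)) sums cinner f (carleman 0 s)"
        by (intro sums_cinner_right carleman_sums)
      then show "(\<lambda>M. \<phi> M s) \<longlonglongrightarrow> cinner f (carleman 0 s)"
        by (simp add: sums_def \<phi>_def T cinner_scaleC_right mult.commute)
    qed
  qed
  ultimately show "AE s in lebesgue. integrable lebesgue (\<lambda>y. kernel 0 0 (s, y) * rep_L2 f y) \<and>
      rep_L2 (T f) s = (LINT y|lebesgue. kernel 0 0 (s, y) * rep_L2 f y)"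
    by (simp add: int)
qed

end


section \<open>Choice of the orthonormal bases\<close>

lemma total_sequence_dense:
  fixes d :: "nat \<Rightarrow> 'a::complex_inner"
  assumes "closure (range d) = UNIV"
  shows "total_sequence d"
  unfolding total_sequence_def
proof (intro allI impI)
  fix z
  assume z: "\<forall>n. cinner z (d n) = 0"
  have "closed ((\<lambda>y. cinner z y) -` {0})"
    by (intro continuous_closed_vimage linear_continuous_at
        bounded_bilinear.bounded_linear_right[OF bounded_bilinear_cinner]) simp
  moreover have "range d \<subseteq> (\<lambda>y. cinner z y) -` {0}"
    using z by auto
  ultimately have "closure (range d) \<subseteq> (\<lambda>y. cinner z y) -` {0}"
    by (rule closure_minimal[rotated])
  with assms have "cinner z z = 0"
    by auto
  then show "z = 0"
    by (simp add: cinner_self)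
qed

lemma separable_total_sequence:
  fixes D :: "'a::complex_inner set"
  assumes "countable D" "closure D = UNIV"
  obtains d :: "nat \<Rightarrow> 'a" where "total_sequence d"
proof -
  have "D \<noteq> {}"
    using assms(2) by auto
  then have "range (from_nat_into D) = D"
    by (rule range_from_nat_into[OF _ assms(1)])
  then show thesis
    using that total_sequence_dense[of "from_nat_into D"] assms(2) by simp
qed

lemma complex_subspace_UNIV: "complex_subspace UNIV"
  by (simp add: complex_subspace_def)

text \<open>An auxiliary basis that serves to establish the adjoints; the basis adapted to the
  operators is built only afterwards, because its conditions are stated with those adjoints. Every
  step is a Gram-Schmidt step, and v supplies the spare unit vectors.\<close>

lemma separable_orthonormal_basis:
  fixes d v :: "nat \<Rightarrow> 'a::complex_inner"
  assumes "total_sequence d" "orthonormal_sequence v"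
  obtains e :: "nat \<Rightarrow> 'a" where "orthonormal_sequence e" "total_sequence e"
proof -
  obtain e where e: "orthonormal_sequence e"
    "\<And>n a. (\<And>m. m \<le> n \<Longrightarrow> cinner a (e m) = 0) \<Longrightarrow> cinner a (d n) = 0"
    by (rule interleaved_gram_schmidt[where S = UNIV and G = "\<lambda>_. True" and J = "\<lambda>_ _. {}" and y = v and d = d])
      (use assms(2) in \<open>auto simp: complex_subspace_UNIV orthonormal_sequence_norm
        intro: orthonormal_sequence_weakly_null\<close>)
  have "total_sequence e"
    unfolding total_sequence_def using total_sequenceD[OF assms(1)] e(2) by blast
  with e(1) show thesis
    using that by blast
qed

lemma adjoint_norm_le:
  fixes f :: "'a::complex_inner \<Rightarrow> 'b::complex_inner"
  assumes "\<And>x y. cinner (f x) y = cinner x (g y)" "\<And>x. norm (f x) \<le> norm x * C" "C \<ge> 0"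
  shows "norm (g y) \<le> norm y * C"
proof (cases "g y = 0")
  case True
  with assms(3) show ?thesis
    by simp
next
  case False
  have "(norm (g y))\<^sup>2 = cmod (cinner (g y) (g y))"
    by (simp add: cinner_self norm_power)
  also have "\<dots> = cmod (cinner (f (g y)) y)"
    by (simp add: assms(1))
  also have "\<dots> \<le> norm (f (g y)) * norm y"
    by (rule norm_cinner_le)
  also have "\<dots> \<le> (norm (g y) * C) * norm y"
    by (intro mult_right_mono assms(2)) simp
  finally show ?thesis
    using False by (simp add: power2_eq_square mult.assoc mult.commute[of C])
qed


lemma unitary_conjugate_clinear:
  assumes "unitary U" "clinear f"
  shows "clinear (U \<circ> f \<circ> inv U)"
proof (rule clinearI)
  have U: "clinear U" "bij U"
    using assms(1) by (auto simp: unitary_def)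
  have inv: "U (inv U y) = y" "inv U (U x) = x" for x y
    using U(2) by (auto simp: bij_is_surj bij_is_inj surj_f_inv_f)
  show "(U \<circ> f \<circ> inv U) (x + y) = (U \<circ> f \<circ> inv U) x + (U \<circ> f \<circ> inv U) y" for x y
  proof -
    have "inv U (x + y) = inv U x + inv U y"
      by (metis inv clinear_add[OF U(1)])
    then show ?thesis
      by (simp add: clinear_add[OF U(1)] clinear_add[OF assms(2)])
  qed
  show "(U \<circ> f \<circ> inv U) (a *\<^sub>C x) = a *\<^sub>C (U \<circ> f \<circ> inv U) x" for a x
  proof -
    have "inv U (a *\<^sub>C x) = a *\<^sub>C inv U x"
      by (metis inv clinear_scaleC[OF U(1)])
    then show ?thesis
      by (simp add: clinear_scaleC[OF U(1)] clinear_scaleC[OF assms(2)])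
  qed
qed

text \<open>The parities are opposite to those of \<open>smooth_orthonormal_basis\<close>: odd steps
  2n+1 capture d n, even steps are free. Along v the first kind of seminorm vanishes by hypothesis;
  the second does so by weak convergence, because \<open>A r (x m)\<close> is a fixed vector when x
  n is chosen.\<close>

lemma adapted_orthonormal_basis:
  fixes A :: "nat \<Rightarrow> 'a::complex_inner \<Rightarrow> 'a" and d v :: "nat \<Rightarrow> 'a" and \<eta> :: "nat \<Rightarrow> real"
  assumes A: "\<And>r y z. A r (y + z) = A r y + A r z" "\<And>r a y. A r (a *\<^sub>C y) = a *\<^sub>C A r y"
    and d: "total_sequence d"
    and v: "orthonormal_sequence v" "\<And>r. (\<lambda>k. norm (A r (v k))) \<longlonglongrightarrow> 0"
    and \<eta>: "\<And>n. \<eta> n > 0"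
  obtains x where "orthonormal_sequence x" "total_sequence x"
    "\<And>n r. even n \<Longrightarrow> r \<le> n \<Longrightarrow> norm (A r (x n)) \<le> \<eta> n"
    "\<And>n r m. even n \<Longrightarrow> r \<le> n \<Longrightarrow> m < n \<Longrightarrow> cmod (cinner (x n) (A r (x m))) \<le> \<eta> n"
proof -
  define J where "J n x = (\<lambda>r z. norm (A r z) / \<eta> n) ` {..n} \<union>
    (\<lambda>(r, m) z. cmod (cinner z (A r (x m))) / \<eta> n) ` ({..n} \<times> {..<n})" for n and x :: "nat \<Rightarrow> 'a"
  have semi: "seminorm_on UNIV (\<lambda>z. norm (A r z))" for r
    by (simp add: seminorm_on_def A norm_triangle_ineq)
  obtain x where x: "orthonormal_sequence x"
    "\<And>n a. odd n \<Longrightarrow> (\<And>m. m \<le> n \<Longrightarrow> cinner a (x m) = 0) \<Longrightarrow> cinner a (d (n div 2)) = 0"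
    "\<And>n p. \<not> odd n \<Longrightarrow> p \<in> J n x \<Longrightarrow> p (x n) \<le> 1"
  proof (rule interleaved_gram_schmidt[where S = UNIV and G = odd and J = J and y = v
        and d = "\<lambda>n. d (n div 2)"])
    show "seminorm_on UNIV p" if "p \<in> J n x" for n x p
      using that by (auto simp: J_def intro!: seminorm_on_divide semi seminorm_on_cinner \<eta>)
    show "(\<lambda>k. p (v k)) \<longlonglongrightarrow> 0" if "p \<in> J n x" for n x p
      using that by (auto simp: J_def intro!: tendsto_divide_zero tendsto_norm_zero v
          orthonormal_sequence_weakly_null)
    show "J n x = J n x'" if "\<And>m. m < n \<Longrightarrow> x m = x' m" for n x x'
      unfolding J_def using that by (intro arg_cong2[of _ _ _ _ union] image_cong) auto
    show "(\<lambda>k. norm (v k)) \<longlonglongrightarrow> 1"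
      by (simp add: orthonormal_sequence_norm[OF v(1)])
  qed (auto simp: complex_subspace_UNIV J_def intro: orthonormal_sequence_weakly_null v)
  show thesis
  proof (rule that[of x])
    show "total_sequence x"
      unfolding total_sequence_def
    proof (intro allI impI total_sequenceD[OF d])
      show "cinner z (d n) = 0" if "\<forall>n. cinner z (x n) = 0" for z n
        using x(2)[of "2 * n + 1" z] that by simp
    qed
    show "norm (A r (x n)) \<le> \<eta> n" if "even n" "r \<le> n" for n r
    proof -
      have "(\<lambda>z. norm (A r z) / \<eta> n) \<in> J n x"
        using that(2) by (simp add: J_def)
      with x(3) that(1) have "norm (A r (x n)) / \<eta> n \<le> 1"
        by blast
      then show ?thesis
        using \<eta>[of n] by (simp add: divide_le_eq)
    qed
    show "cmod (cinner (x n) (A r (x m))) \<le> \<eta> n" if "even n" "r \<le> n" "m < n" for n r m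
    proof -
      have "(\<lambda>z. cmod (cinner z (A r (x m))) / \<eta> n) \<in> J n x"
        unfolding J_def by (rule UnI2, rule image_eqI[of _ _ "(r, m)"]) (use that in auto)
      with x(3) that(1) have "cmod (cinner (x n) (A r (x m))) / \<eta> n \<le> 1"
        by blast
      then show ?thesis
        using \<eta>[of n] by (simp add: divide_le_eq)
    qed
  qed (rule x(1))
qed

lemma double_sum_ge_term:
  fixes c :: "nat \<Rightarrow> nat \<Rightarrow> real"
  assumes "\<And>n i. 0 \<le> c n i" "finite A" "finite I" "m \<in> A" "i \<in> I"
  shows "c m i \<le> (\<Sum>m\<in>A. \<Sum>i\<in>I. c m i)"
proof -
  have "c m i \<le> (\<Sum>i\<in>I. c m i)"
    using assms by (intro member_le_sum) auto
  also have "\<dots> \<le> (\<Sum>m\<in>A. \<Sum>i\<in>I. c m i)"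
    by (rule member_le_sum[of m A "\<lambda>m. \<Sum>i\<in>I. c m i"]) (use assms in \<open>auto intro: sum_nonneg\<close>)
  finally show ?thesis .
qed

section \<open>Assembly: matching the two bases and verifying the decay conditions\<close>

theorem mainTheorem1:
  fixes B :: "nat \<Rightarrow> 'h::complex_hilbert_space \<Rightarrow> 'h"
    and v :: "nat \<Rightarrow> 'h"
  assumes separable: "\<exists>D::'h set. countable D \<and> closure D = UNIV"
    and bounded: "\<forall>r. bounded_clinear (B r)"
    and orthonormal: "orthonormal_sequence v"
    and vanishing: "(\<lambda>n. SUP r. ereal (norm (cadjoint (B r) (v n)))) \<longlonglongrightarrow> 0"
  shows "\<exists>U :: 'h \<Rightarrow> L2. unitary U \<and>
    (\<forall>r. carleman_operator (U \<circ> B r \<circ> inv U) \<and>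
      (\<exists>K. SK_infinity_kernel K \<and> is_kernel_of K (U \<circ> B r \<circ> inv U)))"
proof -
  obtain d :: "nat \<Rightarrow> 'h" where d: "total_sequence d"
    using separable separable_total_sequence by metis
  obtain e :: "nat \<Rightarrow> 'h" where e: "orthonormal_sequence e" "total_sequence e"
    using separable_orthonormal_basis[OF d orthonormal] by blast
  define A where "A r = cadjoint (B r)" for r
  have A: "cinner (B r x) y = cinner x (A r y)" for r x y
    unfolding A_def using bounded by (intro bounded_clinear_has_adjoint[OF _ e]) blast
  have A_add: "A r (y + z) = A r y + A r z" for r y z
    by (rule cinner_ext) (simp add: A[symmetric] cinner_add_right)
  have A_scaleC: "A r (a *\<^sub>C y) = a *\<^sub>C A r y" for r a y
    by (rule cinner_ext) (simp add: A[symmetric] cinner_scaleC_right)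
  have "\<forall>r. \<exists>\<beta>\<ge>0. \<forall>x. norm (B r x) \<le> norm x * \<beta>"
    using bounded bounded_linear.nonneg_bounded by (auto simp: bounded_clinear_def)
  then obtain \<beta> where \<beta>: "\<And>r. \<beta> r \<ge> 0" "\<And>r x. norm (B r x) \<le> norm x * \<beta> r"
    by metis
  have A_le: "norm (A r y) \<le> norm y * \<beta> r" for r y
    by (rule adjoint_norm_le[OF A \<beta>(2,1)])
  have A_v: "(\<lambda>k. norm (A r (v k))) \<longlonglongrightarrow> 0" for r
  proof -
    have "(\<lambda>k. ereal (norm (A r (v k)))) \<longlonglongrightarrow> 0"
    proof (rule tendsto_sandwich[OF always_eventually always_eventually tendsto_const vanishing])
      show "\<forall>k. ereal (norm (A r (v k))) \<le> (SUP r. ereal (norm (cadjoint (B r) (v k))))"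
        unfolding A_def by (auto intro: SUP_upper)
    qed simp
    then show ?thesis
      by (simp add: zero_ereal_def)
  qed
  obtain w :: "nat \<Rightarrow> L2" where w: "orthonormal_sequence w" "total_sequence w" "\<And>n. w n \<in> smooth_L2"
    and w_odd: "\<And>n i. odd n \<Longrightarrow> i \<le> n \<Longrightarrow>
      sup_deriv i (w n) \<le> (1 / 2) ^ n / (1 + (\<Sum>m<n. \<Sum>j\<le>n. sup_deriv j (w m)))"
    using smooth_orthonormal_basis by blast
  define c where "c n i = sup_deriv i (w n)" for n i
  have c_nonneg: "0 \<le> c n i" for n i
    by (simp add: c_def sup_deriv_nonneg w)
  \<comment> \<open>One number dominating the sup norms of all derivatives of order at most n of w
    0, ..., w n; the added 1 permits division by it.\<close>
  define Q where "Q n = 1 + (\<Sum>m\<le>n. \<Sum>j\<le>n. c m j)" for n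
  have Q_ge1: "1 \<le> Q n" for n
    by (simp add: Q_def sum_nonneg c_nonneg)
  have c_le_Q: "c m i \<le> Q n" if "m \<le> n" "i \<le> n" for m i n
    using double_sum_ge_term[of c "{..n}" "{..n}" m i] that c_nonneg by (simp add: Q_def)
  \<comment> \<open>The square of Q pays for the product of two sup norms in a matrix entry.\<close>
  define \<eta> where "\<eta> n = (1 / 2) ^ n / (Q n * Q n)" for n
  have \<eta>_pos: "\<eta> n > 0" for n
    using Q_ge1[of n] by (simp add: \<eta>_def)
  obtain x where x: "orthonormal_sequence x" "total_sequence x"
    and x1: "\<And>n r. even n \<Longrightarrow> r \<le> n \<Longrightarrow> norm (A r (x n)) \<le> \<eta> n"
    and x2: "\<And>n r m. even n \<Longrightarrow> r \<le> n \<Longrightarrow> m < n \<Longrightarrow> cmod (cinner (x n) (A r (x m))) \<le> \<eta> n"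
    using adapted_orthonormal_basis[of A d v \<eta>, OF A_add A_scaleC d orthonormal A_v \<eta>_pos] by blast
  obtain U :: "'h \<Rightarrow> L2" where U: "unitary U" "\<And>n. U (x n) = w n"
    using orthonormal_bases_unitary[OF x w(1,2)] by blast
  have U_cinner: "cinner (U y) (U z) = cinner y z" for y z
    using U(1) by (simp add: unitary_def)
  have U_norm: "norm (U y) = norm y" for y
    using U_cinner[of y y] by (simp add: cinner_self flip: of_real_power)
  have U_inv: "U (inv U f) = f" for f
    using U(1) by (simp add: unitary_def bij_is_surj surj_f_inv_f)
  \<comment> \<open>For p < N the second factor is a summand of S, by which the first was divided in
    advance. For p = N both factors belong to w N, and the second is at most 1.\<close>
  have odd_pair: "c N i * c p j \<le> (1 / 2) ^ N" if "odd N" "i \<le> N" "j \<le> N" "p \<le> N" for N i p j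
  proof -
    define S where "S = (\<Sum>m<N. \<Sum>j\<le>N. c m j)"
    have "S \<ge> 0"
      by (simp add: S_def sum_nonneg c_nonneg)
    have cN: "c N k \<le> (1 / 2) ^ N / (1 + S)" if "k \<le> N" for k
      using w_odd[OF \<open>odd N\<close> that] by (simp add: c_def S_def)
    have "c p j \<le> 1 + S"
    proof (cases "p = N")
      case True
      have "(1 / 2 :: real) ^ N / (1 + S) \<le> 1"
        using \<open>S \<ge> 0\<close> by (simp add: divide_le_eq power_le_one add_increasing2)
      with cN[OF \<open>j \<le> N\<close>] \<open>S \<ge> 0\<close> show ?thesis
        unfolding True by linarith
    next
      case False
      then show ?thesis
        using double_sum_ge_term[of c "{..<N}" "{..N}" p j] that c_nonneg by (simp add: S_def)
    qed
    then have "c N i * c p j \<le> (1 / 2) ^ N / (1 + S) * (1 + S)"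
      using cN[OF \<open>i \<le> N\<close>] \<open>S \<ge> 0\<close> by (intro mult_mono c_nonneg) auto
    then show ?thesis
      using \<open>S \<ge> 0\<close> by simp
  qed
  have \<eta>_pair: "\<eta> N * c n i * c m j \<le> (1 / 2) ^ N"
    if "n \<le> N" "m \<le> N" "i \<le> N" "j \<le> N" for N n m i j
  proof -
    have "\<eta> N * (c n i * c m j) \<le> \<eta> N * (Q N * Q N)"
      using \<eta>_pos[of N] Q_ge1[of N] that
      by (intro mult_left_mono mult_mono c_le_Q c_nonneg) auto
    also have "\<dots> = (1 / 2) ^ N"
      using Q_ge1[of N] by (simp add: \<eta>_def)
    finally show ?thesis
      by (simp add: mult.assoc)
  qed
  have "carleman_operator (U \<circ> B r \<circ> inv U) \<and>
      (\<exists>K. SK_infinity_kernel K \<and> is_kernel_of K (U \<circ> B r \<circ> inv U))" for r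
  proof -
    define t where "t n = U (A r (x n))" for n
    have t_norm: "norm (t n) \<le> \<beta> r" for n
      using A_le[of r "x n"] by (simp add: t_def U_norm orthonormal_sequence_norm[OF x(1)])
    have entry: "cinner (t n) (w m) = cinner (A r (x n)) (x m)" for n m
      by (simp add: t_def U_cinner flip: U(2))
    have entry_le: "cmod (cinner (t n) (w m)) \<le> norm (A r (x n))" for n m
      using norm_cinner_le[of "A r (x n)" "x m"]
      by (simp add: entry orthonormal_sequence_norm[OF x(1)])
    interpret decaying_matrix w t
    proof
      fix i
      show "summable (\<lambda>n. sup_deriv i (w n) * norm (t n))"
      proof (rule summable_comparison_test')
        \<comment> \<open>The constant 1 + \<beta> r serves both parities: even terms need the
          factor 1, odd terms the bound \<beta> r of \<open>norm (t n)\<close>.\<close>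
        show "summable (\<lambda>n. (1 + \<beta> r) * (1 / 2) ^ n)"
          by (intro summable_mult summable_geometric) simp
        fix n
        \<comment> \<open>From r on the vectors are adapted to B r; from i on the functions are
          controlled up to order i.\<close>
        assume n: "max r i \<le> n"
        have "c n i * norm (t n) \<le> (1 + \<beta> r) * (1 / 2) ^ n"
        proof (cases "even n")
          case True
          have "c n i * norm (t n) \<le> Q n * \<eta> n"
            using n x1[OF True, of r] c_nonneg Q_ge1[of n]
            by (intro mult_mono c_le_Q) (auto simp: t_def U_norm)
          also have "\<dots> = (1 / 2) ^ n / Q n"
            using Q_ge1[of n] by (simp add: \<eta>_def)
          also have "\<dots> \<le> (1 / 2) ^ n / 1"
            using Q_ge1[of n] by (intro divide_left_mono) auto
          also have "\<dots> \<le> (1 + \<beta> r) * (1 / 2) ^ n"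
            using \<beta>(1)[of r] by simp
          finally show ?thesis .
        next
          case False
          have "c n i \<le> (1 / 2) ^ n / (1 + (\<Sum>m<n. \<Sum>j\<le>n. c m j))"
            using w_odd[OF False, of i] n by (simp add: c_def)
          also have "\<dots> \<le> (1 / 2) ^ n / 1"
            by (intro divide_left_mono) (auto simp: sum_nonneg c_nonneg add_pos_nonneg)
          finally have "c n i * norm (t n) \<le> (1 / 2) ^ n * (1 + \<beta> r)"
            using t_norm[of n] by (intro mult_mono) auto
          then show ?thesis
            by (simp add: mult.commute)
        qed
        then show "norm (sup_deriv i (w n) * norm (t n)) \<le> (1 + \<beta> r) * (1 / 2) ^ n"
          using c_nonneg[of n i] by (simp add: c_def)
      qed
    next
      fix i j
      have "cmod (cinner (t n) (w m)) * c n i * c m j \<le> (1 + \<beta> r) * (1 / 2) ^ N"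
        if N: "max r (max i j) \<le> N" "max n m = N" for n m N
      proof (cases "even N")
        case True
        have "cmod (cinner (t n) (w m)) \<le> \<eta> N"
        \<comment> \<open>For n = N the entry is at most the norm of \<open>A r (x N)\<close>. For m
          = N it is the conjugate of the product of x N with \<open>A r (x n)\<close>, a vector
          known before x N was chosen.\<close>
        proof (cases "n = N")
          case True
          then show ?thesis
            using entry_le[of n m] x1[OF \<open>even N\<close>, of r] N by simp
        next
          case False
          then have "m = N" "n < N"
            using N(2) by (auto simp: max_def split: if_splits)
          then have "cmod (cinner (x m) (A r (x n))) \<le> \<eta> N"
            using x2[OF \<open>even N\<close>, of r n] N by simp
          then show ?thesis
            by (subst entry, subst cinner_commute) (simp only: complex_mod_cnj)
        qed
        then have "cmod (cinner (t n) (w m)) * c n i * c m j \<le> \<eta> N * c n i * c m j"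
          by (intro mult_right_mono c_nonneg)
        also have "\<dots> \<le> (1 / 2) ^ N"
          using N by (intro \<eta>_pair) auto
        also have "\<dots> \<le> (1 + \<beta> r) * (1 / 2) ^ N"
          using \<beta>(1)[of r] by simp
        finally show ?thesis .
      next
        case False
        \<comment> \<open>For odd N all the decay comes from the function w N; the matrix entry is
          merely bounded.\<close>
        have "c n i * c m j \<le> (1 / 2) ^ N"
        proof (cases "n = N")
          case True
          then show ?thesis
            using odd_pair[of N i j m] False N by auto
        next
          case n: False
          then have "m = N" "n \<le> N"
            using N(2) by (auto simp: max_def split: if_splits)
          then show ?thesis
            using odd_pair[of N j i n] False N by (auto simp: mult.commute)
        qed
        moreover have "cmod (cinner (t n) (w m)) \<le> 1 + \<beta> r"
          using entry_le[of n m] t_norm[of n] by (simp add: t_def U_norm)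
        ultimately have "cmod (cinner (t n) (w m)) * (c n i * c m j) \<le> (1 + \<beta> r) * (1 / 2) ^ N"
          using \<beta>(1)[of r] by (intro mult_mono mult_nonneg_nonneg c_nonneg) auto
        then show ?thesis
          by (simp add: mult.assoc)
      qed
      then show "\<exists>C M. \<forall>n m. M \<le> max n m \<longrightarrow>
          cmod (cinner (t n) (w m)) * sup_deriv i (w n) * sup_deriv j (w m) \<le> C * (1 / 2) ^ max n m"
        unfolding c_def by blast
    qed (rule w)+
    have "cinner ((U \<circ> B r \<circ> inv U) f) (w n) = cinner f (t n)" for f n
    proof -
      have "cinner ((U \<circ> B r \<circ> inv U) f) (w n) = cinner (inv U f) (A r (x n))"
        by (simp add: U_cinner A flip: U(2))
      also have "\<dots> = cinner (U (inv U f)) (t n)"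
        by (simp only: t_def U_cinner)
      finally show ?thesis
        by (simp only: U_inv)
    qed
    then have "is_kernel_of (kernel 0 0) (U \<circ> B r \<circ> inv U)"
      by (rule kernel_is_kernel_of)
    moreover have "clinear (U \<circ> B r \<circ> inv U)"
      using bounded by (intro unitary_conjugate_clinear U(1)) (simp add: bounded_clinear_def)
    ultimately show ?thesis
      unfolding carleman_operator_def integral_operator_def
      using carleman_kernel_kernel SK_infinity_kernel_kernel by blast
  qed
  with U(1) show ?thesis
    by blast
qed

end
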